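(* Let $d\ge 2$, let $K\subset\mathbb{R}^d$ be a convex body with center at the point $0\in K$, and let $\gamma\ge 0$. Assume the following. (1) $Z=\{Z(x,t):\ x\in\mathbb{R}^d,\ t\in\mathbb{R}\}$ is a measurable, mean-square continuous Gaussian random field, homogeneous and isotropic in space and stationary in time, with $\mathbb{E}[Z(x,t)]=0$, $\mathbb{E}[Z^2(x,t)]=1$ and $\mathbb{E}[Z(x,t)Z(y,s)]=C(\|x-y\|,|t-s|)\ge 0$. (2) $C(z,\tau)\to 0$ if $\max\{z,\tau\}\to\infty$, and there exist $\delta_1\in(0,1)$ and $\delta_2\in(0,1)$ such that $$\lim_{T\to\infty}\frac{\sigma_{1,K}^2(T)}{T^{1+\delta_1}\,T^{\gamma d(1+\delta_2)}}=\infty .$$ (3) $u:\mathbb{R}_+\to\mathbb{R}$ is a continuous function with $u(T)\to\infty$ as $T\to\infty$, $u^2(T)=o(\log T)$ as $T\to\infty$, and, for some $\beta_1\in(0,\delta_1)$ and $\beta_2\in(0,\delta_2)$, $$u^2(T)\sup_{(z,\tau)\in B_T^{\beta_1,\beta_2}}C(z,\tau)\to 0\quad (T\to\infty),\qquad B_T^{\beta_1,\beta_2}=\{(z,\tau):\ \tau\ge T^{\beta_1}\ \text{or}\ z\ge T^{\gamma\beta_2}\},$$ where $z,\tau\ge 0$. Let $M(T)=\int_0^T\int_{T^\gamma K}\mathbb{I}_{\{Z(x,t)\ge u(T)\}}\,dx\,dt$. Then, as $T\to\infty$, the random variables $$\frac{M(T)-T^{1+\gamma d}|K|(1-\Phi(u(T)))}{\phi(u(T))\left[2T|K|^2T^{2\gamma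 d}\int_0^T\left(1-\frac{\tau}{T}\right)\int_0^{\mathcal{D}(T^\gamma K)}C(z,\tau)\,\psi_{\rho_{T^\gamma K}}(z)\,dz\,d\tau\right]^{1/2}}$$ and $$\frac{\int_0^T\int_{T^\gamma K}Z(x,t)\,dx\,dt}{\left[2T|K|^2T^{2\gamma d}\int_0^T\left(1-\frac{\tau}{T}\right)\int_0^{\mathcal{D}(T^\gamma K)}C(z,\tau)\,\psi_{\rho_{T^\gamma K}}(z)\,dz\,d\tau\right]^{1/2}}$$ have the same asymptotic distribution, that is, a standard normal distribution.
   Context: A convex body in $\mathbb{R}^d$ is a compact convex set with non-empty interior; $|K|$ is its Lebesgue measure. $T^\gamma K$ is the homothetic image of $K$ with center $0$ and scaling factor $T^\gamma$, and $\mathcal{D}(T^\gamma K)$ is its diameter. $\psi_{\rho_{T^\gamma K}}$ is the probability density of $\rho_{T^\gamma K}=\|P_1-P_2\|$, where $P_1,P_2$ are independent and uniformly distributed in $T^\gamma K$. $\phi(w)=\frac{1}{\sqrt{2\pi}}e^{-w^2/2}$ and $\Phi(v)=\int_{-\infty}^v\phi(w)\,dw$. Integrals of the random field are understood in the mean-square sense. Also $$\sigma_{1,K}^2(T)=\operatorname{Var}\Big(\int_0^T\int_{T^\gamma K}Z(x,t)\,dx\,dt\Big)=2T|K|^2T^{2\gamma d}\int_0^T\Big(1-\frac{\tau}{T}\Big)\int_0^{\mathcal{D}(T^\gamma K)}C(z,\tau)\,\psi_{\rho_{T^\gamma K}}(z)\,dz\,d\tau .$$ The function $z\mapsto\mathbb{I}_{\{z\ge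 u(T)\}}$ is square integrable with respect to the standard Gaussian measure and has Hermite rank one for every $T$, since its first Hermite coefficient is $\phi(u(T))\ne 0$. *)

theory Defs
  imports "HOL-Probability.Probability" "HOL-Library.Landau_Symbols"
begin

section \<open>Gaussian random fields in space and time\<close>

text \<open>
  A random field is a function \<open>Z x t \<omega>\<close> of a point \<open>x\<close> in space, a time \<open>t\<close> and an
  elementary event \<open>\<omega>\<close> of the probability space \<open>M\<close>.
\<close>

text \<open>The degenerate case (a point mass) counts as Gaussian.\<close>

definition gaussian_rv :: "'w measure \<Rightarrow> ('w \<Rightarrow> real) \<Rightarrow> bool" where
  "gaussian_rv M X \<longleftrightarrow>
     (\<exists>\<mu> \<sigma>. 0 < \<sigma> \<and> distributed M lborel X (\<lambda>y. ennreal (normal_density \<mu> \<sigma> y))) \<or>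
     (X \<in> borel_measurable M \<and> (\<exists>\<mu>. AE \<omega> in M. X \<omega> = \<mu>))"

definition gaussian_field :: "'w measure \<Rightarrow> ('a \<Rightarrow> real \<Rightarrow> 'w \<Rightarrow> real) \<Rightarrow> bool" where
  "gaussian_field M Z \<longleftrightarrow>
     (\<forall>(S :: ('a \<times> real) set) a. finite S \<longrightarrow>
        gaussian_rv M (\<lambda>\<omega>. \<Sum>(x, t)\<in>S. a (x, t) * Z x t \<omega>))"

definition measurable_field ::
    "'w measure \<Rightarrow> ('a::euclidean_space \<Rightarrow> real \<Rightarrow> 'w \<Rightarrow> real) \<Rightarrow> bool" where
  "measurable_field M Z \<longleftrightarrow>
     (\<lambda>((x, t), \<omega>). Z x t \<omega>) \<in> borel_measurable ((borel \<Otimes>\<^sub>M borel) \<Otimes>\<^sub>M M)"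

definition ms_continuous_field ::
    "'w measure \<Rightarrow> ('a::euclidean_space \<Rightarrow> real \<Rightarrow> 'w \<Rightarrow> real) \<Rightarrow> bool" where
  "ms_continuous_field M Z \<longleftrightarrow>
     (\<forall>x t. ((\<lambda>(y, s). \<integral>\<omega>. (Z y s \<omega> - Z x t \<omega>)\<^sup>2 \<partial>M) \<longlongrightarrow> 0) (at (x, t)))"

definition same_fdd :: "'w measure \<Rightarrow> ('p \<Rightarrow> 'w \<Rightarrow> real) \<Rightarrow> ('p \<Rightarrow> 'w \<Rightarrow> real) \<Rightarrow> bool" where
  "same_fdd M X Y \<longleftrightarrow>
     (\<forall>S. finite S \<longrightarrow>
        distr M (\<Pi>\<^sub>M p\<in>S. borel) (\<lambda>\<omega>. \<lambda>p\<in>S. X p \<omega>) =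
        distr M (\<Pi>\<^sub>M p\<in>S. borel) (\<lambda>\<omega>. \<lambda>p\<in>S. Y p \<omega>))"

definition homogeneous_in_space ::
    "'w measure \<Rightarrow> (real^'d \<Rightarrow> real \<Rightarrow> 'w \<Rightarrow> real) \<Rightarrow> bool" where
  "homogeneous_in_space M Z \<longleftrightarrow>
     (\<forall>h. same_fdd M (\<lambda>(x, t). Z (x + h) t) (\<lambda>(x, t). Z x t))"

definition isotropic_in_space ::
    "'w measure \<Rightarrow> (real^'d \<Rightarrow> real \<Rightarrow> 'w \<Rightarrow> real) \<Rightarrow> bool" where
  "isotropic_in_space M Z \<longleftrightarrow>
     (\<forall>Q. rotation_matrix Q \<longrightarrow> same_fdd M (\<lambda>(x, t). Z (Q *v x) t) (\<lambda>(x, t). Z x t))"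

definition stationary_in_time ::
    "'w measure \<Rightarrow> (real^'d \<Rightarrow> real \<Rightarrow> 'w \<Rightarrow> real) \<Rightarrow> bool" where
  "stationary_in_time M Z \<longleftrightarrow>
     (\<forall>h. same_fdd M (\<lambda>(x, t). Z x (t + h)) (\<lambda>(x, t). Z x t))"

section \<open>Mean-square integrals\<close>

text \<open>
  Tagged partitions of \<open>S\<close> into finitely many Borel pieces of diameter at most \<open>\<delta>\<close>; an element
  \<open>(p, A)\<close> is a piece \<open>A\<close> with its tag \<open>p\<close>. General Borel pieces are used because convex
  bodies are not unions of boxes.
\<close>

definition fine_partition ::
    "real \<Rightarrow> 'a::euclidean_space set \<Rightarrow> ('a \<times> 'a set) set \<Rightarrow> bool" where
  "fine_partition \<delta> S P \<longleftrightarrow>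
     finite P \<and> disjoint_family_on snd P \<and> \<Union>(snd ` P) = S \<and>
     (\<forall>(p, A)\<in>P. p \<in> A \<and> A \<in> sets borel \<and> (\<forall>x\<in>A. \<forall>y\<in>A. dist x y \<le> \<delta>))"

text \<open>The mean-square integral is the limit in \<open>L\<^sup>2(M)\<close> of the Riemann sums.\<close>

definition has_ms_integral ::
    "'w measure \<Rightarrow> ('a::euclidean_space \<Rightarrow> 'w \<Rightarrow> real) \<Rightarrow> 'a set \<Rightarrow> ('w \<Rightarrow> real) \<Rightarrow> bool" where
  "has_ms_integral M X S I \<longleftrightarrow>
     I \<in> borel_measurable M \<and> integrable M (\<lambda>\<omega>. (I \<omega>)\<^sup>2) \<and>
     (\<forall>\<epsilon>>0. \<exists>\<delta>>0. \<forall>P. fine_partition \<delta> S P \<longrightarrow>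
        (\<integral>\<^sup>+\<omega>. ennreal ((I \<omega> - (\<Sum>(p, A)\<in>P. measure lborel A * X p \<omega>))\<^sup>2) \<partial>M) < ennreal \<epsilon>)"

text \<open>The integral is only determined almost surely; an arbitrary version is chosen.\<close>

definition ms_integral ::
    "'w measure \<Rightarrow> 'a::euclidean_space set \<Rightarrow> ('a \<Rightarrow> 'w \<Rightarrow> real) \<Rightarrow> 'w \<Rightarrow> real" where
  "ms_integral M S X = (SOME I. has_ms_integral M X S I)"

section \<open>Functionals of the field over growing domains\<close>

definition convex_body :: "'a::euclidean_space set \<Rightarrow> bool" where
  "convex_body K \<longleftrightarrow> compact K \<and> convex K \<and> interior K \<noteq> {}"

definition homothetic :: "real \<Rightarrow> real \<Rightarrow> 'a::real_vector set \<Rightarrow> 'a set" where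
  "homothetic \<gamma> T K = (\<lambda>x. (T powr \<gamma>) *\<^sub>R x) ` K"

definition linear_functional ::
    "'w measure \<Rightarrow> (real^'d \<Rightarrow> real \<Rightarrow> 'w \<Rightarrow> real) \<Rightarrow> (real^'d) set \<Rightarrow> real \<Rightarrow> real \<Rightarrow> 'w \<Rightarrow> real" where
  "linear_functional M Z K \<gamma> T =
     ms_integral M {0..T} (\<lambda>t. ms_integral M (homothetic \<gamma> T K) (\<lambda>x \<omega>. Z x t \<omega>))"

definition sojourn_functional ::
    "'w measure \<Rightarrow> (real^'d \<Rightarrow> real \<Rightarrow> 'w \<Rightarrow> real) \<Rightarrow> (real^'d) set \<Rightarrow> real \<Rightarrow> (real \<Rightarrow> real) \<Rightarrow>
       real \<Rightarrow> 'w \<Rightarrow> real" where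
  "sojourn_functional M Z K \<gamma> u T =
     ms_integral M {0..T}
       (\<lambda>t. ms_integral M (homothetic \<gamma> T K) (\<lambda>x \<omega>. indicator {u T..} (Z x t \<omega>)))"

definition linear_variance ::
    "'w measure \<Rightarrow> (real^'d \<Rightarrow> real \<Rightarrow> 'w \<Rightarrow> real) \<Rightarrow> (real^'d) set \<Rightarrow> real \<Rightarrow> real \<Rightarrow> real" where
  "linear_variance M Z K \<gamma> T = prob_space.variance M (linear_functional M Z K \<gamma> T)"

text \<open>
  The Lebesgue density of the distance between two independent uniformly distributed points
  of \<open>A\<close>.
\<close>

definition distance_density :: "'a::euclidean_space set \<Rightarrow> real \<Rightarrow> real" where
  "distance_density A z =
     enn2real (RN_deriv lborel
       (distr (uniform_measure lborel A \<Otimes>\<^sub>M uniform_measure lborel A) lborel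
          (\<lambda>(p, q). norm (p - q))) z)"

definition variance_formula ::
    "(real \<Rightarrow> real \<Rightarrow> real) \<Rightarrow> (real^'d) set \<Rightarrow> real \<Rightarrow> real \<Rightarrow> real" where
  "variance_formula C K \<gamma> T =
     2 * T * (measure lborel K)\<^sup>2 * T powr (2 * \<gamma> * real CARD('d)) *
     (LBINT \<tau>:{0..T}. (1 - \<tau> / T) *
        (LBINT z:{0..diameter (homothetic \<gamma> T K)}.
           C z \<tau> * distance_density (homothetic \<gamma> T K) z))"

definition far_region :: "real \<Rightarrow> real \<Rightarrow> real \<Rightarrow> real \<Rightarrow> (real \<times> real) set" where
  "far_region \<gamma> \<beta>1 \<beta>2 T =
     {(z, \<tau>). 0 \<le> z \<and> 0 \<le> \<tau> \<and> (T powr \<beta>1 \<le> \<tau> \<or> T powr (\<gamma> * \<beta>2) \<le> z)}"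

section \<open>Limit distributions\<close>

definition std_normal_cdf :: "real \<Rightarrow> real" where
  "std_normal_cdf v = (LBINT w:{..v}. std_normal_density w)"

text \<open>The analogue of \<open>weak_conv_m\<close> for a real parameter tending to infinity.\<close>

definition converges_in_distribution ::
    "'w measure \<Rightarrow> (real \<Rightarrow> 'w \<Rightarrow> real) \<Rightarrow> real measure \<Rightarrow> bool" where
  "converges_in_distribution M X N \<longleftrightarrow>
     (\<forall>\<^sub>F T in at_top. X T \<in> borel_measurable M) \<and>
     (\<forall>y. isCont (cdf N) y \<longrightarrow>
        ((\<lambda>T. cdf (distr M borel (X T)) y) \<longlongrightarrow> cdf N y) at_top)"

end

theory Submission
  imports Defs
begin

text \<open>
  Split the exceedance indicator into its mean, its Hermite projection \<open>\<phi>(u) * Z\<close> of rank one and a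
  remainder. After normalisation the projection is the linear functional divided by its standard
  deviation, which is exactly standard normal as a mean-square limit of Gaussian variables, so it
  suffices that the normalised integral of the remainder tends to \<open>0\<close> in mean square. The
  covariance of the remainder at two points with correlation \<open>r\<close> is at most
  \<open>\<phi>(u)\<^sup>2 * r * (exp (u\<^sup>2 * r) / sqrt (1 - r\<^sup>2) - 1)\<close>, by Plackett's formula for the orthant
  probability. On pairs of points in the far region, where \<open>u\<^sup>2 * r\<close> is small, this is
  negligible against \<open>\<phi>(u)\<^sup>2 * r\<close>, whose integral is the squared normalisation. On the remaining
  pairs the covariance is bounded by \<open>1\<close>, and their measure is of smaller order than
  \<open>\<phi>(u)\<^sup>2\<close> times the variance, because \<open>exp (u\<^sup>2)\<close> grows slower than every power of \<open>T\<close>.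
\<close>

section \<open>Gaussian pairs\<close>

text \<open>An upper bound on the remainder covariance suffices, because it is integrated into a
  second moment, which is nonnegative. The bound has to be linear in the correlation
  \<open>r\<close>, since only the integral of \<open>r\<close> over all pairs is the squared
  normalisation; integrating Plackett's derivative over \<open>{0..r}\<close> supplies this factor.
  Three obstacles shape the rest. Gaussianity is given for finite linear combinations, so the
  independence behind regression has to be extracted from characteristic functions. The functionals
  are iterated mean-square integrals of which an arbitrary version is chosen, so they are identified
  almost surely with a single Lebesgue integral of the paths over space-time, where Fubini applies.
  And the normalisation is written with a Radon-Nikodym derivative, which represents the distance
  between two uniform points only because the law of that distance is absolutely continuous.\<close>

text \<open>The density \<open>g / c\<close> changes the measure without changing the characteristic
  function of \<open>Y\<close>, hence without changing its law. The bounds 1 and 3 fit the weights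
  \<open>2 + cos\<close>, \<open>2 + sin\<close> and \<open>1 + indicator\<close> used below:
  positive weights stay within probability measures, to which Levy uniqueness applies.\<close>

lemma (in prob_space) weighted_expectation_eq:
  fixes g Y :: "'a \<Rightarrow> real" and c :: real
  assumes [measurable]: "g \<in> borel_measurable M" "Y \<in> borel_measurable M"
    and g: "\<And>w. 1 \<le> g w" "\<And>w. g w \<le> 3"
    and char_g: "\<And>b. expectation (\<lambda>w. g w *\<^sub>R iexp (b * Y w)) = c *\<^sub>R expectation (\<lambda>w. iexp (b * Y w))"
    and [measurable]: "B \<in> sets borel"
  shows "expectation (\<lambda>w. g w * indicator B (Y w)) = c * prob {w\<in>space M. Y w \<in> B}"
proof -
  have int_g: "integrable M g"
    by (rule integrable_const_bound[where B=3])
      (use g in \<open>auto intro!: AE_I2 simp: abs_of_pos order_trans[OF _ g(1), of 0]\<close>)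
  \<comment> \<open>The case \<open>b = 0\<close> identifies \<open>c\<close> as the mean of
    \<open>g\<close>.\<close>
  have "expectation (\<lambda>w. g w *\<^sub>R (1::complex)) = c *\<^sub>R 1"
    using char_g[of 0] by (simp add: prob_space)
  moreover have "expectation (\<lambda>w. g w *\<^sub>R (1::complex)) = expectation g *\<^sub>R 1"
    using int_g by (subst integral_scaleR_left) auto
  ultimately have c: "expectation g = c"
    by (metis scaleR_right_imp_eq zero_neq_one)
  have "1 \<le> expectation g"
    using integral_mono[OF integrable_const int_g, of 1] g by (simp add: prob_space)
  then have "c > 0" using c by simp
  define N where "N = density M (\<lambda>w. ennreal (g w / c))"
  have gpos: "0 \<le> g w / c" for w
    using g(1)[of w] \<open>c > 0\<close> by simp
  have "emeasure N (space N) = 1"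
  proof -
    have "emeasure N (space N) = (\<integral>\<^sup>+w. ennreal (g w / c) \<partial>M)"
      by (simp add: N_def emeasure_density cong: nn_integral_cong)
    also have "\<dots> = ennreal (expectation (\<lambda>w. g w / c))"
      using int_g gpos by (intro nn_integral_eq_integral) auto
    finally show ?thesis using c \<open>c > 0\<close> by simp
  qed
  then interpret N: prob_space N by (rule prob_spaceI)
  have meas_N[measurable]: "Y \<in> borel_measurable N" by (simp add: N_def)
  have "distr N borel Y = distr M borel Y"
  proof (rule Levy_uniqueness)
    show "real_distribution (distr N borel Y)" by simp
    show "real_distribution (distr M borel Y)" by simp
    show "char (distr N borel Y) = char (distr M borel Y)"
    proof
      fix b
      have "char (distr N borel Y) b = (\<integral>w. iexp (b * Y w) \<partial>N)"
        by (simp add: char_def integral_distr)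
      also have "\<dots> = (\<integral>w. (g w / c) *\<^sub>R iexp (b * Y w) \<partial>M)"
        unfolding N_def using gpos by (subst integral_density) auto
      also have "\<dots> = (1 / c) *\<^sub>R (\<integral>w. g w *\<^sub>R iexp (b * Y w) \<partial>M)"
        by (subst integral_scaleR_right[symmetric]) (simp add: field_simps)
      also have "\<dots> = char (distr M borel Y) b"
        unfolding char_g using \<open>c > 0\<close> by (simp add: char_def integral_distr)
      finally show "char (distr N borel Y) b = char (distr M borel Y) b" .
    qed
  qed
  then have "measure (distr N borel Y) B = measure (distr M borel Y) B" by simp
  then have 1: "measure N {w\<in>space M. Y w \<in> B} = prob {w\<in>space M. Y w \<in> B}"
    by (simp add: measure_distr N_def vimage_def Int_def conj_commute)
  have "expectation (\<lambda>w. g w * indicator B (Y w)) = c * (\<integral>w. (g w / c) *\<^sub>R (indicator B (Y w) :: real) \<partial>M)"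
    using \<open>c > 0\<close> by (subst integral_mult_right_zero[symmetric]) (simp add: field_simps)
  also have "(\<integral>w. (g w / c) *\<^sub>R (indicator B (Y w) :: real) \<partial>M) = (\<integral>w. indicator B (Y w) \<partial>N)"
    unfolding N_def using gpos by (subst integral_density) auto
  also have "\<dots> = (\<integral>w. indicator {w\<in>space M. Y w \<in> B} w \<partial>N)"
    by (intro Bochner_Integration.integral_cong) (auto simp: N_def indicator_def)
  also have "\<dots> = measure N {w\<in>space M. Y w \<in> B}"
    by (simp add: N_def)
  finally show ?thesis using 1 by simp
qed

lemma cos_scaleR_iexp: "cos x *\<^sub>R iexp y = (1/2) * iexp (x + y) + (1/2) * iexp (- x + y)"
  unfolding cis_conv_exp[symmetric]
  by (intro complex_eqI; simp add: cos_add sin_add; simp add: cos_diff sin_diff field_simps)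

lemma sin_scaleR_iexp: "sin x *\<^sub>R iexp y = (-\<i>/2) * iexp (x + y) + (\<i>/2) * iexp (- x + y)"
  unfolding cis_conv_exp[symmetric]
  by (intro complex_eqI; simp add: cos_add sin_add; simp add: cos_diff sin_diff field_simps)

text \<open>Kac's criterion, reduced to uniqueness in one dimension. Weighting by trigonometric
  functions of \<open>a * X\<close> turns the factorisation into one over events of
  \<open>Y\<close>; weighting by such an event then turns the characteristic function of
  \<open>X\<close> into events of \<open>X\<close>.\<close>

lemma (in prob_space) indep_varI_char:
  fixes X Y :: "'a \<Rightarrow> real"
  assumes [measurable]: "X \<in> borel_measurable M" "Y \<in> borel_measurable M"
    and fact: "\<And>a b. expectation (\<lambda>w. iexp (a * X w + b * Y w))
      = expectation (\<lambda>w. iexp (a * X w)) * expectation (\<lambda>w. iexp (b * Y w))"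
  shows "indep_var borel X borel Y"
proof -
  define \<phi> where "\<phi> a = expectation (\<lambda>w. iexp (a * X w))" for a
  have int_iexp: "integrable M (\<lambda>w. iexp (f w))" if [measurable]: "f \<in> borel_measurable M" for f
    by (rule integrable_iexp) auto
  have int_bdd: "integrable M f" if [measurable]: "f \<in> borel_measurable M"
      and "\<And>w. norm (f w) \<le> 3" for f :: "'a \<Rightarrow> complex"
    using that(2) by (intro integrable_const_bound[where B=3]) auto
  have int_bddr: "integrable M f" if [measurable]: "f \<in> borel_measurable M"
      and "\<And>w. norm (f w) \<le> 3" for f :: "'a \<Rightarrow> real"
    using that(2) by (intro integrable_const_bound[where B=3]) auto
  have lin: "expectation (\<lambda>w. 2 * f w + k * g w + l * h w) = 2 * expectation f + k * expectation g + l * expectation h"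
    if "integrable M f" "integrable M g" "integrable M h" for f g h :: "'a \<Rightarrow> complex" and k l
    using that by simp
  have bnd: "1 \<le> 2 + cos x" "2 + cos x \<le> 3" "1 \<le> 2 + sin x" "2 + sin x \<le> 3" "\<bar>cos x\<bar> \<le> 3" "\<bar>sin x\<bar> \<le> 3" for x :: real
    using cos_ge_minus_one[of x] cos_le_one[of x] sin_ge_minus_one[of x] sin_le_one[of x] by linarith+
  have Re_\<phi>: "Re (\<phi> a) = expectation (\<lambda>w. cos (a * X w))" for a
    using integral_Re[OF int_iexp[of "\<lambda>w. a * X w"]] by (simp add: \<phi>_def Re_exp)
  have Im_\<phi>: "Im (\<phi> a) = expectation (\<lambda>w. sin (a * X w))" for a
    using integral_Im[OF int_iexp[of "\<lambda>w. a * X w"]] by (simp add: \<phi>_def Im_exp)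
  have minus: "\<phi> (- a) = cnj (\<phi> a)" for a
    by (intro complex_eqI) (simp_all add: Re_\<phi> Im_\<phi>)
  \<comment> \<open>One argument serves cosine and sine: \<open>k\<close> and \<open>l\<close> are
    the coefficients in Euler's formula and \<open>m\<close> is the mean of
    \<open>f (a * X w)\<close>. The constant 2 makes the weight positive and is subtracted again at
    the end.\<close>
  have trigE: "expectation (\<lambda>w. f (a * X w) * indicator B (Y w)) = m * prob {w\<in>space M. Y w \<in> B}"
    if [measurable]: "f \<in> borel_measurable borel" "B \<in> sets borel"
      and bnd: "\<And>x. 1 \<le> 2 + f x" "\<And>x. 2 + f x \<le> 3" "\<And>x. \<bar>f x\<bar> \<le> 3"
      and split: "\<And>x y. f x *\<^sub>R iexp y = k * iexp (x + y) + l * iexp (- x + y)"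
      and m: "k * \<phi> a + l * \<phi> (- a) = of_real m"
    for f :: "real \<Rightarrow> real" and a m k l B
  proof -
    have "expectation (\<lambda>w. (2 + f (a * X w)) *\<^sub>R iexp (b * Y w)) = (2 + m) *\<^sub>R expectation (\<lambda>w. iexp (b * Y w))" for b
    proof -
      have "(2 + f (a * X w)) *\<^sub>R iexp (b * Y w) =
        2 * iexp (b * Y w) + k * iexp (a * X w + b * Y w) + l * iexp ((- a) * X w + b * Y w)" for w
        unfolding scaleR_add_left split by (simp add: scaleR_conv_of_real add.assoc)
      then have "expectation (\<lambda>w. (2 + f (a * X w)) *\<^sub>R iexp (b * Y w)) =
        expectation (\<lambda>w. 2 * iexp (b * Y w) + k * iexp (a * X w + b * Y w) + l * iexp ((- a) * X w + b * Y w))"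
        by (intro Bochner_Integration.integral_cong refl)
      also have "\<dots> = 2 * expectation (\<lambda>w. iexp (b * Y w)) + k * expectation (\<lambda>w. iexp (a * X w + b * Y w))
        + l * expectation (\<lambda>w. iexp ((- a) * X w + b * Y w))"
        by (intro lin int_iexp) measurable
      also have "\<dots> = (2 + (k * \<phi> a + l * \<phi> (- a))) * expectation (\<lambda>w. iexp (b * Y w))"
        unfolding fact \<phi>_def[symmetric] by (simp only: ring_distribs mult.assoc add.assoc)
      finally show ?thesis by (simp add: scaleR_conv_of_real m)
    qed
    from weighted_expectation_eq[OF _ _ bnd(1,2) this that(2)]
    have "expectation (\<lambda>w. (2 + f (a * X w)) * indicator B (Y w)) = (2 + m) * prob {w\<in>space M. Y w \<in> B}"
      by simp
    moreover have "expectation (\<lambda>w. (2 + f (a * X w)) * indicator B (Y w)) =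
      2 * expectation (\<lambda>w. indicator B (Y w)) + expectation (\<lambda>w. f (a * X w) * indicator B (Y w))"
      by (simp add: distrib_right, subst Bochner_Integration.integral_add)
        (auto intro!: int_bddr simp: indicator_def bnd)
    moreover have "expectation (\<lambda>w. indicator B (Y w)) = prob {w\<in>space M. Y w \<in> B}"
      by (subst Bochner_Integration.integral_cong[OF refl, of _ _ "indicator {w\<in>space M. Y w \<in> B}"]) (auto simp: indicator_def)
    ultimately show ?thesis by (simp add: algebra_simps)
  qed
  have cosE: "expectation (\<lambda>w. cos (a * X w) * indicator B (Y w)) = Re (\<phi> a) * prob {w\<in>space M. Y w \<in> B}"
    if "B \<in> sets borel" for a B
    by (rule trigE[OF _ that bnd(1,2,5) cos_scaleR_iexp]) (measurable, unfold minus, intro complex_eqI, simp_all)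
  have sinE: "expectation (\<lambda>w. sin (a * X w) * indicator B (Y w)) = Im (\<phi> a) * prob {w\<in>space M. Y w \<in> B}"
    if "B \<in> sets borel" for a B
    by (rule trigE[OF _ that bnd(3,4,6) sin_scaleR_iexp]) (measurable, unfold minus, intro complex_eqI, simp_all)
  have prod: "prob {w\<in>space M. X w \<in> A \<and> Y w \<in> B} = prob {w\<in>space M. X w \<in> A} * prob {w\<in>space M. Y w \<in> B}"
    if [measurable]: "A \<in> sets borel" "B \<in> sets borel" for A B
  proof -
    let ?p = "prob {w\<in>space M. Y w \<in> B}"
    have iexpE: "expectation (\<lambda>w. indicator B (Y w) *\<^sub>R iexp (a * X w)) = ?p *\<^sub>R \<phi> a" for a
    proof -
      have int: "integrable M (\<lambda>w. indicator B (Y w) *\<^sub>R iexp (a * X w))"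
        by (intro int_bdd) (auto simp: indicator_def)
      have "Re (expectation (\<lambda>w. indicator B (Y w) *\<^sub>R iexp (a * X w))) = expectation (\<lambda>w. cos (a * X w) * indicator B (Y w))"
        by (subst integral_Re[OF int, symmetric]) (simp add: Re_exp mult.commute)
      moreover have "Im (expectation (\<lambda>w. indicator B (Y w) *\<^sub>R iexp (a * X w))) = expectation (\<lambda>w. sin (a * X w) * indicator B (Y w))"
        by (subst integral_Im[OF int, symmetric]) (simp add: Im_exp mult.commute)
      ultimately show ?thesis
        unfolding cosE[OF that(2)] sinE[OF that(2)] by (intro complex_eqI) (simp_all add: mult.commute)
    qed
    \<comment> \<open>The second pass, with the roles exchanged: the event of \<open>Y\<close> is
      now the weight, shifted by 1 to be positive.\<close>
    have "expectation (\<lambda>w. (1 + indicator B (Y w)) *\<^sub>R iexp (a * X w)) = (1 + ?p) *\<^sub>R expectation (\<lambda>w. iexp (a * X w))" for a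
    proof -
      have "expectation (\<lambda>w. 1 *\<^sub>R iexp (a * X w) + indicator B (Y w) *\<^sub>R iexp (a * X w)) =
        expectation (\<lambda>w. 1 *\<^sub>R iexp (a * X w)) + expectation (\<lambda>w. indicator B (Y w) *\<^sub>R iexp (a * X w))"
        by (intro Bochner_Integration.integral_add int_bdd) (auto simp: indicator_def)
      then show ?thesis
        unfolding iexpE \<phi>_def by (simp add: scaleR_add_left)
    qed
    from weighted_expectation_eq[OF _ _ _ _ this that(1)]
    have "expectation (\<lambda>w. (1 + indicator B (Y w)) * indicator A (X w)) = (1 + ?p) * prob {w\<in>space M. X w \<in> A}"
      by (auto simp: indicator_def)
    also have "expectation (\<lambda>w. (1 + indicator B (Y w)) * indicator A (X w) :: real) =
      expectation (\<lambda>w. indicator {w\<in>space M. X w \<in> A} w + indicator {w\<in>space M. X w \<in> A \<and> Y w \<in> B} w)"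
      by (intro Bochner_Integration.integral_cong) (auto simp: indicator_def)
    also have "\<dots> = prob {w\<in>space M. X w \<in> A} + prob {w\<in>space M. X w \<in> A \<and> Y w \<in> B}"
      by (subst Bochner_Integration.integral_add) (auto simp: less_top[symmetric])
    finally show ?thesis by (simp add: algebra_simps)
  qed
  have "distr M borel X \<Otimes>\<^sub>M distr M borel Y = distr M (borel \<Otimes>\<^sub>M borel) (\<lambda>x. (X x, Y x))"
  proof (rule pair_measure_eqI)
    show "sigma_finite_measure (distr M borel X)" "sigma_finite_measure (distr M borel Y)"
      by (auto intro!: prob_space_imp_sigma_finite prob_space_distr)
    show "sets (distr M borel X \<Otimes>\<^sub>M distr M borel Y) = sets (distr M (borel \<Otimes>\<^sub>M borel) (\<lambda>x. (X x, Y x)))"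
      by (subst sets_distr, rule sets_pair_measure_cong) simp_all
    fix A B assume "A \<in> sets (distr M borel X)" "B \<in> sets (distr M borel Y)"
    then have [measurable]: "A \<in> sets borel" "B \<in> sets borel" by auto
    have eqs: "X -` A \<inter> space M = {w\<in>space M. X w \<in> A}" "Y -` B \<inter> space M = {w\<in>space M. Y w \<in> B}"
      "(\<lambda>x. (X x, Y x)) -` (A \<times> B) \<inter> space M = {w\<in>space M. X w \<in> A \<and> Y w \<in> B}" by auto
    show "emeasure (distr M borel X) A * emeasure (distr M borel Y) B =
           emeasure (distr M (borel \<Otimes>\<^sub>M borel) (\<lambda>x. (X x, Y x))) (A \<times> B)"
      by (simp add: emeasure_distr eqs emeasure_eq_measure prod ennreal_mult)
  qed
  then show ?thesis by (subst indep_var_distribution_eq) auto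
qed

section \<open>Gaussian variables and regression\<close>

lemma integrable_mult_squares:
  fixes f g :: "'a \<Rightarrow> real"
  assumes [measurable]: "f \<in> borel_measurable M" "g \<in> borel_measurable M"
    and "integrable M (\<lambda>x. (f x)\<^sup>2)" "integrable M (\<lambda>x. (g x)\<^sup>2)"
  shows "integrable M (\<lambda>x. f x * g x)"
proof (rule Bochner_Integration.integrable_bound[OF Bochner_Integration.integrable_add[OF assms(3,4)]])
  have "\<bar>a * b\<bar> \<le> a\<^sup>2 + b\<^sup>2" for a b :: real
  proof -
    have "2 * \<bar>a * b\<bar> \<le> a\<^sup>2 + b\<^sup>2"
      using sum_squares_bound[of "\<bar>a\<bar>" "\<bar>b\<bar>"] by (simp add: abs_mult)
    then show ?thesis by linarith
  qed
  then show "AE x in M. norm (f x * g x) \<le> norm ((f x)\<^sup>2 + (g x)\<^sup>2)"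
    by (auto simp: abs_mult)
qed measurable

lemma (in prob_space) distributed_std_normalI_char:
  assumes [measurable]: "X \<in> borel_measurable M"
    and char: "\<And>t. expectation (\<lambda>w. iexp (t * X w)) = of_real (exp (- t\<^sup>2 / 2))"
  shows "distr M borel X = std_normal_distribution"
proof (rule Levy_uniqueness)
  show "real_distribution std_normal_distribution" by (rule real_dist_normal_dist)
  show "char (distr M borel X) = char std_normal_distribution"
    unfolding char_std_normal_distribution by (rule ext) (simp add: char_def[of "distr M borel X"] integral_distr char[simplified])
qed simp

lemma (in prob_space) gaussian_rv_measurable:
  "gaussian_rv M X \<Longrightarrow> X \<in> borel_measurable M"
  unfolding gaussian_rv_def by (auto dest: distributed_measurable)

text \<open>Both alternatives of \<open>gaussian_rv\<close> obey one formula, the point mass being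
  the case of variance 0; Riemann sums may therefore be degenerate later on.\<close>

lemma (in prob_space) gaussian_rv_char:
  assumes "gaussian_rv M X" and mean: "expectation X = 0"
  shows "expectation (\<lambda>w. iexp (t * X w)) = of_real (exp (- (expectation (\<lambda>w. (X w)\<^sup>2) * t\<^sup>2 / 2)))"
  using assms(1) unfolding gaussian_rv_def
proof (elim disjE exE conjE)
  fix \<mu> \<sigma> :: real assume \<sigma>: "0 < \<sigma>" and D: "distributed M lborel X (\<lambda>y. ennreal (normal_density \<mu> \<sigma> y))"
  have [measurable]: "X \<in> borel_measurable M" using distributed_measurable[OF D] by simp
  have "\<mu> = 0" using normal_distributed_expectation[OF \<sigma> D] mean by simp
  have var: "expectation (\<lambda>w. (X w)\<^sup>2) = \<sigma>\<^sup>2"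
    using normal_distributed_variance[OF \<sigma> D] mean by simp
  have "distributed M lborel (\<lambda>w. (X w - \<mu>) / \<sigma>) std_normal_density"
    using D normal_standard_normal_convert[OF \<sigma>] by blast
  then have D': "distr M lborel (\<lambda>w. X w / \<sigma>) = std_normal_distribution"
    unfolding distributed_def \<open>\<mu> = 0\<close> by simp
  have "expectation (\<lambda>w. iexp (t * X w)) = expectation (\<lambda>w. iexp ((t * \<sigma>) * (X w / \<sigma>)))"
    using \<sigma> by simp
  also have "\<dots> = (\<integral>x. iexp ((t * \<sigma>) * x) \<partial>distr M lborel (\<lambda>w. X w / \<sigma>))"
    by (subst integral_distr) auto
  also have "\<dots> = char std_normal_distribution (t * \<sigma>)"
    unfolding D' by (simp add: char_def)
  finally show ?thesis
    by (simp add: char_std_normal_distribution var power_mult_distrib mult.commute)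
next
  fix \<mu> assume [measurable]: "X \<in> borel_measurable M" and AE: "AE w in M. X w = \<mu>"
  have "expectation X = expectation (\<lambda>_. \<mu>)" using AE by (intro integral_cong_AE) auto
  then have "\<mu> = 0" using mean by (simp add: prob_space)
  have "expectation (\<lambda>w. (X w)\<^sup>2) = expectation (\<lambda>_. 0)"
    using AE \<open>\<mu> = 0\<close> by (intro integral_cong_AE) auto
  moreover have "expectation (\<lambda>w. iexp (t * X w)) = expectation (\<lambda>_. 1)"
    using AE \<open>\<mu> = 0\<close> by (intro integral_cong_AE) auto
  ultimately show ?thesis by (simp add: prob_space)
qed

text \<open>The residual \<open>X - r * Y\<close> is uncorrelated with \<open>Y\<close>. Every
  combination of \<open>Y\<close> and \<open>W\<close> is one of \<open>X\<close> and
  \<open>Y\<close>, hence Gaussian and determined by its variance, so the joint characteristic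
  function splits.\<close>

lemma (in prob_space) gaussian_pair_regression:
  fixes X Y :: "'a \<Rightarrow> real" and r :: real
  defines "W \<equiv> \<lambda>w. (X w - r * Y w) / sqrt (1 - r\<^sup>2)"
  assumes gauss: "\<And>a b. gaussian_rv M (\<lambda>w. a * X w + b * Y w)"
    and mean: "expectation X = 0" "expectation Y = 0"
    and sq: "expectation (\<lambda>w. (X w)\<^sup>2) = 1" "expectation (\<lambda>w. (Y w)\<^sup>2) = 1"
    and cov: "expectation (\<lambda>w. X w * Y w) = r" and r: "\<bar>r\<bar> < 1"
  shows "indep_var borel Y borel W"
    and "distr M borel Y = std_normal_distribution"
    and "distr M borel W = std_normal_distribution"
proof -
  have [measurable]: "X \<in> borel_measurable M" "Y \<in> borel_measurable M"
    using gaussian_rv_measurable[OF gauss[of 1 0]] gaussian_rv_measurable[OF gauss[of 0 1]] by simp_all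
  have [measurable]: "W \<in> borel_measurable M" unfolding W_def by measurable
  have int2: "integrable M (\<lambda>w. (X w)\<^sup>2)" "integrable M (\<lambda>w. (Y w)\<^sup>2)"
    using sq by (metis not_integrable_integral_eq zero_neq_one)+
  have int: "integrable M X" "integrable M Y" "integrable M (\<lambda>w. X w * Y w)"
    using int2 square_integrable_imp_integrable[of X] square_integrable_imp_integrable[of Y] integrable_mult_squares[of X M Y]
    by auto
  have s: "0 < 1 - r\<^sup>2" using r by (simp add: abs_square_less_1)
  define s where "s = sqrt (1 - r\<^sup>2)"
  have s0: "s > 0" "s\<^sup>2 = 1 - r\<^sup>2" using s by (auto simp: s_def)
  have sq_lin: "expectation (\<lambda>w. (a * X w + b * Y w)\<^sup>2) = a\<^sup>2 + b\<^sup>2 + 2 * a * b * r" for a b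
  proof -
    have "(a * X w + b * Y w)\<^sup>2 = a\<^sup>2 * (X w)\<^sup>2 + b\<^sup>2 * (Y w)\<^sup>2 + (2 * a * b) * (X w * Y w)" for w
      by algebra
    then show ?thesis using int2 int sq cov by simp
  qed
  have mean0: "expectation (\<lambda>w. a * X w + b * Y w) = 0" for a b
  proof -
    have "expectation (\<lambda>w. a * X w + b * Y w) = expectation (\<lambda>w. a * X w) + expectation (\<lambda>w. b * Y w)"
      by (intro Bochner_Integration.integral_add integrable_mult_right int)
    then show ?thesis by (simp add: mean)
  qed
  have char_lin: "expectation (\<lambda>w. iexp (1 * (a * X w + b * Y w))) = of_real (exp (- ((a\<^sup>2 + b\<^sup>2 + 2 * a * b * r) / 2)))" for a b
    using gaussian_rv_char[OF gauss mean0, of 1 a b] by (simp only: sq_lin power_one mult_1_right)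
  have char_YW: "expectation (\<lambda>w. iexp (a * Y w + b * W w)) = of_real (exp (- ((a\<^sup>2 + b\<^sup>2) / 2)))" for a b
  proof -
    \<comment> \<open>The combination \<open>a * Y + b * W\<close> in the coordinates
      \<open>X\<close>, \<open>Y\<close>; the factor 1 is the argument of the characteristic
      function in \<open>char_lin\<close>.\<close>
    have 1: "1 * (b / s * X w + (a - b * r / s) * Y w) = a * Y w + b * W w" for w
      unfolding W_def s_def[symmetric] by (simp add: algebra_simps diff_divide_distrib)
    have "k\<^sup>2 + (a - k * r)\<^sup>2 + 2 * k * (a - k * r) * r = a\<^sup>2 + k\<^sup>2 * (1 - r\<^sup>2)" for k
      by algebra
    from this[of "b / s"] have 2: "(b / s)\<^sup>2 + (a - b * r / s)\<^sup>2 + 2 * (b / s) * (a - b * r / s) * r = a\<^sup>2 + b\<^sup>2"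
      using s0 s by (simp add: power_divide)
    show ?thesis using char_lin[of "b / s" "a - b * r / s"] unfolding 1 2 .
  qed
  have cY: "expectation (\<lambda>w. iexp (a * Y w)) = of_real (exp (- a\<^sup>2 / 2))" for a
    using char_YW[of a 0] by simp
  have cW: "expectation (\<lambda>w. iexp (b * W w)) = of_real (exp (- b\<^sup>2 / 2))" for b
    using char_YW[of 0 b] by simp
  show "distr M borel Y = std_normal_distribution" by (rule distributed_std_normalI_char[OF _ cY]) measurable
  show "distr M borel W = std_normal_distribution" by (rule distributed_std_normalI_char[OF _ cW]) measurable
  show "indep_var borel Y borel W"
  proof (rule indep_varI_char)
    fix a b :: real
    have "exp (- ((a\<^sup>2 + b\<^sup>2) / 2)) = exp (- a\<^sup>2 / 2) * exp (- b\<^sup>2 / 2)"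
      unfolding exp_add[symmetric] by (simp add: add_divide_distrib)
    then show "expectation (\<lambda>w. iexp (a * Y w + b * W w)) = expectation (\<lambda>w. iexp (a * Y w)) * expectation (\<lambda>w. iexp (b * W w))"
      unfolding char_YW cY cW by (simp only: of_real_mult)
  qed auto
qed

section \<open>The standard normal density and Plackett's derivative\<close>

lemma std_normal_density_mult:
  "std_normal_density x * std_normal_density y = exp (- (x\<^sup>2 + y\<^sup>2) / 2) / (2 * pi)"
proof -
  have "exp (- x\<^sup>2 / 2) * exp (- y\<^sup>2 / 2) = exp (- (x\<^sup>2 + y\<^sup>2) / 2)"
    unfolding exp_add[symmetric] by (simp add: add_divide_distrib diff_divide_distrib)
  moreover have "sqrt (2 * pi) * sqrt (2 * pi) = 2 * pi"
    by (simp add: real_sqrt_mult_self)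
  ultimately show ?thesis
    by (simp add: std_normal_density_def del: real_sqrt_mult_self)
qed

lemma DERIV_std_normal_density:
  "(std_normal_density has_real_derivative (- x * std_normal_density x)) (at x)"
proof -
  have "((\<lambda>x::real. - x\<^sup>2 / 2) has_real_derivative - x) (at x)"
    by (auto intro!: derivative_eq_intros)
  from DERIV_cmult[OF DERIV_chain2[OF DERIV_exp this], of "1 / sqrt (2 * pi)"]
  show ?thesis
    unfolding std_normal_density_def[abs_def] by (simp add: mult_ac)
qed

lemma std_normal_density_le_1: "std_normal_density x \<le> 1"
proof -
  have "1 * 1 \<le> 2 * pi" using pi_gt3 by linarith
  then have "1 \<le> sqrt (2 * pi)" by simp
  moreover have "exp (- x\<^sup>2 / 2) \<le> 1" by simp
  ultimately have "exp (- x\<^sup>2 / 2) \<le> sqrt (2 * pi)" by linarith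
  then show ?thesis unfolding std_normal_density_def by (simp add: divide_le_eq_1 split: if_splits) 
qed

lemma std_normal_density_tendsto_at_top: "(std_normal_density \<longlongrightarrow> 0) at_top"
proof -
  have "filterlim (\<lambda>x::real. x\<^sup>2 / 2) at_top at_top"
    by (rule filterlim_at_top_mono[of "\<lambda>x. x / 2"])
      (auto intro!: eventually_at_top_linorderI[of 1] filterlim_tendsto_pos_mult_at_top[of "\<lambda>_. 1/2" "1/2", simplified] filterlim_ident
        simp: power2_eq_square)
  then have "((\<lambda>x::real. exp (- (x\<^sup>2 / 2))) \<longlongrightarrow> 0) at_top"
    by (intro filterlim_compose[OF exp_at_bot] filterlim_uminus_at_bot_at_top[THEN filterlim_compose])
  then show ?thesis
    unfolding std_normal_density_def[abs_def] by (auto intro: tendsto_eq_intros)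
qed

text \<open>A primitive on the whole line lets the fundamental theorem turn masses of intervals into
  differences; its additive constant cancels there.\<close>

lemma std_normal_antiderivative: "\<exists>G. \<forall>x. (G has_real_derivative std_normal_density x) (at x)"
proof -
  have "\<exists>F. \<forall>x::real. (-\<infinity>::ereal) < x \<longrightarrow> x < \<infinity> \<longrightarrow> (F has_vector_derivative std_normal_density x) (at x)"
    by (rule einterval_antiderivative, simp) (rule DERIV_isCont[OF DERIV_std_normal_density])
  then show ?thesis
    by (simp add: has_real_derivative_iff_has_vector_derivative)
qed

text \<open>Conditionally on \<open>Y = y\<close>, the standard normal pair with correlation \<open>s\<close> exceeds \<open>u\<close> iff the
  residual exceeds \<open>(u - s * y) / sqrt (1 - s\<^sup>2)\<close>.\<close>

definition cond_level :: "real \<Rightarrow> real \<Rightarrow> real \<Rightarrow> real" where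
  "cond_level u s y = (u - s * y) / sqrt (1 - s\<^sup>2)"

text \<open>The derivative in the correlation \<open>s\<close> of the conditional exceedance
  probability given \<open>Y = y\<close>: minus the density at \<open>cond_level\<close>, times the
  derivative of \<open>cond_level\<close> in \<open>s\<close>.\<close>

definition plackett_kernel :: "real \<Rightarrow> real \<Rightarrow> real \<Rightarrow> real" where
  "plackett_kernel u s y = std_normal_density (cond_level u s y) * ((y - u * s) / (sqrt (1 - s\<^sup>2)) ^ 3)"

context
  fixes u r :: real
  assumes u: "0 \<le> u" and r: "0 \<le> r" "r < 1"
begin

lemma one_minus_sq_pos: "0 \<le> s \<Longrightarrow> s \<le> r \<Longrightarrow> 0 < 1 - s\<^sup>2"
  using r by (simp add: abs_square_less_1)

lemma DERIV_cond_level: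
  assumes "0 \<le> s" "s \<le> r"
  shows "((\<lambda>s. cond_level u s y) has_real_derivative (- ((y - u * s) / (sqrt (1 - s\<^sup>2)) ^ 3))) (at s)"
proof -
  let ?q = "sqrt (1 - s\<^sup>2)"
  have p: "0 < 1 - s\<^sup>2" using one_minus_sq_pos[OF assms] .
  then have q: "?q > 0" "?q\<^sup>2 = 1 - s\<^sup>2" by auto
  have dq: "((\<lambda>s. sqrt (1 - s\<^sup>2)) has_real_derivative (- s / ?q)) (at s)"
    using p by (auto intro!: derivative_eq_intros simp: divide_simps)
  have "((\<lambda>s. cond_level u s y) has_real_derivative ((- y * ?q - (u - s * y) * (- s / ?q)) / (?q * ?q))) (at s)"
    unfolding cond_level_def using q by (intro DERIV_divide dq) (auto intro!: derivative_eq_intros)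
  also have "(- y * ?q - (u - s * y) * (- s / ?q)) / (?q * ?q) = (- y * ?q\<^sup>2 + (u - s * y) * s) / ?q ^ 3"
    using q(1) by (simp add: field_simps power2_eq_square power3_eq_cube)
  also have "- y * ?q\<^sup>2 + (u - s * y) * s = - (y - u * s)"
    unfolding q(2) by (simp add: algebra_simps power2_eq_square)
  finally show ?thesis by (simp only: minus_divide_left)
qed

text \<open>As \<open>s\<close> runs from 0 to \<open>r\<close>, the level falls from
  \<open>u\<close> to \<open>cond_level u r y\<close>, because \<open>u * s \<le> u \<le> y\<close>.
  The mass gained between these two levels is the integral of the kernel.\<close>

lemma residual_tail_le:
  assumes y: "u \<le> y"
  shows "emeasure std_normal_distribution {cond_level u r y..} \<le> emeasure std_normal_distribution {u..} +
    (\<integral>\<^sup>+s. ennreal (plackett_kernel u s y) * indicator {0..r} s \<partial>lborel)"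
proof -
  obtain G where G: "\<And>x. (G has_real_derivative std_normal_density x) (at x)"
    using std_normal_antiderivative by blast
  have pos: "0 \<le> (y - u * s) / (sqrt (1 - s\<^sup>2)) ^ 3" if "0 \<le> s" "s \<le> r" for s
  proof -
    have "u * s \<le> u * 1" using that r u by (intro mult_left_mono) auto
    then have "u * s \<le> y" using y by linarith
    then show ?thesis using one_minus_sq_pos[OF that] by simp
  qed
  have level0: "cond_level u 0 y = u" by (simp add: cond_level_def)
  have "cond_level u r y \<le> cond_level u 0 y"
    by (rule DERIV_nonpos_imp_nonincreasing[OF r(1)])
      (metis DERIV_cond_level neg_le_0_iff_le pos)
  then have dec: "cond_level u r y \<le> u" by (simp only: level0)
  have "emeasure std_normal_distribution {cond_level u r y..} \<le> emeasure std_normal_distribution ({cond_level u r y..u} \<union> {u..})"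
    by (intro emeasure_mono) auto
  also have "\<dots> \<le> emeasure std_normal_distribution {cond_level u r y..u} + emeasure std_normal_distribution {u..}"
    by (intro emeasure_subadditive) auto
  also have "emeasure std_normal_distribution {cond_level u r y..u} = (\<integral>\<^sup>+x. ennreal (std_normal_density x) * indicator {cond_level u r y..u} x \<partial>lborel)"
    by (simp add: emeasure_density)
  also have "\<dots> = ennreal (G u - G (cond_level u r y))"
    by (rule nn_integral_FTC_Icc) (auto intro: G dec)
  also have "\<dots> = ennreal ((- G (cond_level u r y)) - (- G (cond_level u 0 y)))" by (simp add: level0)
  also have "\<dots> = (\<integral>\<^sup>+s. ennreal (std_normal_density (cond_level u s y) * ((y - u * s) / (sqrt (1 - s\<^sup>2)) ^ 3)) * indicator {0..r} s \<partial>lborel)"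
  proof (rule nn_integral_FTC_Icc[symmetric])
    show "(\<lambda>s. std_normal_density (cond_level u s y) * ((y - u * s) / (sqrt (1 - s\<^sup>2)) ^ 3)) \<in> borel_measurable borel"
      unfolding cond_level_def by measurable
    fix s assume s: "s \<in> {0..r}"
    show "((\<lambda>s. - G (cond_level u s y)) has_real_derivative std_normal_density (cond_level u s y) * ((y - u * s) / (sqrt (1 - s\<^sup>2)) ^ 3)) (at s)"
      using DERIV_minus[OF DERIV_chain2[OF G DERIV_cond_level[of s y]]] s by simp
    show "0 \<le> std_normal_density (cond_level u s y) * ((y - u * s) / (sqrt (1 - s\<^sup>2)) ^ 3)"
      using mult_nonneg_nonneg[OF normal_density_nonneg pos] s by simp
  qed (use r in auto)
  finally show ?thesis unfolding plackett_kernel_def by (simp only: add.commute)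
qed

text \<open>Times the density of \<open>y\<close>, the kernel is an exact derivative in
  \<open>y\<close>, and the boundary term at \<open>u\<close> is the bivariate normal density at
  \<open>(u, u)\<close>. The bound is uniform in \<open>s\<close>, so integrating it over
  \<open>{0..r}\<close> yields the factor \<open>r\<close>.\<close>

lemma plackett_integral:
  assumes s: "0 \<le> s" "s \<le> r"
  shows "(\<integral>\<^sup>+y. ennreal (std_normal_density y * plackett_kernel u s y) * indicator {u..} y \<partial>lborel)
    \<le> ennreal ((std_normal_density u)\<^sup>2 * exp (u\<^sup>2 * r) / sqrt (1 - r\<^sup>2))"
proof -
  let ?q = "sqrt (1 - s\<^sup>2)"
  have p: "0 < 1 - s\<^sup>2" using one_minus_sq_pos[OF s] .
  then have q: "?q > 0" "?q\<^sup>2 = 1 - s\<^sup>2" by auto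
  let ?H = "\<lambda>y. - (std_normal_density y * std_normal_density (cond_level u s y) / ?q)"
  have "(\<integral>\<^sup>+y. ennreal (std_normal_density y * (std_normal_density (cond_level u s y) * ((y - u * s) / ?q ^ 3))) * indicator {u..} y \<partial>lborel)
    = ennreal (0 - ?H u)"
  proof (rule nn_integral_FTC_atLeast[where F="?H"])
    show "(\<lambda>y. std_normal_density y * (std_normal_density (cond_level u s y) * ((y - u * s) / ?q ^ 3))) \<in> borel_measurable borel"
      unfolding cond_level_def by measurable
    fix y assume y: "u \<le> y"
    have dlevel: "((\<lambda>y. cond_level u s y) has_real_derivative (- s / ?q)) (at y)"
      unfolding cond_level_def using q by (auto intro!: derivative_eq_intros simp: field_simps)
    have "(?H has_real_derivative (- (((- y * std_normal_density y) * std_normal_density (cond_level u s y)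
        + ((- cond_level u s y * std_normal_density (cond_level u s y)) * (- s / ?q)) * std_normal_density y) / ?q))) (at y)"
      by (intro DERIV_minus DERIV_cdivide DERIV_mult DERIV_std_normal_density DERIV_chain2[OF DERIV_std_normal_density dlevel])
    also have "- (((- y * std_normal_density y) * std_normal_density (cond_level u s y)
        + ((- cond_level u s y * std_normal_density (cond_level u s y)) * (- s / ?q)) * std_normal_density y) / ?q)
      = std_normal_density y * std_normal_density (cond_level u s y) * ((y - cond_level u s y * s / ?q) / ?q)"
      by (simp add: algebra_simps add_divide_distrib diff_divide_distrib)
    also have "(y - cond_level u s y * s / ?q) / ?q = (y * ?q\<^sup>2 - (u - s * y) * s) / ?q ^ 3"
      using q(1) unfolding cond_level_def by (simp add: field_simps power2_eq_square power3_eq_cube)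
    also have "y * ?q\<^sup>2 - (u - s * y) * s = y - u * s"
      unfolding q(2) by (simp add: algebra_simps power2_eq_square)
    finally show "(?H has_real_derivative std_normal_density y * (std_normal_density (cond_level u s y) * ((y - u * s) / ?q ^ 3))) (at y)"
      by (simp add: mult.assoc)
    have "u * s \<le> u * 1" using s r u by (intro mult_left_mono) auto
    then show "0 \<le> std_normal_density y * (std_normal_density (cond_level u s y) * ((y - u * s) / ?q ^ 3))"
      using y p by simp
  next
    have "((\<lambda>y. std_normal_density y * std_normal_density (cond_level u s y)) \<longlongrightarrow> 0) at_top"
    proof (rule tendsto_sandwich[OF _ _ tendsto_const std_normal_density_tendsto_at_top])
      show "\<forall>\<^sub>F y in at_top. std_normal_density y * std_normal_density (cond_level u s y) \<le> std_normal_density y"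
        by (auto intro!: always_eventually mult_left_le std_normal_density_le_1)
    qed simp
    from tendsto_minus[OF tendsto_divide[OF this tendsto_const[of ?q]]] q
    show "(?H \<longlongrightarrow> 0) at_top" by simp
  qed
  also have "\<dots> \<le> ennreal ((std_normal_density u)\<^sup>2 * exp (u\<^sup>2 * r) / sqrt (1 - r\<^sup>2))"
  proof (rule ennreal_leI)
    \<comment> \<open>On the diagonal \<open>1 - s\<^sup>2\<close> cancels against one factor
      \<open>1 - s\<close>. The exponent of the bivariate density becomes
      \<open>- u\<^sup>2 / (1 + s)\<close>, which exceeds \<open>- u\<^sup>2\<close> by at most
      \<open>u\<^sup>2 * r\<close>.\<close>
    have "cond_level u s u = u * (1 - s) / ?q" by (simp add: cond_level_def algebra_simps)
    then have "(cond_level u s u)\<^sup>2 = u\<^sup>2 * ((1 - s)\<^sup>2 / ?q\<^sup>2)"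
      by (simp add: power_mult_distrib power_divide)
    also have "(1 - s)\<^sup>2 / ?q\<^sup>2 = 1 - 2 * s / (1 + s)"
      unfolding q(2) using p s r by (simp add: field_simps power2_eq_square) 
    finally have t: "(cond_level u s u)\<^sup>2 = u\<^sup>2 - 2 * (u\<^sup>2 * (s / (1 + s)))"
      by (simp add: algebra_simps)
    have "s / (1 + s) \<le> s / 1" using s by (intro divide_left_mono) auto
    then have "u\<^sup>2 * (s / (1 + s)) \<le> u\<^sup>2 * r" using s by (intro mult_left_mono) auto
    moreover have "- (a + b) / 2 \<le> - (a + a) / 2 + c" if "b = a - 2 * k" "k \<le> c" for a b c k :: real
      using that by (simp add: field_simps)
    ultimately have "- (u\<^sup>2 + (cond_level u s u)\<^sup>2) / 2 \<le> - (u\<^sup>2 + u\<^sup>2) / 2 + u\<^sup>2 * r" using t by blast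
    then have "exp (- (u\<^sup>2 + (cond_level u s u)\<^sup>2) / 2) \<le> exp (- (u\<^sup>2 + u\<^sup>2) / 2) * exp (u\<^sup>2 * r)"
      unfolding exp_add[symmetric] by simp
    then have 1: "std_normal_density u * std_normal_density (cond_level u s u) \<le> (std_normal_density u)\<^sup>2 * exp (u\<^sup>2 * r)"
      unfolding power2_eq_square[of "std_normal_density u"] std_normal_density_mult
      by (simp add: divide_right_mono)
    have "s\<^sup>2 \<le> r\<^sup>2" using s by (intro power_mono) auto
    then have "sqrt (1 - r\<^sup>2) \<le> ?q" by simp
    moreover have "0 < sqrt (1 - r\<^sup>2)" using one_minus_sq_pos[of r] r by simp
    ultimately show "0 - ?H u \<le> (std_normal_density u)\<^sup>2 * exp (u\<^sup>2 * r) / sqrt (1 - r\<^sup>2)"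
      using frac_le[OF _ 1, of "sqrt (1 - r\<^sup>2)" ?q] by simp
  qed
  finally show ?thesis unfolding plackett_kernel_def .
qed

end

section \<open>Orthant probabilities, Hermite coefficients and the remainder covariance\<close>

interpretation std_normal: real_distribution std_normal_distribution
  by (rule real_dist_normal_dist)

definition std_normal_tail :: "real \<Rightarrow> real" where
  "std_normal_tail u = measure std_normal_distribution {u..}"

lemma std_normal_tail_bounds: "0 \<le> std_normal_tail u" "std_normal_tail u \<le> 1"
  by (auto simp: std_normal_tail_def)

lemma std_normal_tail_eq: "std_normal_tail u = 1 - std_normal_cdf u"
proof -
  have "measure std_normal_distribution {u} = 0"
    by (simp add: measure_def emeasure_density nn_integral_indicator_singleton)
  then have "std_normal_tail u = measure std_normal_distribution {u<..}"
    using std_normal.finite_measure_Union[of "{u}" "{u<..}"]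
    by (simp add: std_normal_tail_def ivl_disj_un_singleton(1)[symmetric])
  also have "{u<..} = space std_normal_distribution - {..u}" by auto
  also have "measure std_normal_distribution \<dots> = 1 - measure std_normal_distribution {..u}"
    by (rule std_normal.prob_compl) simp
  also have "measure std_normal_distribution {..u} = std_normal_cdf u"
  proof -
    have "emeasure std_normal_distribution {..u} = (\<integral>\<^sup>+x. ennreal (indicator {..u} x * std_normal_density x) \<partial>lborel)"
      by (auto simp: emeasure_density indicator_def intro!: nn_integral_cong)
    also have "\<dots> = ennreal (std_normal_cdf u)"
      unfolding std_normal_cdf_def set_lebesgue_integral_def
      by (subst nn_integral_eq_integral) (auto intro!: integrable_mult_indicator[where 'b=real, simplified])
    finally show ?thesis
      unfolding measure_def
      by (simp add: std_normal_cdf_def set_lebesgue_integral_def)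
  qed
  finally show ?thesis .
qed

text \<open>Plackett's formula as an inequality: the squared tail is the value for independent
  variables, and the second term bounds the growth as the correlation rises from 0 to
  \<open>r\<close>. The proof conditions on \<open>Y\<close> and integrates
  \<open>residual_tail_le\<close>.\<close>

lemma (in prob_space) gaussian_orthant_le:
  fixes Y W :: "'a \<Rightarrow> real" and u r :: real
  assumes indep: "indep_var borel Y borel W"
    and Y: "distr M borel Y = std_normal_distribution"
    and W: "distr M borel W = std_normal_distribution"
    and u: "0 \<le> u" and r: "0 \<le> r" "r < 1"
  shows "prob {w\<in>space M. u \<le> r * Y w + sqrt (1 - r\<^sup>2) * W w \<and> u \<le> Y w}
    \<le> (std_normal_tail u)\<^sup>2 + r * ((std_normal_density u)\<^sup>2 * exp (u\<^sup>2 * r) / sqrt (1 - r\<^sup>2))"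
proof -
  let ?N = "std_normal_distribution" and ?q = "sqrt (1 - r\<^sup>2)"
  let ?c = "(std_normal_density u)\<^sup>2 * exp (u\<^sup>2 * r) / ?q"
  have [measurable]: "Y \<in> borel_measurable M" "W \<in> borel_measurable M"
    using indep by (auto dest: indep_var_rv1 indep_var_rv2)
  have q: "?q > 0" using one_minus_sq_pos[OF u r, of r] r by simp
  let ?S = "{p. u \<le> r * fst p + ?q * snd p \<and> u \<le> fst p}"
  have S[measurable]: "?S \<in> sets (borel \<Otimes>\<^sub>M borel)"
    unfolding borel_prod by (intro borel_closed closed_Collect_conj closed_Collect_le continuous_intros)
  have S': "?S \<in> sets (?N \<Otimes>\<^sub>M ?N)"
    using S by (simp cong: sets_pair_measure_cong)
  \<comment> \<open>Tonelli moves \<open>s\<close> to the outside, so that the inner integral over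
    \<open>y\<close> is the one evaluated in \<open>plackett_integral\<close>.\<close>
  have "(\<integral>\<^sup>+y. (\<integral>\<^sup>+s. ennreal (plackett_kernel u s y) * indicator {0..r} s * indicator {u..} y \<partial>lborel) \<partial>?N)
    = (\<integral>\<^sup>+y. (\<integral>\<^sup>+s. ennreal (std_normal_density y) * (ennreal (plackett_kernel u s y) * indicator {0..r} s * indicator {u..} y) \<partial>lborel) \<partial>lborel)"
    unfolding plackett_kernel_def cond_level_def by (subst nn_integral_density) (auto simp: nn_integral_cmult)
  also have "\<dots> = (\<integral>\<^sup>+s. (\<integral>\<^sup>+y. ennreal (std_normal_density y) * (ennreal (plackett_kernel u s y) * indicator {0..r} s * indicator {u..} y) \<partial>lborel) \<partial>lborel)"
    unfolding plackett_kernel_def cond_level_def by (rule lborel_pair.Fubini') measurable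
  also have "\<dots> \<le> (\<integral>\<^sup>+s. ennreal ?c * indicator {0..r} s \<partial>lborel)"
  proof (rule nn_integral_mono)
    fix s
    have eq: "(\<integral>\<^sup>+y. ennreal (std_normal_density y) * (ennreal (plackett_kernel u s y) * indicator {u..} y) \<partial>lborel)
      = (\<integral>\<^sup>+y. ennreal (std_normal_density y * plackett_kernel u s y) * indicator {u..} y \<partial>lborel)"
      by (intro nn_integral_cong) (simp only: ennreal_mult'[OF normal_density_nonneg] mult.assoc)
    show "(\<integral>\<^sup>+y. ennreal (std_normal_density y) * (ennreal (plackett_kernel u s y) * indicator {0..r} s * indicator {u..} y) \<partial>lborel)
      \<le> ennreal ?c * indicator {0..r} s"
      using plackett_integral[OF u r, of s, folded eq]
      by (cases "s \<in> {0..r}") auto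
  qed
  also have "\<dots> = ennreal ?c * ennreal r"
    using r by (subst nn_integral_cmult) auto
  also have "\<dots> = ennreal (r * ?c)"
    using r by (subst ennreal_mult''[symmetric]) (auto simp: mult.commute)
  finally have B: "(\<integral>\<^sup>+y. (\<integral>\<^sup>+s. ennreal (plackett_kernel u s y) * indicator {0..r} s * indicator {u..} y \<partial>lborel) \<partial>?N)
    \<le> ennreal (r * ?c)" .
  have "ennreal (prob {w\<in>space M. u \<le> r * Y w + ?q * W w \<and> u \<le> Y w})
    = emeasure (distr M (borel \<Otimes>\<^sub>M borel) (\<lambda>w. (Y w, W w))) ?S"
    by (subst emeasure_distr) (auto simp: emeasure_eq_measure intro!: arg_cong[where f=prob])
  also have "distr M (borel \<Otimes>\<^sub>M borel) (\<lambda>w. (Y w, W w)) = ?N \<Otimes>\<^sub>M ?N"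
    using indep unfolding indep_var_distribution_eq Y W by simp
  also have "emeasure (?N \<Otimes>\<^sub>M ?N) ?S = (\<integral>\<^sup>+y. emeasure ?N (Pair y -` ?S) \<partial>?N)"
    by (rule std_normal.emeasure_pair_measure_alt[OF S'])
  also have "\<dots> \<le> (\<integral>\<^sup>+y. indicator {u..} y * ennreal (std_normal_tail u) +
      (\<integral>\<^sup>+s. ennreal (plackett_kernel u s y) * indicator {0..r} s * indicator {u..} y \<partial>lborel) \<partial>?N)"
  proof (rule nn_integral_mono)
    fix y
    show "emeasure ?N (Pair y -` ?S) \<le> indicator {u..} y * ennreal (std_normal_tail u) +
      (\<integral>\<^sup>+s. ennreal (plackett_kernel u s y) * indicator {0..r} s * indicator {u..} y \<partial>lborel)"
    proof (cases "u \<le> y")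
      case True
      have "Pair y -` ?S = {cond_level u r y..}"
        using q True by (auto simp: cond_level_def field_simps)
      then show ?thesis
        using residual_tail_le[OF u r True] True
        by (simp add: std_normal_tail_def std_normal.emeasure_eq_measure)
    qed (simp add: vimage_def)
  qed
  also have "\<dots> = (\<integral>\<^sup>+y. indicator {u..} y * ennreal (std_normal_tail u) \<partial>?N) +
      (\<integral>\<^sup>+y. (\<integral>\<^sup>+s. ennreal (plackett_kernel u s y) * indicator {0..r} s * indicator {u..} y \<partial>lborel) \<partial>?N)"
    unfolding plackett_kernel_def cond_level_def by (rule nn_integral_add) measurable
  also have "(\<integral>\<^sup>+y. indicator {u..} y * ennreal (std_normal_tail u) \<partial>?N) = ennreal ((std_normal_tail u)\<^sup>2)"
    by (subst nn_integral_multc) (auto simp: std_normal_tail_def std_normal.emeasure_eq_measure ennreal_mult power2_eq_square)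
  also have "ennreal ((std_normal_tail u)\<^sup>2) + (\<integral>\<^sup>+y. (\<integral>\<^sup>+s. ennreal (plackett_kernel u s y) * indicator {0..r} s * indicator {u..} y \<partial>lborel) \<partial>?N)
    \<le> ennreal ((std_normal_tail u)\<^sup>2) + ennreal (r * ?c)"
    using B by (rule add_left_mono)
  also have "\<dots> = ennreal ((std_normal_tail u)\<^sup>2 + r * ?c)"
    using r q by (intro ennreal_plus[symmetric]) auto
  finally have "ennreal (prob {w\<in>space M. u \<le> r * Y w + ?q * W w \<and> u \<le> Y w}) \<le> ennreal ((std_normal_tail u)\<^sup>2 + r * ?c)" .
  moreover have "0 \<le> (std_normal_tail u)\<^sup>2 + r * ?c"
    using r q by (intro add_nonneg_nonneg mult_nonneg_nonneg divide_nonneg_nonneg) auto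
  ultimately show ?thesis by (simp only: ennreal_le_iff)
qed

text \<open>The first Hermite coefficient of the exceedance indicator, from
  \<open>- std_normal_density\<close> as a primitive of \<open>x * std_normal_density x\<close>. For
  \<open>0 \<le> u\<close> the integrand is nonnegative, so one computation gives integrability and
  value.\<close>

lemma std_normal_truncated_mean:
  assumes u: "0 \<le> u"
  shows "integrable std_normal_distribution (\<lambda>x. indicator {u..} x * x)"
    and "(\<integral>x. indicator {u..} x * x \<partial>std_normal_distribution) = std_normal_density u"
proof -
  have "(\<integral>\<^sup>+x. ennreal (indicator {u..} x * x) \<partial>std_normal_distribution) =
    (\<integral>\<^sup>+x. ennreal (std_normal_density x * x) * indicator {u..} x \<partial>lborel)"
    by (subst nn_integral_density) (auto intro!: nn_integral_cong simp: indicator_def ennreal_mult')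
  also have "\<dots> = ennreal (0 - (- std_normal_density u))"
  proof (rule nn_integral_FTC_atLeast[where F="\<lambda>x. - std_normal_density x"])
    fix x assume "u \<le> x"
    show "((\<lambda>x. - std_normal_density x) has_real_derivative std_normal_density x * x) (at x)"
      using DERIV_minus[OF DERIV_std_normal_density[of x]] by (simp add: mult.commute)
    show "0 \<le> std_normal_density x * x" using u \<open>u \<le> x\<close> by simp
  next
    show "((\<lambda>x. - std_normal_density x) \<longlongrightarrow> 0) at_top"
      using tendsto_minus[OF std_normal_density_tendsto_at_top] by (simp only: minus_zero)
  qed auto
  finally have "has_bochner_integral std_normal_distribution (\<lambda>x. indicator {u..} x * x) (std_normal_density u)"
    using u by (intro has_bochner_integral_nn_integral) (auto simp: indicator_def)
  then show "integrable std_normal_distribution (\<lambda>x. indicator {u..} x * x)"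
    "(\<integral>x. indicator {u..} x * x \<partial>std_normal_distribution) = std_normal_density u"
    by (auto simp: has_bochner_integral_iff)
qed

definition rank_one_remainder :: "real \<Rightarrow> real \<Rightarrow> real" where
  "rank_one_remainder u z = indicator {u..} z - std_normal_tail u - std_normal_density u * z"

lemma measurable_rank_one_remainder[measurable]: "rank_one_remainder u \<in> borel_measurable borel"
  unfolding rank_one_remainder_def[abs_def] by measurable

lemma (in prob_space) std_normal_exceedance:
  fixes X :: "'a \<Rightarrow> real"
  assumes [measurable]: "X \<in> borel_measurable M" and X: "distr M borel X = std_normal_distribution"
  shows "expectation (\<lambda>w. indicator {u..} (X w)) = std_normal_tail u"
    and "0 \<le> u \<Longrightarrow> expectation (\<lambda>w. indicator {u..} (X w) * X w) = std_normal_density u"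
proof -
  have "expectation (\<lambda>w. indicator {u..} (X w) :: real) = (\<integral>x. indicator {u..} x \<partial>distr M borel X)"
    by (subst integral_distr) auto
  then show "expectation (\<lambda>w. indicator {u..} (X w)) = std_normal_tail u"
    unfolding X by (simp add: std_normal_tail_def)
  have "expectation (\<lambda>w. indicator {u..} (X w) * X w) = (\<integral>x. indicator {u..} x * x \<partial>distr M borel X)"
    by (simp add: integral_distr)
  then show "0 \<le> u \<Longrightarrow> expectation (\<lambda>w. indicator {u..} (X w) * X w) = std_normal_density u"
    unfolding X by (simp add: std_normal_truncated_mean)
qed

lemma (in prob_space) square_integrableI:
  fixes X :: "'a \<Rightarrow> real"
  assumes "expectation (\<lambda>w. (X w)\<^sup>2) = 1"
  shows "integrable M (\<lambda>w. (X w)\<^sup>2)"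
  using assms by (metis not_integrable_integral_eq zero_neq_one)

text \<open>By orthogonality the second moment is the variance of the indicator minus the squared
  Hermite coefficient. The crude bound 1 is enough for close pairs, whose total measure is
  small.\<close>

lemma (in prob_space) rank_one_remainder_sq:
  fixes X :: "'a \<Rightarrow> real"
  assumes [measurable]: "X \<in> borel_measurable M" and X: "distr M borel X = std_normal_distribution"
    and mean: "expectation X = 0" and sq: "expectation (\<lambda>w. (X w)\<^sup>2) = 1" and u: "0 \<le> u"
  shows "integrable M (\<lambda>w. (rank_one_remainder u (X w))\<^sup>2)"
    and "expectation (\<lambda>w. (rank_one_remainder u (X w))\<^sup>2) \<le> 1"
proof -
  let ?Q = "std_normal_tail u" and ?p = "std_normal_density u"
  have int2: "integrable M (\<lambda>w. (X w)\<^sup>2)" by (rule square_integrableI[OF sq])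
  have int1: "integrable M X" by (rule square_integrable_imp_integrable[OF _ int2]) measurable
  have intI: "integrable M (\<lambda>w. indicator {u..} (X w) :: real)"
    by (intro integrable_const_bound[where B=1]) auto
  have intIX: "integrable M (\<lambda>w. indicator {u..} (X w) * X w)"
    by (rule Bochner_Integration.integrable_bound[OF int1]) (auto simp: indicator_def)
  have eq: "(rank_one_remainder u z)\<^sup>2 =
    (1 - 2 * ?Q) * indicator {u..} z + ?Q\<^sup>2 + ?p\<^sup>2 * z\<^sup>2 + 2 * ?Q * ?p * z - 2 * ?p * (indicator {u..} z * z)" for z
    by (cases "z \<in> {u..}") (simp_all add: rank_one_remainder_def power2_eq_square algebra_simps)
  show "integrable M (\<lambda>w. (rank_one_remainder u (X w))\<^sup>2)"
    unfolding eq using int2 int1 intI intIX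
    by (intro Bochner_Integration.integrable_add Bochner_Integration.integrable_diff integrable_mult_right integrable_const)
  have "expectation (\<lambda>w. (rank_one_remainder u (X w))\<^sup>2) = (1 - 2 * ?Q) * ?Q + ?Q\<^sup>2 + ?p\<^sup>2 * 1 + 2 * ?Q * ?p * 0 - 2 * ?p * ?p"
    unfolding eq
    by (simp add: int2 int1 intI intIX std_normal_exceedance[OF _ X] u mean sq prob_space)
  also have "\<dots> = ?Q - ?Q\<^sup>2 - ?p\<^sup>2" by (simp add: power2_eq_square algebra_simps)
  also have "\<dots> \<le> ?Q" by simp
  also have "\<dots> \<le> 1" by (rule std_normal_tail_bounds)
  finally show "expectation (\<lambda>w. (rank_one_remainder u (X w))\<^sup>2) \<le> 1" .
qed

text \<open>In \<open>X = r * Y + sqrt (1 - r\<^sup>2) * W\<close> the residual is centred and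
  independent of \<open>Y\<close>, so only the part along \<open>Y\<close> contributes.\<close>

lemma (in prob_space) gaussian_pair_exceedance_mixed:
  fixes X Y :: "'a \<Rightarrow> real"
  assumes gauss: "\<And>a b. gaussian_rv M (\<lambda>w. a * X w + b * Y w)"
    and mean: "expectation X = 0" "expectation Y = 0"
    and sq: "expectation (\<lambda>w. (X w)\<^sup>2) = 1" "expectation (\<lambda>w. (Y w)\<^sup>2) = 1"
    and cov: "expectation (\<lambda>w. X w * Y w) = r" and r: "\<bar>r\<bar> < 1" and u: "0 \<le> u"
  shows "expectation (\<lambda>w. indicator {u..} (Y w) * X w) = r * std_normal_density u"
proof -
  define W where "W = (\<lambda>w. (X w - r * Y w) / sqrt (1 - r\<^sup>2))"
  note reg = gaussian_pair_regression[OF gauss mean sq cov r, folded W_def]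
  have [measurable]: "X \<in> borel_measurable M" "Y \<in> borel_measurable M"
    using gaussian_rv_measurable[OF gauss[of 1 0]] gaussian_rv_measurable[OF gauss[of 0 1]] by simp_all
  have [measurable]: "W \<in> borel_measurable M" unfolding W_def by measurable
  have int: "integrable M X" "integrable M Y"
    using square_integrableI[OF sq(1)] square_integrableI[OF sq(2)] square_integrable_imp_integrable[of X] square_integrable_imp_integrable[of Y] by auto
  have intW: "integrable M W" unfolding W_def using int by simp
  have EW: "expectation W = 0"
  proof -
    have "expectation (\<lambda>w. X w - r * Y w) = 0"
      using int by (subst Bochner_Integration.integral_diff) (auto simp: mean)
    then show ?thesis unfolding W_def by simp
  qed
  have s: "sqrt (1 - r\<^sup>2) > 0" using r by (simp add: abs_square_less_1)
  have X_eq: "X w = r * Y w + sqrt (1 - r\<^sup>2) * W w" for w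
    using s by (simp add: W_def)
  have intIY: "integrable M (\<lambda>w. indicator {u..} (Y w) * Y w)"
    by (rule Bochner_Integration.integrable_bound[OF int(2)]) (auto simp: indicator_def)
  have intIW: "integrable M (\<lambda>w. indicator {u..} (Y w) * W w)"
    by (rule Bochner_Integration.integrable_bound[OF intW]) (auto simp: indicator_def)
  have "indep_var borel (indicator {u..} \<circ> Y) borel (id \<circ> W)"
    by (rule indep_var_compose[OF reg(1)]) auto
  then have "expectation (\<lambda>w. indicator {u..} (Y w) * W w) = expectation (\<lambda>w. indicator {u..} (Y w)) * expectation W"
    by (subst indep_var_lebesgue_integral[symmetric]) (auto simp: comp_def intW intro!: integrable_const_bound[where B=1])
  then have IW: "expectation (\<lambda>w. indicator {u..} (Y w) * W w) = 0" using EW by simp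
  have "(\<lambda>w. indicator {u..} (Y w) * X w) =
      (\<lambda>w. r * (indicator {u..} (Y w) * Y w) + sqrt (1 - r\<^sup>2) * (indicator {u..} (Y w) * W w))"
    by (subst X_eq) (simp add: algebra_simps)
  then have "expectation (\<lambda>w. indicator {u..} (Y w) * X w) =
    r * expectation (\<lambda>w. indicator {u..} (Y w) * Y w) + sqrt (1 - r\<^sup>2) * expectation (\<lambda>w. indicator {u..} (Y w) * W w)"
    using intIY intIW by simp
  then show ?thesis
    using std_normal_exceedance(2)[OF _ reg(2) u] by (simp add: IW)
qed

text \<open>Removing the mean cancels the squared tail of the orthant bound, and removing the
  rank-one term subtracts \<open>r\<close> times the squared density. What remains carries a bracket
  that vanishes as \<open>u\<^sup>2 * r\<close> and \<open>r\<close> tend to 0.\<close>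

lemma (in prob_space) rank_one_remainder_cov:
  fixes X Y :: "'a \<Rightarrow> real"
  assumes gauss: "\<And>a b. gaussian_rv M (\<lambda>w. a * X w + b * Y w)"
    and mean: "expectation X = 0" "expectation Y = 0"
    and sq: "expectation (\<lambda>w. (X w)\<^sup>2) = 1" "expectation (\<lambda>w. (Y w)\<^sup>2) = 1"
    and cov: "expectation (\<lambda>w. X w * Y w) = r" and r: "0 \<le> r" "r < 1" and u: "0 \<le> u"
  shows "expectation (\<lambda>w. rank_one_remainder u (X w) * rank_one_remainder u (Y w))
    \<le> r * (std_normal_density u)\<^sup>2 * (exp (u\<^sup>2 * r) / sqrt (1 - r\<^sup>2) - 1)"
proof -
  let ?Q = "std_normal_tail u" and ?p = "std_normal_density u"
  let ?I = "\<lambda>z. indicator {u..} z :: real"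
  have gauss': "gaussian_rv M (\<lambda>w. a * Y w + b * X w)" for a b
    using gauss[of b a] by (simp add: add.commute)
  have cov': "expectation (\<lambda>w. Y w * X w) = r" using cov by (simp add: mult.commute)
  have r': "\<bar>r\<bar> < 1" using r by simp
  define W where "W = (\<lambda>w. (X w - r * Y w) / sqrt (1 - r\<^sup>2))"
  note reg = gaussian_pair_regression[OF gauss mean sq cov r', folded W_def]
  note reg' = gaussian_pair_regression[OF gauss' mean(2,1) sq(2,1) cov' r']
  have [measurable]: "X \<in> borel_measurable M" "Y \<in> borel_measurable M"
    using gaussian_rv_measurable[OF gauss[of 1 0]] gaussian_rv_measurable[OF gauss[of 0 1]] by simp_all
  have int2: "integrable M (\<lambda>w. (X w)\<^sup>2)" "integrable M (\<lambda>w. (Y w)\<^sup>2)"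
    using sq by (auto intro: square_integrableI)
  have int: "integrable M X" "integrable M Y" "integrable M (\<lambda>w. X w * Y w)"
    using int2 square_integrable_imp_integrable[of X] square_integrable_imp_integrable[of Y] integrable_mult_squares[of X M Y]
    by auto
  have intI: "integrable M (\<lambda>w. ?I (X w))" "integrable M (\<lambda>w. ?I (Y w))" "integrable M (\<lambda>w. ?I (X w) * ?I (Y w))"
    by (auto intro!: integrable_const_bound[where B=1] simp: indicator_def)
  have intIX: "integrable M (\<lambda>w. ?I (X w) * Y w)"
    by (rule Bochner_Integration.integrable_bound[OF int(2)]) (auto simp: indicator_def)
  have intIY: "integrable M (\<lambda>w. ?I (Y w) * X w)"
    by (rule Bochner_Integration.integrable_bound[OF int(1)]) (auto simp: indicator_def)
  have s: "sqrt (1 - r\<^sup>2) > 0" using r by (simp add: abs_square_less_1)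
  have X_eq: "X w = r * Y w + sqrt (1 - r\<^sup>2) * W w" for w
    using s by (simp add: W_def)
  have "expectation (\<lambda>w. ?I (X w) * ?I (Y w)) = expectation (indicator {w\<in>space M. u \<le> X w \<and> u \<le> Y w})"
    by (intro Bochner_Integration.integral_cong) (auto simp: indicator_def)
  also have "\<dots> = prob {w\<in>space M. u \<le> X w \<and> u \<le> Y w}" by simp
  also have "\<dots> \<le> ?Q\<^sup>2 + r * (?p\<^sup>2 * exp (u\<^sup>2 * r) / sqrt (1 - r\<^sup>2))"
    unfolding X_eq by (rule gaussian_orthant_le[OF reg u r])
  finally have orth: "expectation (\<lambda>w. ?I (X w) * ?I (Y w)) \<le> ?Q\<^sup>2 + r * (?p\<^sup>2 * exp (u\<^sup>2 * r) / sqrt (1 - r\<^sup>2))" .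
  have eq: "rank_one_remainder u x * rank_one_remainder u y = ?I x * ?I y + (- ?Q) * ?I x + (- ?Q) * ?I y + ?Q\<^sup>2
      + (- ?p) * (?I x * y) + (- ?p) * (?I y * x) + ?Q * ?p * x + ?Q * ?p * y + ?p\<^sup>2 * (x * y)" for x y
    unfolding rank_one_remainder_def by (simp add: power2_eq_square algebra_simps)
  have "expectation (\<lambda>w. rank_one_remainder u (X w) * rank_one_remainder u (Y w))
    = expectation (\<lambda>w. ?I (X w) * ?I (Y w)) + (- ?Q) * ?Q + (- ?Q) * ?Q + ?Q\<^sup>2
      + (- ?p) * (r * ?p) + (- ?p) * (r * ?p) + ?Q * ?p * 0 + ?Q * ?p * 0 + ?p\<^sup>2 * r"
    unfolding eq
    by (simp add: int intI intIX intIY mean cov prob_space std_normal_exceedance(1)[OF _ reg(2)] std_normal_exceedance(1)[OF _ reg'(2)]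
        gaussian_pair_exceedance_mixed[OF gauss mean sq cov r' u] gaussian_pair_exceedance_mixed[OF gauss' mean(2,1) sq(2,1) cov' r' u])
  also have "\<dots> = expectation (\<lambda>w. ?I (X w) * ?I (Y w)) - ?Q\<^sup>2 - r * ?p\<^sup>2"
    by (simp add: power2_eq_square algebra_simps)
  also have "\<dots> \<le> r * (?p\<^sup>2 * exp (u\<^sup>2 * r) / sqrt (1 - r\<^sup>2)) - r * ?p\<^sup>2"
    using orth by simp
  finally show ?thesis by (simp add: algebra_simps)
qed

section \<open>Mean-square integrals of second-order fields\<close>

text \<open>A density instead of a restricted space: the measurable sets remain all Borel sets, so
  measurability of fields given on the whole space carries over, also to products.\<close>

definition lborel_on :: "'a::euclidean_space set \<Rightarrow> 'a measure" where
  "lborel_on S = density lborel (\<lambda>x. ennreal (indicator S x))"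

lemma sets_lborel_on[measurable_cong, simp]: "sets (lborel_on S) = sets borel"
  and space_lborel_on[simp]: "space (lborel_on S) = UNIV"
  by (auto simp: lborel_on_def)

lemma emeasure_lborel_on:
  assumes [measurable]: "S \<in> sets borel" "A \<in> sets borel"
  shows "emeasure (lborel_on S) A = emeasure lborel (S \<inter> A)"
proof -
  have "emeasure (lborel_on S) A = (\<integral>\<^sup>+x. indicator (S \<inter> A) x \<partial>lborel)"
    unfolding lborel_on_def by (subst emeasure_density, measurable) (intro nn_integral_cong, auto split: split_indicator)
  then show ?thesis by simp
qed

lemma measure_lborel_on:
  assumes "S \<in> sets borel" "A \<in> sets borel"
  shows "measure (lborel_on S) A = measure lborel (S \<inter> A)"
  using emeasure_lborel_on[OF assms] by (simp add: measure_def)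

lemma finite_measure_lborel_on:
  assumes "S \<in> sets borel" "bounded S"
  shows "finite_measure (lborel_on S)"
  using emeasure_lborel_on[OF assms(1), of UNIV] emeasure_bounded_finite[OF assms(2)]
  by (intro finite_measureI) (auto simp: top_unique less_top)

lemma integral_lborel_on:
  fixes f :: "'a::euclidean_space \<Rightarrow> 'b::{banach,second_countable_topology}"
  assumes [measurable]: "S \<in> sets borel" "f \<in> borel_measurable borel"
  shows "integral\<^sup>L (lborel_on S) f = (\<integral>x. indicator S x *\<^sub>R f x \<partial>lborel)"
  unfolding lborel_on_def by (rule integral_density) auto

lemma lborel_on_Times:
  fixes A :: "'a::euclidean_space set" and B :: "'b::euclidean_space set"
  assumes [measurable]: "A \<in> sets borel" "B \<in> sets borel"
    and fin: "bounded B"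
  shows "lborel_on A \<Otimes>\<^sub>M lborel_on B = lborel_on (A \<times> B)"
proof -
  interpret B: finite_measure "lborel_on B" by (rule finite_measure_lborel_on) (use fin in auto)
  have "lborel_on A \<Otimes>\<^sub>M lborel_on B = density (lborel \<Otimes>\<^sub>M lborel) (\<lambda>(x, y). ennreal (indicator A x) * ennreal (indicator B y))"
    unfolding lborel_on_def
    by (rule pair_measure_density) (use B.sigma_finite_measure_axioms in \<open>auto simp: lborel_on_def lborel.sigma_finite_measure_axioms\<close>)
  also have "\<dots> = lborel_on (A \<times> B)"
    unfolding lborel_on_def lborel_prod[symmetric]
    by (intro density_cong) (auto simp: indicator_def split_beta borel_prod)
  finally show ?thesis .
qed

text \<open>Joint measurability gives path integrals and Fubini a meaning; the bound
  \<open>B\<close>, uniform in the index, controls the second moment of every path integral over a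
  finite measure.\<close>

definition second_order_field :: "'w measure \<Rightarrow> ('p::euclidean_space \<Rightarrow> 'w \<Rightarrow> real) \<Rightarrow> real \<Rightarrow> bool" where
  "second_order_field M X B \<longleftrightarrow>
     (\<lambda>(p, w). X p w) \<in> borel_measurable (borel \<Otimes>\<^sub>M M) \<and>
     (\<forall>p. integrable M (\<lambda>w. (X p w)\<^sup>2) \<and> (\<integral>w. (X p w)\<^sup>2 \<partial>M) \<le> B)"

lemma second_order_field_measurable[measurable_dest]:
  "second_order_field M X B \<Longrightarrow> (\<lambda>(p, w). X p w) \<in> borel_measurable (borel \<Otimes>\<^sub>M M)"
  by (simp add: second_order_field_def)

lemma (in prob_space) second_order_field_section:
  assumes "second_order_field M X B"
  shows "X p \<in> borel_measurable M"
proof -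
  have [measurable]: "(\<lambda>(p, w). X p w) \<in> borel_measurable (borel \<Otimes>\<^sub>M M)"
    using assms by (simp add: second_order_field_def)
  have "(\<lambda>w. (\<lambda>(p, w). X p w) (p, w)) \<in> borel_measurable M" by measurable
  then show ?thesis by simp
qed

text \<open>The square of a path integral is a double integral, and Fubini moves the expectation
  inside. The products are absolutely integrable since
  \<open>\<bar>a * b\<bar> \<le> (a\<^sup>2 + b\<^sup>2) / 2\<close>. The last claim is the
  quantitative tool: moments at most \<open>B\<close> give an integral of second moment at most
  \<open>B\<close> times the squared mass.\<close>

lemma (in prob_space) second_order_field_integral:
  fixes X :: "'p::euclidean_space \<Rightarrow> 'a \<Rightarrow> real"
  assumes X: "second_order_field M X B" and N: "finite_measure N" "sets N = sets borel"
  shows "integrable (N \<Otimes>\<^sub>M M) (\<lambda>(p, w). X p w)" (is ?int)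
    and "(\<lambda>w. \<integral>p. X p w \<partial>N) \<in> borel_measurable M" (is ?meas)
    and "integrable M (\<lambda>w. (\<integral>p. X p w \<partial>N)\<^sup>2)" (is ?int2)
    and "integrable (N \<Otimes>\<^sub>M N) (\<lambda>(p, q). expectation (\<lambda>w. X p w * X q w))" (is ?intcov)
    and "expectation (\<lambda>w. (\<integral>p. X p w \<partial>N)\<^sup>2) =
      (\<integral>(p, q). expectation (\<lambda>w. X p w * X q w) \<partial>(N \<Otimes>\<^sub>M N))" (is ?eq)
    and "expectation (\<lambda>w. (\<integral>p. X p w \<partial>N)\<^sup>2) \<le> B * (measure N UNIV)\<^sup>2" (is ?le)
proof -
  interpret N: finite_measure N by fact
  interpret NM: pair_sigma_finite N M ..
  interpret NN: finite_measure "N \<Otimes>\<^sub>M N" by (rule finite_measure_pair_measure) (rule N)+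
  interpret NNM: pair_sigma_finite "N \<Otimes>\<^sub>M N" M ..
  interpret NN': pair_sigma_finite N N ..
  note [measurable_cong] = N(2)
  have [measurable]: "(\<lambda>(p, w). X p w) \<in> borel_measurable (borel \<Otimes>\<^sub>M M)" using X by measurable
  have [measurable]: "X p \<in> borel_measurable M" for p by (rule second_order_field_section[OF X])
  have spN: "space N = UNIV" using sets_eq_imp_space_eq[OF N(2)] by simp
  have int2: "integrable M (\<lambda>w. (X p w)\<^sup>2)" and le: "expectation (\<lambda>w. (X p w)\<^sup>2) \<le> B" for p
    using X by (auto simp: second_order_field_def)
  have "0 \<le> expectation (\<lambda>w. (X undefined w)\<^sup>2)" by simp
  with le[of undefined] have "B \<ge> 0" by linarith
  have nn: "(\<integral>\<^sup>+w. ennreal ((X p w)\<^sup>2) \<partial>M) \<le> ennreal B" for p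
    using int2 le by (subst nn_integral_eq_integral) (auto intro: ennreal_leI)
  have int_sq: "integrable (N \<Otimes>\<^sub>M M) (\<lambda>z. (X (fst z) (snd z))\<^sup>2)"
  proof (rule integrableI_bounded)
    have "(\<integral>\<^sup>+z. ennreal (norm ((X (fst z) (snd z))\<^sup>2)) \<partial>(N \<Otimes>\<^sub>M M)) = (\<integral>\<^sup>+p. (\<integral>\<^sup>+w. ennreal ((X p w)\<^sup>2) \<partial>M) \<partial>N)"
      by (subst nn_integral_fst[symmetric]) auto
    also have "\<dots> \<le> (\<integral>\<^sup>+p. ennreal B \<partial>N)"
      by (intro nn_integral_mono nn)
    also have "\<dots> < \<infinity>" by (simp add: ennreal_mult_less_top N.emeasure_eq_measure spN)
    finally show "(\<integral>\<^sup>+z. ennreal (norm ((X (fst z) (snd z))\<^sup>2)) \<partial>(N \<Otimes>\<^sub>M M)) < \<infinity>" .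
  qed measurable
  have "finite_measure (N \<Otimes>\<^sub>M M)"
    by (rule finite_measure_pair_measure) (use N in \<open>auto intro: finite_measure_axioms\<close>)
  then have "integrable (N \<Otimes>\<^sub>M M) (\<lambda>z. X (fst z) (snd z))"
    by (rule finite_measure.square_integrable_imp_integrable[OF _ _ int_sq]) measurable
  then show ?int by (simp add: case_prod_unfold)
  show meas: ?meas by measurable
  let ?f = "\<lambda>z. X (fst (fst z)) (snd z) * X (snd (fst z)) (snd z)"
  have prod_le: "\<bar>a * b\<bar> \<le> (a\<^sup>2 + b\<^sup>2) / 2" for a b :: real
    using sum_squares_bound[of "\<bar>a\<bar>" "\<bar>b\<bar>"] by (simp add: abs_mult)
  have E_le: "(\<integral>\<^sup>+w. ennreal \<bar>X p w * X q w\<bar> \<partial>M) \<le> ennreal B" for p q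
  proof -
    have "(\<integral>\<^sup>+w. ennreal \<bar>X p w * X q w\<bar> \<partial>M) \<le> (\<integral>\<^sup>+w. ennreal (((X p w)\<^sup>2 + (X q w)\<^sup>2) / 2) \<partial>M)"
      by (intro nn_integral_mono ennreal_leI prod_le)
    also have "\<dots> = ennreal (expectation (\<lambda>w. ((X p w)\<^sup>2 + (X q w)\<^sup>2) / 2))"
      using int2 by (intro nn_integral_eq_integral) auto
    also have "\<dots> \<le> ennreal B"
      using int2[of p] int2[of q] le[of p] le[of q] by (intro ennreal_leI) simp
    finally show ?thesis .
  qed
  have int_f: "integrable ((N \<Otimes>\<^sub>M N) \<Otimes>\<^sub>M M) ?f"
  proof (rule integrableI_bounded)
    have "(\<integral>\<^sup>+z. ennreal (norm (?f z)) \<partial>((N \<Otimes>\<^sub>M N) \<Otimes>\<^sub>M M)) = (\<integral>\<^sup>+r. (\<integral>\<^sup>+w. ennreal \<bar>X (fst r) w * X (snd r) w\<bar> \<partial>M) \<partial>(N \<Otimes>\<^sub>M N))"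
      by (subst nn_integral_fst[symmetric]) (auto simp: case_prod_unfold)
    also have "\<dots> \<le> (\<integral>\<^sup>+r. ennreal B \<partial>(N \<Otimes>\<^sub>M N))"
      by (intro nn_integral_mono E_le)
    also have "\<dots> < \<infinity>" by (simp add: ennreal_mult_less_top NN.emeasure_eq_measure)
    finally show "(\<integral>\<^sup>+z. ennreal (norm (?f z)) \<partial>((N \<Otimes>\<^sub>M N) \<Otimes>\<^sub>M M)) < \<infinity>" .
  qed measurable
  show intcov: ?intcov
    using NNM.integrable_fst'[OF int_f] by (simp add: case_prod_unfold)
  have AE_f: "AE w in M. integrable (N \<Otimes>\<^sub>M N) (\<lambda>r. X (fst r) w * X (snd r) w)"
    using NNM.AE_integrable_snd[of "\<lambda>r w. X (fst r) w * X (snd r) w"] int_f by (simp add: case_prod_unfold)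
  \<comment> \<open>The square splits as an iterated integral only for those \<open>w\<close> whose
    path products are integrable, that is, almost surely.\<close>
  have sq: "AE w in M. (\<integral>r. X (fst r) w * X (snd r) w \<partial>(N \<Otimes>\<^sub>M N)) = (\<integral>p. X p w \<partial>N)\<^sup>2"
    using AE_f
  proof eventually_elim
    case (elim w)
    have "(\<integral>r. X (fst r) w * X (snd r) w \<partial>(N \<Otimes>\<^sub>M N)) = (\<integral>p. (\<integral>q. X p w * X q w \<partial>N) \<partial>N)"
      using NN'.integral_fst'[OF elim] by simp
    then show ?case by (simp add: power2_eq_square)
  qed
  have int_r: "integrable M (\<lambda>w. \<integral>r. X (fst r) w * X (snd r) w \<partial>(N \<Otimes>\<^sub>M N))"
    using NNM.integrable_snd[of "\<lambda>r w. X (fst r) w * X (snd r) w"] int_f by (simp add: case_prod_unfold)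
  show int2: ?int2
    by (rule integrable_cong_AE_imp[OF int_r]) (use sq in auto)
  have "expectation (\<lambda>w. (\<integral>p. X p w \<partial>N)\<^sup>2) = expectation (\<lambda>w. \<integral>r. X (fst r) w * X (snd r) w \<partial>(N \<Otimes>\<^sub>M N))"
    by (intro integral_cong_AE) (use sq in auto)
  also have "\<dots> = (\<integral>r. expectation (\<lambda>w. X (fst r) w * X (snd r) w) \<partial>(N \<Otimes>\<^sub>M N))"
    using NNM.Fubini_integral[of "\<lambda>r w. X (fst r) w * X (snd r) w"] int_f by (simp add: case_prod_unfold)
  finally show eq: ?eq by (simp add: case_prod_unfold)
  have "(\<integral>(p, q). expectation (\<lambda>w. X p w * X q w) \<partial>(N \<Otimes>\<^sub>M N)) \<le> (\<integral>r. B \<partial>(N \<Otimes>\<^sub>M N))"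
  proof (rule integral_mono[OF intcov])
    fix r :: "'p \<times> 'p"
    have "ennreal \<bar>expectation (\<lambda>w. X (fst r) w * X (snd r) w)\<bar> \<le> ennreal B"
    \<comment> \<open>A non-integrable product has integral 0 by convention, which also respects the
      bound as \<open>B \<ge> 0\<close>.\<close>
    proof (cases "integrable M (\<lambda>w. X (fst r) w * X (snd r) w)")
      case True
      from integral_norm_bound_ennreal[OF this] E_le[of "fst r" "snd r"] show ?thesis
        by (simp add: abs_mult)
    qed (simp add: not_integrable_integral_eq)
    then show "(case r of (p, q) \<Rightarrow> expectation (\<lambda>w. X p w * X q w)) \<le> B"
      using \<open>B \<ge> 0\<close> by (simp add: case_prod_unfold)
  qed simp
  also have "\<dots> = B * (measure N UNIV)\<^sup>2"
  proof -
    have "emeasure (N \<Otimes>\<^sub>M N) (UNIV \<times> UNIV) = emeasure N UNIV * emeasure N UNIV"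
      by (rule N.emeasure_pair_measure_Times) (simp_all add: N(2))
    then have "measure (N \<Otimes>\<^sub>M N) UNIV = (measure N UNIV)\<^sup>2"
      by (simp add: measure_def enn2real_mult power2_eq_square)
    then show ?thesis by (simp add: spN space_pair_measure mult.commute)
  qed
  finally show ?le unfolding eq .
qed

section \<open>Tagged partitions and uniqueness of mean-square integrals\<close>

text \<open>A bounded set is totally bounded, hence covered by finitely many balls of radius
  \<open>\<delta> / 2\<close>; cutting them off one after the other makes the pieces disjoint.
  Without this existence the condition in \<open>has_ms_integral\<close> could hold
  vacuously.\<close>

lemma fine_partition_exists:
  fixes S :: "'a::euclidean_space set"
  assumes S: "S \<in> sets borel" "bounded S" and \<delta>: "\<delta> > 0"
  shows "\<exists>P. fine_partition \<delta> S P"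
proof -
  have *: "\<exists>P. fine_partition \<delta> S P"
    if "finite F" "S \<subseteq> \<Union>F" "S \<in> sets borel" "\<And>A. A \<in> F \<Longrightarrow> A \<in> sets borel \<and> (\<forall>x\<in>A. \<forall>y\<in>A. dist x y \<le> \<delta>)" for F and S :: "'a set"
    using that
  proof (induction F arbitrary: S rule: finite_induct)
    case empty
    then show ?case
      by (intro exI[of _ "{}"]) (auto simp: fine_partition_def disjoint_family_on_def)
  next
    case (insert A F)
    have "\<exists>P. fine_partition \<delta> (S - A) P"
      by (rule insert.IH) (use insert.prems in auto)
    then obtain P where P: "fine_partition \<delta> (S - A) P" by blast
    show ?case
    \<comment> \<open>A piece must contain its tag, so an empty intersection contributes no
      piece.\<close>
    proof (cases "S \<inter> A = {}")
      case True
      then have "S - A = S" by auto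
      then show ?thesis using P by auto
    next
      case False
      then obtain p where p: "p \<in> S \<inter> A" by blast
      have UP: "\<Union> (snd ` P) = S - A" and disj: "disjoint_family_on snd P" and finP: "finite P"
        and AP: "\<forall>(q, B)\<in>P. q \<in> B \<and> B \<in> sets borel \<and> (\<forall>x\<in>B. \<forall>y\<in>B. dist x y \<le> \<delta>)"
        using P by (simp_all add: fine_partition_def)
      have Ab: "A \<in> sets borel \<and> (\<forall>x\<in>A. \<forall>y\<in>A. dist x y \<le> \<delta>)"
        by (rule insert.prems) simp
      have Sb: "S \<in> sets borel" by fact
      have notin: "(p, S \<inter> A) \<notin> P"
      proof
        assume "(p, S \<inter> A) \<in> P"
        then have "snd (p, S \<inter> A) \<subseteq> S - A" unfolding UP[symmetric] by (rule UN_upper)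
        then show False using p by auto
      qed
      have "fine_partition \<delta> S (insert (p, S \<inter> A) P)"
        unfolding fine_partition_def
      proof (intro conjI)
        show "finite (insert (p, S \<inter> A) P)" using finP by simp
        show "disjoint_family_on snd (insert (p, S \<inter> A) P)"
          unfolding disjoint_family_on_insert[OF notin] using UP disj by auto
        show "\<Union> (snd ` insert (p, S \<inter> A) P) = S" using UP by auto
        show "\<forall>(q, B)\<in>insert (p, S \<inter> A) P. q \<in> B \<and> B \<in> sets borel \<and> (\<forall>x\<in>B. \<forall>y\<in>B. dist x y \<le> \<delta>)"
          using AP p Ab Sb by auto
      qed
      then show ?thesis by blast
    qed
  qed
  have "compact (closure S)" using S by (simp add: compact_closure)
  then have "\<exists>T. finite T \<and> closure S \<subseteq> (\<Union>x\<in>T. ball x (\<delta> / 2))"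
    using half_gt_zero[OF \<delta>] unfolding compact_eq_totally_bounded by blast
  then obtain T where T: "finite T" "closure S \<subseteq> (\<Union>x\<in>T. ball x (\<delta> / 2))" by blast
  show ?thesis
  proof (rule *[of "(\<lambda>x. ball x (\<delta> / 2)) ` T"])
    show "S \<subseteq> \<Union> ((\<lambda>x. ball x (\<delta> / 2)) ` T)" using T closure_subset by fast
    fix A assume "A \<in> (\<lambda>x. ball x (\<delta> / 2)) ` T"
    then obtain x where A: "A = ball x (\<delta> / 2)" by blast
    have "dist y z \<le> \<delta>" if "y \<in> A" "z \<in> A" for y z
      using that dist_triangle3[of y z x] unfolding A by (simp add: dist_commute)
    then show "A \<in> sets borel \<and> (\<forall>x\<in>A. \<forall>y\<in>A. dist x y \<le> \<delta>)" by (auto simp: A)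
  qed (use T S in auto)
qed

lemma fine_partitionD:
  assumes "fine_partition \<delta> S P"
  shows "finite P" "\<Union> (snd ` P) = S" "disjoint_family_on snd P"
    and "a \<in> P \<Longrightarrow> fst a \<in> snd a" "a \<in> P \<Longrightarrow> snd a \<in> sets borel" "a \<in> P \<Longrightarrow> snd a \<subseteq> S"
    and "a \<in> P \<Longrightarrow> x \<in> snd a \<Longrightarrow> y \<in> snd a \<Longrightarrow> dist x y \<le> \<delta>"
proof -
  show UP: "\<Union> (snd ` P) = S" using assms by (simp add: fine_partition_def)
  then show "a \<in> P \<Longrightarrow> snd a \<subseteq> S" by blast
qed (use assms in \<open>auto simp: fine_partition_def case_prod_unfold\<close>)

lemma fine_partition_mono: "fine_partition \<delta> S P \<Longrightarrow> \<delta> \<le> \<delta>' \<Longrightarrow> fine_partition \<delta>' S P"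
  unfolding fine_partition_def by fastforce

text \<open>Both integrals are close to the Riemann sum of a common partition. This determines the
  version picked by \<open>ms_integral\<close> up to a null set.\<close>

lemma has_ms_integral_unique:
  fixes X :: "'a::euclidean_space \<Rightarrow> 'w \<Rightarrow> real"
  assumes S: "S \<in> sets borel" "bounded S"
    and X[measurable]: "\<And>p. X p \<in> borel_measurable M"
    and I: "has_ms_integral M X S I" and J: "has_ms_integral M X S J"
  shows "AE w in M. I w = J w"
proof -
  have [measurable]: "I \<in> borel_measurable M" "J \<in> borel_measurable M"
    using I J by (auto simp: has_ms_integral_def)
  have "(\<integral>\<^sup>+w. ennreal ((I w - J w)\<^sup>2) \<partial>M) \<le> 0 + ennreal \<epsilon>" if "\<epsilon> > 0" for \<epsilon>
  proof -
    have \<epsilon>: "\<epsilon> / 4 > 0" using that by simp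
    obtain \<delta>1 where 1: "\<delta>1 > 0" "\<And>P. fine_partition \<delta>1 S P \<Longrightarrow>
        (\<integral>\<^sup>+w. ennreal ((I w - (\<Sum>(p, A)\<in>P. measure lborel A * X p w))\<^sup>2) \<partial>M) < ennreal (\<epsilon> / 4)"
      using I \<epsilon> unfolding has_ms_integral_def by blast
    obtain \<delta>2 where 2: "\<delta>2 > 0" "\<And>P. fine_partition \<delta>2 S P \<Longrightarrow>
        (\<integral>\<^sup>+w. ennreal ((J w - (\<Sum>(p, A)\<in>P. measure lborel A * X p w))\<^sup>2) \<partial>M) < ennreal (\<epsilon> / 4)"
      using J \<epsilon> unfolding has_ms_integral_def by blast
    obtain P where "fine_partition (min \<delta>1 \<delta>2) S P"
      using fine_partition_exists[OF S, of "min \<delta>1 \<delta>2"] 1(1) 2(1) by auto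
    then have P: "fine_partition \<delta>1 S P" "fine_partition \<delta>2 S P"
      by (auto intro: fine_partition_mono)
    define R where "R w = (\<Sum>(p, A)\<in>P. measure lborel A * X p w)" for w
    have [measurable]: "R \<in> borel_measurable M" unfolding R_def[abs_def] case_prod_unfold by measurable
    have two: "ennreal (2 * x) = 2 * ennreal x" for x
      by (subst ennreal_mult') simp_all
    have le: "(a - b)\<^sup>2 \<le> 2 * (a - c)\<^sup>2 + 2 * (b - c)\<^sup>2" for a b c :: real
      using sum_squares_bound[of "a - c" "c - b"] by (simp add: power2_eq_square algebra_simps)
    have "(\<integral>\<^sup>+w. ennreal ((I w - J w)\<^sup>2) \<partial>M) \<le> (\<integral>\<^sup>+w. 2 * ennreal ((I w - R w)\<^sup>2) + 2 * ennreal ((J w - R w)\<^sup>2) \<partial>M)"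
    proof (rule nn_integral_mono)
      fix w
      have "ennreal ((I w - J w)\<^sup>2) \<le> ennreal (2 * (I w - R w)\<^sup>2 + 2 * (J w - R w)\<^sup>2)"
        by (rule ennreal_leI[OF le])
      then show "ennreal ((I w - J w)\<^sup>2) \<le> 2 * ennreal ((I w - R w)\<^sup>2) + 2 * ennreal ((J w - R w)\<^sup>2)"
        by (simp add: ennreal_plus ennreal_mult)
    qed
    also have "\<dots> = 2 * (\<integral>\<^sup>+w. ennreal ((I w - R w)\<^sup>2) \<partial>M) + 2 * (\<integral>\<^sup>+w. ennreal ((J w - R w)\<^sup>2) \<partial>M)"
      by (subst nn_integral_add) (auto simp: nn_integral_cmult)
    also have "\<dots> \<le> 2 * ennreal (\<epsilon> / 4) + 2 * ennreal (\<epsilon> / 4)"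
      using 1(2)[OF P(1)] 2(2)[OF P(2)] unfolding R_def by (intro add_mono mult_left_mono) auto
    also have "\<dots> = ennreal (2 * (\<epsilon> / 4) + 2 * (\<epsilon> / 4))"
      unfolding two[symmetric] using \<epsilon> by (intro ennreal_plus[symmetric]) auto
    finally show ?thesis by simp
  qed
  then have "(\<integral>\<^sup>+w. ennreal ((I w - J w)\<^sup>2) \<partial>M) \<le> 0"
    by (rule ennreal_le_epsilon)
  then have "(\<integral>\<^sup>+w. ennreal ((I w - J w)\<^sup>2) \<partial>M) = 0"
    by (simp only: le_zero_eq)
  then show ?thesis by (subst (asm) nn_integral_0_iff_AE) auto
qed

lemma has_ms_integral_ms_integral: "has_ms_integral M X S I \<Longrightarrow> has_ms_integral M X S (ms_integral M S X)"
  unfolding ms_integral_def by (rule someI[of "has_ms_integral M X S"])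

text \<open>A Riemann sum involves finitely many tags, so exceptional null sets may depend on the
  point. This is what allows inner integrals, known only up to a version for each time, to be
  replaced inside the outer one.\<close>

lemma has_ms_integral_cong_AE:
  fixes X Y :: "'a::euclidean_space \<Rightarrow> 'w \<Rightarrow> real"
  assumes I: "has_ms_integral M X S I" and eq: "\<And>p. p \<in> S \<Longrightarrow> AE w in M. X p w = Y p w"
  shows "has_ms_integral M Y S I"
  unfolding has_ms_integral_def
proof (intro conjI allI impI)
  fix \<epsilon> :: real assume "\<epsilon> > 0"
  then obtain \<delta> where \<delta>: "\<delta> > 0" "\<And>P. fine_partition \<delta> S P \<Longrightarrow>
        (\<integral>\<^sup>+w. ennreal ((I w - (\<Sum>(p, A)\<in>P. measure lborel A * X p w))\<^sup>2) \<partial>M) < ennreal \<epsilon>"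
    using I unfolding has_ms_integral_def by blast
  have "(\<integral>\<^sup>+w. ennreal ((I w - (\<Sum>(p, A)\<in>P. measure lborel A * Y p w))\<^sup>2) \<partial>M) < ennreal \<epsilon>" if P: "fine_partition \<delta> S P" for P
  proof -
    have "AE w in M. X (fst a) w = Y (fst a) w" if "a \<in> P" for a
      using fine_partitionD(4,6)[OF P that] by (intro eq) blast
    then have "AE w in M. \<forall>a\<in>P. X (fst a) w = Y (fst a) w"
      by (intro AE_finite_allI fine_partitionD(1)[OF P])
    then have "(\<integral>\<^sup>+w. ennreal ((I w - (\<Sum>(p, A)\<in>P. measure lborel A * Y p w))\<^sup>2) \<partial>M) =
      (\<integral>\<^sup>+w. ennreal ((I w - (\<Sum>(p, A)\<in>P. measure lborel A * X p w))\<^sup>2) \<partial>M)"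
      by (intro nn_integral_cong_AE) (auto simp: case_prod_unfold cong: sum.cong)
    then show ?thesis using \<delta>(2)[OF P] by simp
  qed
  then show "\<exists>\<delta>>0. \<forall>P. fine_partition \<delta> S P \<longrightarrow>
     (\<integral>\<^sup>+w. ennreal ((I w - (\<Sum>(p, A)\<in>P. measure lborel A * Y p w))\<^sup>2) \<partial>M) < ennreal \<epsilon>"
    using \<delta>(1) by blast
qed (use I in \<open>auto simp: has_ms_integral_def\<close>)

section \<open>Mean-square integrals as path integrals\<close>

text \<open>The modulus is uniform over the whole space; for a field whose increment variance
  depends on the lag alone it follows from continuity at one point.\<close>

definition ms_uniformly_continuous :: "'w measure \<Rightarrow> ('p::euclidean_space \<Rightarrow> 'w \<Rightarrow> real) \<Rightarrow> bool" where
  "ms_uniformly_continuous M X \<longleftrightarrow>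
     (\<forall>\<epsilon>>0. \<exists>\<delta>>0. \<forall>p q. dist p q \<le> \<delta> \<longrightarrow> (\<integral>w. (X p w - X q w)\<^sup>2 \<partial>M) \<le> \<epsilon>)"

lemma integrable_diff_squares:
  fixes f g :: "'a \<Rightarrow> real"
  assumes [measurable]: "f \<in> borel_measurable M" "g \<in> borel_measurable M"
    and "integrable M (\<lambda>x. (f x)\<^sup>2)" "integrable M (\<lambda>x. (g x)\<^sup>2)"
  shows "integrable M (\<lambda>x. (f x - g x)\<^sup>2)"
proof -
  have "integrable M (\<lambda>x. (f x)\<^sup>2 + (g x)\<^sup>2 - 2 * (f x * g x))"
    using integrable_mult_squares[OF assms] assms by simp
  then show ?thesis by (simp add: power2_diff mult.assoc)
qed

text \<open>Path integral minus Riemann sum is itself the path integral of an error field whose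
  second moment is small at every point, so the moment bound for path integrals applies to
  it.\<close>

theorem (in prob_space) has_ms_integral_pathwise:
  fixes X :: "'p::euclidean_space \<Rightarrow> 'a \<Rightarrow> real"
  assumes X: "second_order_field M X B" and cont: "ms_uniformly_continuous M X"
    and S[measurable]: "S \<in> sets borel" and "bounded S"
  shows "has_ms_integral M X S (\<lambda>w. \<integral>p. X p w \<partial>lborel_on S)"
  unfolding has_ms_integral_def
proof (intro conjI allI impI)
  let ?N = "lborel_on S"
  have fin: "finite_measure ?N" by (rule finite_measure_lborel_on) fact+
  interpret N: finite_measure ?N by (rule fin)
  interpret NM: pair_sigma_finite ?N M ..
  note soi = second_order_field_integral[OF _ fin sets_lborel_on]
  have [measurable]: "(\<lambda>(p, w). X p w) \<in> borel_measurable (borel \<Otimes>\<^sub>M M)" using X by measurable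
  have [measurable]: "X p \<in> borel_measurable M" for p by (rule second_order_field_section[OF X])
  show "(\<lambda>w. \<integral>p. X p w \<partial>?N) \<in> borel_measurable M" "integrable M (\<lambda>w. (\<integral>p. X p w \<partial>?N)\<^sup>2)"
    by (rule soi[OF X])+
  fix \<epsilon> :: real assume "\<epsilon> > 0"
  define m where "m = measure ?N UNIV"
  \<comment> \<open>The added 1 keeps the quotient defined for a null set and makes
    \<open>e * m\<^sup>2 < \<epsilon>\<close> strict.\<close>
  define e where "e = \<epsilon> / (m\<^sup>2 + 1)"
  have m1: "0 < m\<^sup>2 + 1" by (simp add: add_nonneg_pos)
  have "e > 0" using \<open>\<epsilon> > 0\<close> m1 by (simp add: e_def)
  have e_lt: "e * m\<^sup>2 < \<epsilon>"
    using \<open>\<epsilon> > 0\<close> m1 by (simp add: e_def divide_simps)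
  obtain \<delta> where \<delta>: "\<delta> > 0" "\<And>p q. dist p q \<le> \<delta> \<Longrightarrow> expectation (\<lambda>w. (X p w - X q w)\<^sup>2) \<le> e"
    using cont \<open>e > 0\<close> unfolding ms_uniformly_continuous_def by blast
  have "(\<integral>\<^sup>+w. ennreal (((\<integral>p. X p w \<partial>?N) - (\<Sum>(p, A)\<in>P. measure lborel A * X p w))\<^sup>2) \<partial>M) < ennreal \<epsilon>"
    if P: "fine_partition \<delta> S P" for P
  proof -
    note finP = fine_partitionD(1)[OF P] and UP = fine_partitionD(2)[OF P] and disj = fine_partitionD(3)[OF P]
    have [measurable]: "a \<in> P \<Longrightarrow> snd a \<in> sets borel" for a by (rule fine_partitionD(5)[OF P])
    \<comment> \<open>The error field: the field minus its step approximation, which takes on each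
      piece the value at the tag. It vanishes outside \<open>S\<close>.\<close>
    define D where "D y w = indicator S y * X y w - (\<Sum>a\<in>P. indicator (snd a) y * X (fst a) w)" for y w
    have D_in: "\<exists>a\<in>P. dist y (fst a) \<le> \<delta> \<and> D y = (\<lambda>w. X y w - X (fst a) w)" if "y \<in> S" for y
    proof -
      obtain a where a: "a \<in> P" "y \<in> snd a" using UP \<open>y \<in> S\<close> by blast
      have ind: "indicator (snd b) y = (if b = a then 1 else 0 :: real)" if "b \<in> P" for b
        using disj a that unfolding disjoint_family_on_def by (auto simp: indicator_def)
      have "(\<Sum>b\<in>P. indicator (snd b) y * X (fst b) w) = X (fst a) w" for w
      proof -
        have "(\<Sum>b\<in>P. indicator (snd b) y * X (fst b) w) = (\<Sum>b\<in>P. if b = a then X (fst b) w else 0)"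
          by (intro sum.cong) (auto simp: ind)
        then show ?thesis using a finP by simp
      qed
      then have "D y = (\<lambda>w. X y w - X (fst a) w)"
        using \<open>y \<in> S\<close> by (auto simp: D_def)
      moreover have "dist y (fst a) \<le> \<delta>" using fine_partitionD(4)[OF P a(1)] by (intro fine_partitionD(7)[OF P a(1)] a(2))
      ultimately show ?thesis using a by blast
    qed
    have D_out: "D y = (\<lambda>_. 0)" if "y \<notin> S" for y
      using that UP by (auto simp: D_def indicator_def intro!: sum.neutral ext)
    have D: "second_order_field M D e"
      unfolding second_order_field_def
    proof (intro conjI allI)
      show "(\<lambda>(p, w). D p w) \<in> borel_measurable (borel \<Otimes>\<^sub>M M)"
        unfolding D_def by measurable
      fix y
      have sq: "integrable M (\<lambda>w. (X p w)\<^sup>2)" for p using X by (simp add: second_order_field_def)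
      show "integrable M (\<lambda>w. (D y w)\<^sup>2)"
        using D_in[of y] D_out[of y] integrable_diff_squares[OF _ _ sq sq] by (cases "y \<in> S") auto
      show "expectation (\<lambda>w. (D y w)\<^sup>2) \<le> e"
        using D_in[of y] D_out[of y] \<delta>(2) \<open>e > 0\<close> by (cases "y \<in> S") auto
    qed
    have "AE w in M. integrable ?N (\<lambda>p. X p w)"
      using NM.AE_integrable_snd[OF soi(1)[OF X]] .
    then have AE: "AE w in M. (\<integral>p. X p w \<partial>?N) - (\<Sum>(p, A)\<in>P. measure lborel A * X p w) = (\<integral>y. D y w \<partial>?N)"
    proof eventually_elim
      case (elim w)
      have 1: "integrable ?N (\<lambda>y. indicator S y * X y w)"
        using integrable_mult_indicator[OF _ elim, of S] by simp
      have ms: "measure ?N (snd a) = measure lborel (snd a)" if "a \<in> P" for a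
      proof -
        have "S \<inter> snd a = snd a" using fine_partitionD(6)[OF P that] by blast
        then show ?thesis using measure_lborel_on[OF S fine_partitionD(5)[OF P that]] by simp
      qed
      have ind: "integrable ?N (\<lambda>y. indicator (snd a) y * X (fst a) w)"
        "(\<integral>y. indicator (snd a) y * X (fst a) w \<partial>?N) = measure lborel (snd a) * X (fst a) w" if "a \<in> P" for a
      proof -
        have [measurable]: "snd a \<in> sets borel" by (rule fine_partitionD(5)[OF P that])
        have "integrable ?N (indicator (snd a) :: _ \<Rightarrow> real)"
          by (simp add: N.emeasure_eq_measure)
        then show "integrable ?N (\<lambda>y. indicator (snd a) y * X (fst a) w)" by simp
        show "(\<integral>y. indicator (snd a) y * X (fst a) w \<partial>?N) = measure lborel (snd a) * X (fst a) w"
          by (simp add: ms[OF that])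
      qed
      have "(\<integral>y. D y w \<partial>?N) = (\<integral>y. indicator S y * X y w \<partial>?N) - (\<integral>y. (\<Sum>a\<in>P. indicator (snd a) y * X (fst a) w) \<partial>?N)"
        unfolding D_def by (intro Bochner_Integration.integral_diff 1 Bochner_Integration.integrable_sum ind)
      also have "(\<integral>y. (\<Sum>a\<in>P. indicator (snd a) y * X (fst a) w) \<partial>?N) = (\<Sum>a\<in>P. measure lborel (snd a) * X (fst a) w)"
        by (subst Bochner_Integration.integral_sum) (simp_all only: ind cong: sum.cong)
      finally have "(\<integral>y. D y w \<partial>?N) = (\<integral>y. indicator S y * X y w \<partial>?N) - (\<Sum>a\<in>P. measure lborel (snd a) * X (fst a) w)" .
      also have "(\<integral>y. indicator S y * X y w \<partial>?N) = (\<integral>y. X y w \<partial>?N)"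
      proof -
        have [measurable]: "(\<lambda>y. X y w) \<in> borel_measurable borel"
          using borel_measurable_integrable[OF elim] by simp
        have "(\<lambda>y. indicator S y *\<^sub>R (indicator S y * X y w)) = (\<lambda>y. indicator S y *\<^sub>R X y w)"
          by (auto simp: fun_eq_iff indicator_def)
        then show ?thesis
          using integral_lborel_on[OF S, of "\<lambda>y. X y w"] integral_lborel_on[OF S, of "\<lambda>y. indicator S y * X y w"]
          by (simp only:) measurable
      qed
      finally show ?case by (simp add: case_prod_unfold)
    qed
    have "(\<integral>\<^sup>+w. ennreal (((\<integral>p. X p w \<partial>?N) - (\<Sum>(p, A)\<in>P. measure lborel A * X p w))\<^sup>2) \<partial>M)
      = (\<integral>\<^sup>+w. ennreal ((\<integral>y. D y w \<partial>?N)\<^sup>2) \<partial>M)"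
      by (intro nn_integral_cong_AE) (use AE in eventually_elim, simp)
    also have "\<dots> = ennreal (expectation (\<lambda>w. (\<integral>y. D y w \<partial>?N)\<^sup>2))"
      by (intro nn_integral_eq_integral soi(3)[OF D]) simp
    also have "\<dots> \<le> ennreal (e * m\<^sup>2)"
      using soi(6)[OF D] by (intro ennreal_leI) (simp add: m_def)
    also have "\<dots> < ennreal \<epsilon>" using e_lt \<open>\<epsilon> > 0\<close> by (intro ennreal_lessI)
    finally show ?thesis .
  qed
  note bound = this
  show "\<exists>\<delta>>0. \<forall>P. fine_partition \<delta> S P \<longrightarrow>
     (\<integral>\<^sup>+w. ennreal (((\<integral>p. X p w \<partial>?N) - (\<Sum>(p, A)\<in>P. measure lborel A * X p w))\<^sup>2) \<partial>M) < ennreal \<epsilon>"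
    by (intro exI[of _ \<delta>] conjI allI impI bound \<delta>(1))
qed

text \<open>The inner path integral \<open>J\<close> is again a second-order, uniformly mean-square
  continuous field in time, so the outer integral is a path integral too, and Fubini joins both
  almost surely.\<close>

theorem (in prob_space) iterated_ms_integral:
  fixes X :: "'b::euclidean_space \<times> 'c::euclidean_space \<Rightarrow> 'a \<Rightarrow> real"
  assumes X: "second_order_field M X B" and cont: "ms_uniformly_continuous M X"
    and A[measurable]: "A \<in> sets borel" and bA: "bounded A"
    and T[measurable]: "T \<in> sets borel" and bT: "bounded T"
  defines "I \<equiv> ms_integral M T (\<lambda>t. ms_integral M A (\<lambda>x w. X (x, t) w))"
  shows "I \<in> borel_measurable M" and "AE w in M. I w = (\<integral>p. X p w \<partial>lborel_on (A \<times> T))"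
proof -
  let ?N = "lborel_on A" and ?NT = "lborel_on T"
  have fin: "finite_measure ?N" and finT: "finite_measure ?NT" by (rule finite_measure_lborel_on; fact)+
  interpret N: finite_measure ?N by (rule fin)
  interpret NT: finite_measure ?NT by (rule finT)
  interpret NNT: pair_sigma_finite ?N ?NT ..
  interpret NM: pair_sigma_finite ?N M ..
  note soi = second_order_field_integral[OF _ fin sets_lborel_on]
  have meas[measurable]: "(\<lambda>(p, w). X p w) \<in> borel_measurable (borel \<Otimes>\<^sub>M M)" using X by measurable
  have [measurable]: "X p \<in> borel_measurable M" for p by (rule second_order_field_section[OF X])
  have sq: "integrable M (\<lambda>w. (X p w)\<^sup>2)" for p using X unfolding second_order_field_def by blast
  have pairm: "(\<lambda>z. ((fst z :: 'b, t), snd z)) \<in> borel \<Otimes>\<^sub>M M \<rightarrow>\<^sub>M borel \<Otimes>\<^sub>M M" for t :: 'c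
    by (rule measurable_Pair, rule borel_measurable_Pair) simp_all
  have slice_m[measurable]: "(\<lambda>z. X (fst z, t) (snd z)) \<in> borel_measurable (borel \<Otimes>\<^sub>M M)" for t
    using measurable_compose[OF pairm meas] by simp
  have slice: "second_order_field M (\<lambda>x. X (x, t)) B" for t
    using X slice_m[of t] unfolding second_order_field_def by (simp add: case_prod_unfold)
  have slice_cont: "ms_uniformly_continuous M (\<lambda>x. X (x, t))" for t
    unfolding ms_uniformly_continuous_def
  proof (intro allI impI)
    fix \<epsilon> :: real assume "\<epsilon> > 0"
    then obtain \<delta> where \<delta>: "\<delta> > 0" "\<And>p q. dist p q \<le> \<delta> \<Longrightarrow> expectation (\<lambda>w. (X p w - X q w)\<^sup>2) \<le> \<epsilon>"
      using cont unfolding ms_uniformly_continuous_def by blast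
    show "\<exists>\<delta>>0. \<forall>p q. dist p q \<le> \<delta> \<longrightarrow> expectation (\<lambda>w. (X (p, t) w - X (q, t) w)\<^sup>2) \<le> \<epsilon>"
      by (rule exI[of _ \<delta>]) (auto intro!: \<delta> simp: dist_Pair_Pair)
  qed
  define J where "J t w = (\<integral>x. X (x, t) w \<partial>?N)" for t w
  have J_ms: "has_ms_integral M (\<lambda>x. X (x, t)) A (J t)" for t
    unfolding J_def[abs_def] by (rule has_ms_integral_pathwise[OF slice slice_cont A bA])
  let ?J = "\<lambda>t. ms_integral M A (\<lambda>x w. X (x, t) w)"
  have J_eq: "AE w in M. J t w = ?J t w" for t
    by (rule has_ms_integral_unique[OF A bA _ J_ms has_ms_integral_ms_integral[OF J_ms]]) measurable
  have J_int: "AE w in M. integrable ?N (\<lambda>x. X (x, t) w)" for t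
    using NM.AE_integrable_snd[OF soi(1)[OF slice]] .
  define m where "m = measure ?N UNIV"
  have J: "second_order_field M J (B * m\<^sup>2)"
    unfolding second_order_field_def
  proof (intro conjI allI)
    have "(\<lambda>z. ((snd z, fst (fst z) :: 'c), snd (fst z))) \<in> (borel \<Otimes>\<^sub>M M) \<Otimes>\<^sub>M ?N \<rightarrow>\<^sub>M borel \<Otimes>\<^sub>M M"
    proof (rule measurable_Pair, rule borel_measurable_Pair)
      show "(\<lambda>z. snd z) \<in> borel_measurable ((borel \<Otimes>\<^sub>M M) \<Otimes>\<^sub>M ?N)"
        using measurable_snd[of "borel \<Otimes>\<^sub>M M" ?N] by (simp cong: measurable_cong_sets)
      show "(\<lambda>z. fst (fst z)) \<in> borel_measurable ((borel \<Otimes>\<^sub>M M) \<Otimes>\<^sub>M ?N)"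
        by (rule measurable_compose[OF measurable_fst measurable_fst])
      show "(\<lambda>z. snd (fst z)) \<in> ((borel \<Otimes>\<^sub>M M) \<Otimes>\<^sub>M ?N) \<rightarrow>\<^sub>M M"
        by (rule measurable_compose[OF measurable_fst measurable_snd])
    qed
    from measurable_compose[OF this meas]
    have [measurable]: "(\<lambda>z. X (snd z, fst (fst z)) (snd (fst z))) \<in> borel_measurable ((borel \<Otimes>\<^sub>M M) \<Otimes>\<^sub>M ?N)"
      by simp
    have "(\<lambda>z. \<integral>x. X (x, fst z) (snd z) \<partial>?N) \<in> borel_measurable (borel \<Otimes>\<^sub>M M)"
      by (rule N.borel_measurable_lebesgue_integral) (simp add: case_prod_unfold)
    then show "(\<lambda>(t, w). J t w) \<in> borel_measurable (borel \<Otimes>\<^sub>M M)"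
      by (simp add: J_def case_prod_unfold)
  qed (use soi(3,6)[OF slice] in \<open>auto simp: J_def m_def\<close>)
  have J_cont: "ms_uniformly_continuous M J"
    unfolding ms_uniformly_continuous_def
  proof (intro allI impI)
    fix \<epsilon> :: real assume "\<epsilon> > 0"
    define e where "e = \<epsilon> / (m\<^sup>2 + 1)"
    have m1: "0 < m\<^sup>2 + 1" by (simp add: add_nonneg_pos)
    have "e > 0" using \<open>\<epsilon> > 0\<close> m1 by (simp add: e_def)
    have e_le: "e * m\<^sup>2 \<le> \<epsilon>"
      using \<open>\<epsilon> > 0\<close> m1 by (simp add: e_def divide_simps)
    obtain \<delta> where \<delta>: "\<delta> > 0" "\<And>p q. dist p q \<le> \<delta> \<Longrightarrow> expectation (\<lambda>w. (X p w - X q w)\<^sup>2) \<le> e"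
      using cont \<open>e > 0\<close> unfolding ms_uniformly_continuous_def by blast
    have "expectation (\<lambda>w. (J t w - J s w)\<^sup>2) \<le> \<epsilon>" if "dist t s \<le> \<delta>" for t s
    proof -
      have D: "second_order_field M (\<lambda>x w. X (x, t) w - X (x, s) w) e"
        unfolding second_order_field_def
      proof (intro conjI allI)
        show "(\<lambda>(x, w). X (x, t) w - X (x, s) w) \<in> borel_measurable (borel \<Otimes>\<^sub>M M)"
          unfolding case_prod_unfold by measurable
        show "integrable M (\<lambda>w. (X (x, t) w - X (x, s) w)\<^sup>2)" for x
          by (rule integrable_diff_squares[OF _ _ sq sq]) measurable
        show "expectation (\<lambda>w. (X (x, t) w - X (x, s) w)\<^sup>2) \<le> e" for x
          using that by (intro \<delta>) (simp add: dist_Pair_Pair)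
      qed
      have [measurable]: "J t \<in> borel_measurable M" for t by (rule second_order_field_section[OF J])
      have [measurable]: "(\<lambda>w. \<integral>x. X (x, t) w - X (x, s) w \<partial>?N) \<in> borel_measurable M" by (rule soi(2)[OF D])
      have "AE w in M. J t w - J s w = (\<integral>x. X (x, t) w - X (x, s) w \<partial>?N)"
        using J_int[of t] J_int[of s] by eventually_elim (simp add: J_def)
      then have "expectation (\<lambda>w. (J t w - J s w)\<^sup>2) = expectation (\<lambda>w. (\<integral>x. X (x, t) w - X (x, s) w \<partial>?N)\<^sup>2)"
        by (intro integral_cong_AE) auto
      also have "\<dots> \<le> e * m\<^sup>2" unfolding m_def by (rule soi(6)[OF D])
      finally show ?thesis using e_le by simp
    qed
    then show "\<exists>\<delta>>0. \<forall>t s. dist t s \<le> \<delta> \<longrightarrow> expectation (\<lambda>w. (J t w - J s w)\<^sup>2) \<le> \<epsilon>"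
      using \<delta>(1) by (intro exI[of _ \<delta>]) simp
  qed
  \<comment> \<open>Each inner integral is an arbitrary version, equal to \<open>J t\<close> only
    off a null set depending on \<open>t\<close>.\<close>
  have JT: "has_ms_integral M ?J T (\<lambda>w. \<integral>t. J t w \<partial>?NT)"
    by (rule has_ms_integral_cong_AE[OF has_ms_integral_pathwise[OF J J_cont T bT] J_eq])
  have I_ms: "has_ms_integral M ?J T I"
    unfolding I_def by (rule has_ms_integral_ms_integral[OF JT])
  then show "I \<in> borel_measurable M" by (simp add: has_ms_integral_def)
  have [measurable]: "?J t \<in> borel_measurable M" for t
    using has_ms_integral_ms_integral[OF J_ms[of t]] by (simp add: has_ms_integral_def)
  have I_eq: "AE w in M. I w = (\<integral>t. J t w \<partial>?NT)"
    by (rule has_ms_integral_unique[OF T bT _ I_ms JT]) measurable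
  have prod: "?N \<Otimes>\<^sub>M ?NT = lborel_on (A \<times> T)"
    by (rule lborel_on_Times[OF A T bT])
  have fin2: "finite_measure (?N \<Otimes>\<^sub>M ?NT)" by (rule finite_measure_pair_measure) fact+
  have sets2: "sets (?N \<Otimes>\<^sub>M ?NT) = sets borel" unfolding prod by simp
  interpret N2: finite_measure "?N \<Otimes>\<^sub>M ?NT" by (rule fin2)
  interpret N2M: pair_sigma_finite "?N \<Otimes>\<^sub>M ?NT" M ..
  have "AE w in M. integrable (?N \<Otimes>\<^sub>M ?NT) (\<lambda>p. X p w)"
    using N2M.AE_integrable_snd[OF second_order_field_integral(1)[OF X fin2 sets2]] .
  with I_eq show "AE w in M. I w = (\<integral>p. X p w \<partial>lborel_on (A \<times> T))"
  proof eventually_elim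
    case (elim w)
    then have "(\<integral>t. J t w \<partial>?NT) = (\<integral>p. X p w \<partial>(?N \<Otimes>\<^sub>M ?NT))"
      using NNT.integral_snd[of "\<lambda>x t. X (x, t) w"] by (simp add: J_def case_prod_unfold)
    then show ?case using elim(1) unfolding prod by simp
  qed
qed

section \<open>Gaussian limits in mean square and stability of limit laws\<close>

lemma norm_iexp_diff_le: "norm (iexp a - iexp b) \<le> \<bar>a - b\<bar>"
proof -
  have "iexp a - iexp b = iexp b * (iexp (a - b) - 1)"
    by (simp add: exp_diff right_diff_distrib)
  then have "norm (iexp a - iexp b) = norm (iexp (a - b) - 1)"
    by (simp add: norm_mult)
  also have "\<dots> \<le> \<bar>a - b\<bar>"
    using iexp_approx1[of "a - b" 0] by simp
  finally show ?thesis .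
qed

text \<open>The weighted inequality
  \<open>2 * \<bar>x * y\<bar> \<le> e * x\<^sup>2 + y\<^sup>2 / e\<close> takes the place of
  Cauchy-Schwarz and balances both terms when the squared error is at most
  \<open>e\<^sup>2\<close>.\<close>

lemma (in prob_space) L2_perturbation:
  fixes I R :: "'a \<Rightarrow> real"
  assumes [measurable]: "I \<in> borel_measurable M" "R \<in> borel_measurable M"
    and I: "integrable M (\<lambda>w. (I w)\<^sup>2)" and D: "integrable M (\<lambda>w. (I w - R w)\<^sup>2)"
    and e: "e > 0" and le: "expectation (\<lambda>w. (I w - R w)\<^sup>2) \<le> e\<^sup>2"
  shows "\<bar>expectation (\<lambda>w. (R w)\<^sup>2) - expectation (\<lambda>w. (I w)\<^sup>2)\<bar> \<le> e\<^sup>2 + e * expectation (\<lambda>w. (I w)\<^sup>2) + e"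
    and "norm (expectation (\<lambda>w. iexp (t * I w)) - expectation (\<lambda>w. iexp (t * R w))) \<le> \<bar>t\<bar> * e"
proof -
  let ?V = "expectation (\<lambda>w. (I w)\<^sup>2)"
  have prod: "integrable M (\<lambda>w. I w * (I w - R w))"
    by (rule integrable_mult_squares[OF _ _ I D]) measurable
  have amgm: "2 * \<bar>x * y\<bar> \<le> e * x\<^sup>2 + y\<^sup>2 / e" for x y :: real
  proof -
    have "2 * (sqrt e * \<bar>x\<bar>) * (\<bar>y\<bar> / sqrt e) \<le> (sqrt e * \<bar>x\<bar>)\<^sup>2 + (\<bar>y\<bar> / sqrt e)\<^sup>2"
      by (rule sum_squares_bound)
    then show ?thesis using e by (simp add: power_mult_distrib power_divide abs_mult)
  qed
  have eq: "(R w)\<^sup>2 = (I w)\<^sup>2 + (I w - R w)\<^sup>2 - 2 * (I w * (I w - R w))" for w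
    by (simp add: power2_eq_square algebra_simps)
  have "expectation (\<lambda>w. (R w)\<^sup>2) - ?V = expectation (\<lambda>w. (I w - R w)\<^sup>2) - 2 * expectation (\<lambda>w. I w * (I w - R w))"
    unfolding eq using I D prod by simp
  moreover have D0: "0 \<le> expectation (\<lambda>w. (I w - R w)\<^sup>2)" by simp
  ultimately have "\<bar>expectation (\<lambda>w. (R w)\<^sup>2) - ?V\<bar> \<le> expectation (\<lambda>w. (I w - R w)\<^sup>2) + 2 * \<bar>expectation (\<lambda>w. I w * (I w - R w))\<bar>"
    by linarith
  also have "2 * \<bar>expectation (\<lambda>w. I w * (I w - R w))\<bar> \<le> expectation (\<lambda>w. 2 * \<bar>I w * (I w - R w)\<bar>)"
    using integral_abs_bound[of M "\<lambda>w. I w * (I w - R w)"] by simp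
  also have "\<dots> \<le> expectation (\<lambda>w. e * (I w)\<^sup>2 + (I w - R w)\<^sup>2 / e)"
    by (intro integral_mono amgm) (use I D prod in auto)
  also have "\<dots> = e * ?V + expectation (\<lambda>w. (I w - R w)\<^sup>2) / e"
    using I D by simp
  also have "\<dots> \<le> e * ?V + e\<^sup>2 / e" using le e by (intro add_left_mono divide_right_mono) auto
  also have "e\<^sup>2 / e = e" using e by (simp add: power2_eq_square)
  finally show "\<bar>expectation (\<lambda>w. (R w)\<^sup>2) - ?V\<bar> \<le> e\<^sup>2 + e * ?V + e"
    using le by linarith
  have i: "integrable M (\<lambda>w. iexp (t * I w))" "integrable M (\<lambda>w. iexp (t * R w))"
    by (auto intro!: integrable_iexp)
  have dle: "\<bar>x\<bar> \<le> (e + x\<^sup>2 / e) / 2" for x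
    using amgm[of 1 x] by simp
  have "norm (expectation (\<lambda>w. iexp (t * I w)) - expectation (\<lambda>w. iexp (t * R w)))
      = norm (expectation (\<lambda>w. iexp (t * I w) - iexp (t * R w)))"
    using i by (subst Bochner_Integration.integral_diff) auto
  also have "\<dots> \<le> expectation (\<lambda>w. norm (iexp (t * I w) - iexp (t * R w)))"
    by (rule integral_norm_bound)
  also have "\<dots> \<le> expectation (\<lambda>w. \<bar>t\<bar> * ((e + (I w - R w)\<^sup>2 / e) / 2))"
  proof (rule integral_mono)
    show "integrable M (\<lambda>w. norm (iexp (t * I w) - iexp (t * R w)))"
      using i by (intro integrable_norm Bochner_Integration.integrable_diff)
    show "integrable M (\<lambda>w. \<bar>t\<bar> * ((e + (I w - R w)\<^sup>2 / e) / 2))" using D by simp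
    fix w
    have "norm (iexp (t * I w) - iexp (t * R w)) \<le> \<bar>t * I w - t * R w\<bar>" by (rule norm_iexp_diff_le)
    also have "\<dots> = \<bar>t\<bar> * \<bar>I w - R w\<bar>" by (simp add: abs_mult flip: right_diff_distrib)
    also have "\<dots> \<le> \<bar>t\<bar> * ((e + (I w - R w)\<^sup>2 / e) / 2)" by (intro mult_left_mono dle) simp
    finally show "norm (iexp (t * I w) - iexp (t * R w)) \<le> \<bar>t\<bar> * ((e + (I w - R w)\<^sup>2 / e) / 2)" .
  qed
  also have "\<dots> = \<bar>t\<bar> * ((e + expectation (\<lambda>w. (I w - R w)\<^sup>2) / e) / 2)"
    using D by (simp add: prob_space)
  also have "\<dots> \<le> \<bar>t\<bar> * ((e + e\<^sup>2 / e) / 2)"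
    using le e by (intro mult_left_mono divide_right_mono add_left_mono) auto
  also have "\<dots> = \<bar>t\<bar> * e" using e by (simp add: power2_eq_square)
  finally show "norm (expectation (\<lambda>w. iexp (t * I w)) - expectation (\<lambda>w. iexp (t * R w))) \<le> \<bar>t\<bar> * e" .
qed

text \<open>Riemann sums are finite combinations of the field, hence centred Gaussian. Along a
  sequence converging in mean square, both their variances and their characteristic functions at
  \<open>t\<close> converge.\<close>

theorem (in prob_space) ms_integral_gaussian_char:
  fixes X :: "'p::euclidean_space \<Rightarrow> 'a \<Rightarrow> real"
  assumes I: "has_ms_integral M X S I" and S: "S \<in> sets borel" "bounded S"
    and gauss: "\<And>F a. finite F \<Longrightarrow> gaussian_rv M (\<lambda>w. \<Sum>p\<in>F. a p * X p w)"
    and mean: "\<And>p. expectation (X p) = 0" and sq: "\<And>p. integrable M (\<lambda>w. (X p w)\<^sup>2)"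
  shows "expectation (\<lambda>w. iexp (t * I w)) = of_real (exp (- (expectation (\<lambda>w. (I w)\<^sup>2) * t\<^sup>2 / 2)))"
proof -
  have [measurable]: "I \<in> borel_measurable M" and I2: "integrable M (\<lambda>w. (I w)\<^sup>2)"
    using I by (auto simp: has_ms_integral_def)
  have [measurable]: "X p \<in> borel_measurable M" for p
    using gaussian_rv_measurable[OF gauss[of "{p}" "\<lambda>_. 1"]] by simp
  have intX: "integrable M (X p)" for p
    by (rule square_integrable_imp_integrable[OF _ sq]) measurable
  let ?V = "expectation (\<lambda>w. (I w)\<^sup>2)"
  define e where "e n = inverse (real (Suc n))" for n
  have e_pos: "e n > 0" for n by (simp add: e_def)
  have e_lim: "e \<longlonglongrightarrow> 0" unfolding e_def by (rule LIMSEQ_inverse_real_of_nat)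
  have "\<exists>R. R \<in> borel_measurable M \<and> integrable M (\<lambda>w. (I w - R w)\<^sup>2) \<and> expectation (\<lambda>w. (I w - R w)\<^sup>2) \<le> (e n)\<^sup>2
      \<and> expectation (\<lambda>w. iexp (t * R w)) = of_real (exp (- (expectation (\<lambda>w. (R w)\<^sup>2) * t\<^sup>2 / 2)))" for n
  proof -
    have "(e n)\<^sup>2 > 0" using e_pos[of n] by simp
    then obtain \<delta> where \<delta>: "\<delta> > 0" "\<And>P. fine_partition \<delta> S P \<Longrightarrow>
        (\<integral>\<^sup>+w. ennreal ((I w - (\<Sum>(p, A)\<in>P. measure lborel A * X p w))\<^sup>2) \<partial>M) < ennreal ((e n)\<^sup>2)"
      using I unfolding has_ms_integral_def by blast
    obtain P where P: "fine_partition \<delta> S P" using fine_partition_exists[OF S \<delta>(1)] by blast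
    define R where "R w = (\<Sum>(p, A)\<in>P. measure lborel A * X p w)" for w
    have [measurable]: "R \<in> borel_measurable M" unfolding R_def[abs_def] case_prod_unfold by measurable
    have nn: "(\<integral>\<^sup>+w. ennreal ((I w - R w)\<^sup>2) \<partial>M) < ennreal ((e n)\<^sup>2)"
      using \<delta>(2)[OF P] unfolding R_def .
    have int: "integrable M (\<lambda>w. (I w - R w)\<^sup>2)"
      by (rule integrableI_bounded) (use order.strict_trans[OF nn ennreal_less_top] in auto)
    have "ennreal (expectation (\<lambda>w. (I w - R w)\<^sup>2)) < ennreal ((e n)\<^sup>2)"
      using nn nn_integral_eq_integral[OF int] by simp
    then have le: "expectation (\<lambda>w. (I w - R w)\<^sup>2) \<le> (e n)\<^sup>2"
      by (simp add: ennreal_less_iff)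
    \<comment> \<open>\<open>gauss\<close> speaks of sums over finite sets of points. Disjoint
      pieces containing their tags have distinct tags, so the sum over pieces can be reindexed by
      tags.\<close>
    have inj: "inj_on fst P"
    proof (rule inj_onI)
      fix a b assume ab: "a \<in> P" "b \<in> P" "fst a = fst b"
      show "a = b"
      proof (rule ccontr)
        assume "a \<noteq> b"
        then have "snd a \<inter> snd b = {}" using disjoint_family_onD[OF fine_partitionD(3)[OF P] ab(1,2)] by simp
        then show False using fine_partitionD(4)[OF P ab(1)] fine_partitionD(4)[OF P ab(2)] ab(3) by auto
      qed
    qed
    have R_eq: "R = (\<lambda>w. \<Sum>p\<in>fst ` P. measure lborel (snd (the_inv_into P fst p)) * X p w)"
      unfolding R_def[abs_def] by (simp add: sum.reindex[OF inj] the_inv_into_f_f[OF inj] case_prod_unfold)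
    have "gaussian_rv M R" unfolding R_eq by (rule gauss) (use fine_partitionD(1)[OF P] in simp)
    moreover have "expectation R = 0"
      unfolding R_eq using intX by (subst Bochner_Integration.integral_sum) (auto simp: mean)
    ultimately have "expectation (\<lambda>w. iexp (t * R w)) = of_real (exp (- (expectation (\<lambda>w. (R w)\<^sup>2) * t\<^sup>2 / 2)))"
      by (rule gaussian_rv_char)
    then show ?thesis using int le by (intro exI[of _ R]) auto
  qed
  then have "\<exists>R. \<forall>n. R n \<in> borel_measurable M \<and> integrable M (\<lambda>w. (I w - R n w)\<^sup>2) \<and> expectation (\<lambda>w. (I w - R n w)\<^sup>2) \<le> (e n)\<^sup>2
      \<and> expectation (\<lambda>w. iexp (t * R n w)) = of_real (exp (- (expectation (\<lambda>w. (R n w)\<^sup>2) * t\<^sup>2 / 2)))"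
    by (intro choice) blast
  then obtain R where [measurable]: "\<And>n. R n \<in> borel_measurable M"
    and R: "\<And>n. integrable M (\<lambda>w. (I w - R n w)\<^sup>2)" "\<And>n. expectation (\<lambda>w. (I w - R n w)\<^sup>2) \<le> (e n)\<^sup>2"
    and R_char: "\<And>n. expectation (\<lambda>w. iexp (t * R n w)) = of_real (exp (- (expectation (\<lambda>w. (R n w)\<^sup>2) * t\<^sup>2 / 2)))"
    by blast
  note pert = L2_perturbation[OF _ _ I2 R(1) e_pos R(2)]
  have V_lim: "(\<lambda>n. expectation (\<lambda>w. (R n w)\<^sup>2)) \<longlonglongrightarrow> ?V"
  proof (rule LIM_zero_cancel, rule Lim_null_comparison)
    show "\<forall>\<^sub>F n in sequentially. norm (expectation (\<lambda>w. (R n w)\<^sup>2) - ?V) \<le> (e n)\<^sup>2 + e n * ?V + e n"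
      using pert(1) by (intro always_eventually) simp
    show "(\<lambda>n. (e n)\<^sup>2 + e n * ?V + e n) \<longlonglongrightarrow> 0"
      by (rule tendsto_eq_intros e_lim refl | simp)+
  qed
  have "(\<lambda>n. expectation (\<lambda>w. iexp (t * R n w))) \<longlonglongrightarrow> expectation (\<lambda>w. iexp (t * I w))"
  proof (rule LIM_zero_cancel, rule Lim_null_comparison)
    show "\<forall>\<^sub>F n in sequentially. norm (expectation (\<lambda>w. iexp (t * R n w)) - expectation (\<lambda>w. iexp (t * I w))) \<le> \<bar>t\<bar> * e n"
      using pert(2)[of _ t] by (intro always_eventually) (simp add: norm_minus_commute)
    show "(\<lambda>n. \<bar>t\<bar> * e n) \<longlonglongrightarrow> 0"
      using tendsto_mult_right_zero[OF e_lim] by simp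
  qed
  moreover have "(\<lambda>n. expectation (\<lambda>w. iexp (t * R n w))) \<longlonglongrightarrow> of_real (exp (- (?V * t\<^sup>2 / 2)))"
    unfolding R_char by (intro tendsto_intros V_lim) simp
  ultimately show ?thesis by (rule LIMSEQ_unique)
qed

text \<open>Slutsky: a perturbation that vanishes in mean square does not change the limit law.\<close>

lemma (in prob_space) cdf_perturbation:
  fixes X Y :: "'a \<Rightarrow> real"
  assumes [measurable]: "X \<in> borel_measurable M" "Y \<in> borel_measurable M"
    and D: "integrable M (\<lambda>w. (X w - Y w)\<^sup>2)" and e: "e > 0"
  shows "cdf (distr M borel Y) (y - e) - expectation (\<lambda>w. (X w - Y w)\<^sup>2) / e\<^sup>2 \<le> cdf (distr M borel X) y"
    and "cdf (distr M borel X) y \<le> cdf (distr M borel Y) (y + e) + expectation (\<lambda>w. (X w - Y w)\<^sup>2) / e\<^sup>2"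
proof -
  have cdf_eq: "cdf (distr M borel U) z = prob {w\<in>space M. U w \<le> z}" if [measurable]: "U \<in> borel_measurable M" for U z
    by (auto simp: cdf_def measure_distr intro!: arg_cong[where f=prob])
  let ?B = "{w\<in>space M. e\<^sup>2 \<le> (X w - Y w)\<^sup>2}"
  have cheb: "prob ?B \<le> expectation (\<lambda>w. (X w - Y w)\<^sup>2) / e\<^sup>2"
    using e by (intro integral_Markov_inequality_measure[OF D, of "{}", simplified]) auto
  have *: "e \<le> \<bar>a\<bar> \<Longrightarrow> e\<^sup>2 \<le> a\<^sup>2" for a
    using e power_mono[of e "\<bar>a\<bar>" 2] by simp
  have "prob {w\<in>space M. Y w \<le> y - e} \<le> prob ({w\<in>space M. X w \<le> y} \<union> ?B)"
    by (rule finite_measure_mono) (auto intro!: *)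
  also have "\<dots> \<le> prob {w\<in>space M. X w \<le> y} + prob ?B"
    by (rule measure_Un_le) auto
  finally show "cdf (distr M borel Y) (y - e) - expectation (\<lambda>w. (X w - Y w)\<^sup>2) / e\<^sup>2 \<le> cdf (distr M borel X) y"
    using cheb by (simp add: cdf_eq)
  have "prob {w\<in>space M. X w \<le> y} \<le> prob ({w\<in>space M. Y w \<le> y + e} \<union> ?B)"
    by (rule finite_measure_mono) (auto intro!: *)
  also have "\<dots> \<le> prob {w\<in>space M. Y w \<le> y + e} + prob ?B"
    by (rule measure_Un_le) auto
  finally show "cdf (distr M borel X) y \<le> cdf (distr M borel Y) (y + e) + expectation (\<lambda>w. (X w - Y w)\<^sup>2) / e\<^sup>2"
    using cheb by (simp add: cdf_eq)
qed

text \<open>At a continuity point the shift \<open>e\<close> is chosen from the modulus of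
  \<open>cdf N\<close>; with \<open>e\<close> fixed, the Chebyshev term vanishes as \<open>T\<close>
  grows. \<open>Y T\<close> has exactly the limit law for large \<open>T\<close>.\<close>

theorem (in prob_space) converges_in_distribution_perturbation:
  fixes X Y :: "real \<Rightarrow> 'a \<Rightarrow> real"
  assumes X: "\<forall>\<^sub>F T in at_top. X T \<in> borel_measurable M"
    and Y: "\<forall>\<^sub>F T in at_top. Y T \<in> borel_measurable M \<and> distr M borel (Y T) = N"
    and D: "\<forall>\<^sub>F T in at_top. integrable M (\<lambda>w. (X T w - Y T w)\<^sup>2)"
    and lim: "((\<lambda>T. expectation (\<lambda>w. (X T w - Y T w)\<^sup>2)) \<longlongrightarrow> 0) at_top"
  shows "converges_in_distribution M X N"
  unfolding converges_in_distribution_def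
proof (intro conjI allI impI X)
  fix y assume cont: "isCont (cdf N) y"
  show "((\<lambda>T. cdf (distr M borel (X T)) y) \<longlongrightarrow> cdf N y) at_top"
  proof (rule tendstoI)
    fix \<epsilon> :: real assume "\<epsilon> > 0"
    then have "\<epsilon> / 2 > 0" by simp
    then obtain d where d: "d > 0" "\<And>z. \<bar>z - y\<bar> < d \<Longrightarrow> \<bar>cdf N z - cdf N y\<bar> < \<epsilon> / 2"
      using cont unfolding continuous_at_eps_delta dist_real_def by blast
    define e where "e = d / 2"
    have e: "e > 0" using d by (simp add: e_def)
    have N: "\<bar>cdf N (y + e) - cdf N y\<bar> < \<epsilon> / 2" "\<bar>cdf N (y - e) - cdf N y\<bar> < \<epsilon> / 2"
      using d(1) by (intro d(2), simp add: e_def)+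
    have "0 < \<epsilon> / 2 * e\<^sup>2" using \<open>\<epsilon> > 0\<close> e by simp
    from order_tendstoD(2)[OF lim this] X Y D
    show "\<forall>\<^sub>F T in at_top. dist (cdf (distr M borel (X T)) y) (cdf N y) < \<epsilon>"
    proof eventually_elim
      case (elim T)
      have *: "expectation (\<lambda>w. (X T w - Y T w)\<^sup>2) / e\<^sup>2 < \<epsilon> / 2"
        using elim(1) e by (simp add: divide_less_eq)
      show ?case
      proof -
        have YN: "distr M borel (Y T) = N" and m: "X T \<in> borel_measurable M" "Y T \<in> borel_measurable M"
          using elim by auto
        note pert = cdf_perturbation[OF m elim(4) e, of y, unfolded YN]
        show ?thesis using pert N * unfolding dist_real_def by linarith
      qed
    qed
  qed
qed

section \<open>The distance between two uniform points\<close>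

lemma emeasure_lborel_affine_vimage:
  fixes E :: "'a::euclidean_space set"
  assumes [measurable]: "E \<in> sets borel" and c: "c \<noteq> 0"
  shows "emeasure lborel E = ennreal (\<bar>c\<bar> ^ DIM('a)) * emeasure lborel {x. t + c *\<^sub>R x \<in> E}"
proof -
  have "emeasure lborel E = emeasure (density (distr lborel borel (\<lambda>x. t + c *\<^sub>R x)) (\<lambda>_. \<bar>c\<bar> ^ DIM('a))) E"
    using lborel_affine[OF c, of t] by simp
  also have "\<dots> = ennreal (\<bar>c\<bar> ^ DIM('a)) * emeasure (distr lborel borel (\<lambda>x. t + c *\<^sub>R x)) E"
    by (subst emeasure_density) (auto simp: nn_integral_cmult_indicator)
  also have "emeasure (distr lborel borel (\<lambda>x. t + c *\<^sub>R x)) E = emeasure lborel {x. t + c *\<^sub>R x \<in> E}"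
    by (subst emeasure_distr) (auto simp: vimage_def)
  finally show ?thesis .
qed

lemma lborel_null_affine_iff:
  fixes E :: "'a::euclidean_space set"
  assumes "E \<in> sets borel" and c: "c \<noteq> 0"
  shows "emeasure lborel {x. t + c *\<^sub>R x \<in> E} = 0 \<longleftrightarrow> emeasure lborel E = 0"
  using c by (simp add: emeasure_lborel_affine_vimage[OF assms, of t])

text \<open>Average over the dilations by \<open>c \<in> {1..2}\<close>: by Fubini, almost every dilation of the shell is
  null, and nullity does not depend on the dilation.\<close>

lemma lborel_null_shell:
  assumes N[measurable]: "N \<in> sets borel" and null: "emeasure lborel N = 0"
  shows "emeasure lborel {x::'a::euclidean_space. norm x \<in> N} = 0"
proof -
  let ?E = "{x::'a. norm x \<in> N}"
  have E[measurable]: "?E \<in> sets borel" by measurable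
  have E_eq: "emeasure lborel {x::'a. norm (c *\<^sub>R x) \<in> N} = 0 \<longleftrightarrow> emeasure lborel ?E = 0" if "c \<noteq> 0" for c
    using lborel_null_affine_iff[OF E that, of 0] by simp
  have ind: "(\<lambda>z. indicator N (norm (fst z *\<^sub>R snd z)) * indicator {1..2} (fst z) :: ennreal) \<in> borel_measurable (lborel \<Otimes>\<^sub>M (lborel :: 'a measure))"
    by measurable
  have "(\<integral>\<^sup>+c. emeasure lborel {x::'a. norm (c *\<^sub>R x) \<in> N} * indicator {1..2} c \<partial>lborel)
    = (\<integral>\<^sup>+c. (\<integral>\<^sup>+x. indicator N (norm (c *\<^sub>R (x::'a))) * indicator {1..2} c \<partial>lborel) \<partial>lborel)"
  proof (intro nn_integral_cong)
    fix c :: real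
    have "(\<integral>\<^sup>+x. indicator N (norm (c *\<^sub>R (x::'a))) * indicator {1..2} c \<partial>lborel) = (\<integral>\<^sup>+x. indicator N (norm (c *\<^sub>R (x::'a))) \<partial>lborel) * indicator {1..2} c"
      by (rule nn_integral_multc) measurable
    also have "(\<integral>\<^sup>+x. indicator N (norm (c *\<^sub>R (x::'a))) \<partial>lborel) = (\<integral>\<^sup>+x. indicator {x::'a. norm (c *\<^sub>R x) \<in> N} x \<partial>lborel)"
      by (intro nn_integral_cong) (auto simp: indicator_def)
    also have "\<dots> = emeasure lborel {x::'a. norm (c *\<^sub>R x) \<in> N}"
      by (rule nn_integral_indicator) measurable
    finally show "emeasure lborel {x::'a. norm (c *\<^sub>R x) \<in> N} * indicator {1..2} c = (\<integral>\<^sup>+x. indicator N (norm (c *\<^sub>R (x::'a))) * indicator {1..2} c \<partial>lborel)" ..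
  qed
  also have "\<dots> = (\<integral>\<^sup>+x. (\<integral>\<^sup>+c. indicator N (norm (c *\<^sub>R (x::'a))) * indicator {1..2} c \<partial>lborel) \<partial>lborel)"
    using lborel_pair.Fubini[OF ind] by simp
  also have "\<dots> = (\<integral>\<^sup>+x. 0 \<partial>(lborel :: 'a measure))"
  proof (rule nn_integral_cong_AE)
    have "AE x in lborel. x \<noteq> (0::'a)" by (rule AE_lborel_singleton)
    then show "AE x in lborel. (\<integral>\<^sup>+c. indicator N (norm (c *\<^sub>R (x::'a))) * indicator {1..2} c \<partial>lborel) = 0"
    proof eventually_elim
      case (elim x)
      have "(\<integral>\<^sup>+c. indicator N (norm (c *\<^sub>R (x::'a))) * indicator {1..2} c \<partial>lborel) \<le> (\<integral>\<^sup>+c. indicator {c. 0 + norm x *\<^sub>R c \<in> N} c \<partial>lborel)"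
        by (intro nn_integral_mono) (auto simp: indicator_def mult.commute)
      also have "\<dots> = emeasure lborel {c. 0 + norm x *\<^sub>R c \<in> N}"
        by (rule nn_integral_indicator) measurable
      also have "\<dots> = 0" using lborel_null_affine_iff[OF N, of "norm x" 0] elim null by simp
      finally show ?case by simp
    qed
  qed
  finally have 0: "(\<integral>\<^sup>+c. emeasure lborel {x::'a. norm (c *\<^sub>R x) \<in> N} * indicator {1..2} c \<partial>lborel) = 0" by simp
  show ?thesis
  proof (rule ccontr)
    assume nz: "emeasure lborel ?E \<noteq> 0"
    have "Measurable.pred (lborel \<Otimes>\<^sub>M (lborel :: 'a measure)) (\<lambda>z. norm (fst z *\<^sub>R snd z) \<in> N)"
      by measurable
    then have pm: "{z \<in> space (lborel \<Otimes>\<^sub>M (lborel :: 'a measure)). norm (fst z *\<^sub>R snd z) \<in> N} \<in> sets (lborel \<Otimes>\<^sub>M (lborel :: 'a measure))"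
      by (simp only: pred_def)
    have "(\<lambda>c. emeasure lborel {x\<in>space lborel. norm (c *\<^sub>R (x::'a)) \<in> N}) \<in> borel_measurable lborel"
    proof (intro lborel.measurable_emeasure)
      have "{z \<in> space (lborel \<Otimes>\<^sub>M (lborel :: 'a measure)). snd z \<in> {x \<in> space lborel. norm (fst z *\<^sub>R x) \<in> N}}
        = {z \<in> space (lborel \<Otimes>\<^sub>M (lborel :: 'a measure)). norm (fst z *\<^sub>R snd z) \<in> N}"
        by auto
      then show "{z \<in> space (lborel \<Otimes>\<^sub>M (lborel :: 'a measure)). snd z \<in> {x \<in> space lborel. norm (fst z *\<^sub>R x) \<in> N}}
        \<in> sets (lborel \<Otimes>\<^sub>M (lborel :: 'a measure))"
        using pm by (simp only:)
    qed auto
    then have [measurable]: "(\<lambda>c. emeasure lborel {x::'a. norm (c *\<^sub>R x) \<in> N}) \<in> borel_measurable borel"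
      by simp
    have "AE c in lborel. emeasure lborel {x::'a. norm (c *\<^sub>R x) \<in> N} * indicator {1..2} c = 0"
      using 0 by (subst (asm) nn_integral_0_iff_AE) simp_all
    then have "AE c in lborel. c \<notin> {1..2::real}"
    proof eventually_elim
      case (elim c)
      show ?case
      proof
        assume c: "c \<in> {1..2}"
        then have "c \<noteq> 0" by auto
        then show False using elim c nz E_eq by (simp del: norm_scaleR)
      qed
    qed
    then have "emeasure lborel {1..2::real} = 0"
      by (subst (asm) AE_iff_measurable[of "{1..2}"]) auto
    then show False by simp
  qed
qed

text \<open>For fixed \<open>p\<close>, the points \<open>q\<close> with distance in a null set form
  a reflected translate of a null shell, and integration over \<open>p\<close> keeps the measure 0.
  This makes \<open>distance_density\<close> a genuine density of the distance.\<close>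

lemma absolutely_continuous_distance:
  fixes A :: "'a::euclidean_space set"
  assumes A[measurable]: "A \<in> sets borel" and pos: "emeasure lborel A \<noteq> 0" "emeasure lborel A \<noteq> \<infinity>"
  defines "U \<equiv> uniform_measure lborel A"
  shows "absolutely_continuous lborel (distr (U \<Otimes>\<^sub>M U) lborel (\<lambda>(p, q). norm (p - q)))"
  unfolding absolutely_continuous_def
proof
  fix N :: "real set" assume "N \<in> null_sets lborel"
  then have N[measurable]: "N \<in> sets borel" and null: "emeasure lborel N = 0" by auto
  interpret U: prob_space U unfolding U_def by (rule prob_space_uniform_measure[OF pos])
  have [measurable_cong]: "sets U = sets borel" by (simp add: U_def)
  have spU: "space U = UNIV" by (simp add: U_def)
  have m: "(\<lambda>(p, q). norm (p - q)) \<in> U \<Otimes>\<^sub>M U \<rightarrow>\<^sub>M lborel" by measurable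
  let ?S = "{z. norm (fst z - snd z :: 'a) \<in> N}"
  have S: "?S \<in> sets (U \<Otimes>\<^sub>M U)"
  proof -
    have "{z \<in> space (U \<Otimes>\<^sub>M U). norm (fst z - snd z) \<in> N} \<in> sets (U \<Otimes>\<^sub>M U)" by measurable
    then show ?thesis by (simp add: space_pair_measure spU)
  qed
  have "emeasure (distr (U \<Otimes>\<^sub>M U) lborel (\<lambda>(p, q). norm (p - q))) N = emeasure (U \<Otimes>\<^sub>M U) ?S"
    by (subst emeasure_distr[OF m]) (auto simp: space_pair_measure spU intro!: arg_cong2[where f=emeasure])
  also have "\<dots> = (\<integral>\<^sup>+p. emeasure U (Pair p -` ?S) \<partial>U)"
    by (rule U.emeasure_pair_measure_alt[OF S])
  also have "\<dots> = (\<integral>\<^sup>+p. 0 \<partial>U)"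
  proof (rule nn_integral_cong)
    fix p
    have E: "{x::'a. norm x \<in> N} \<in> sets borel" by measurable
    have eq: "Pair p -` ?S = {q. p + (-1) *\<^sub>R q \<in> {x. norm x \<in> N}}" by auto
    have n: "emeasure lborel (Pair p -` ?S) = 0"
      unfolding eq using lborel_null_affine_iff[OF E, of "-1" p] lborel_null_shell[OF N null] by simp
    have b: "Pair p -` ?S \<in> sets lborel" unfolding eq by measurable
    have "emeasure lborel (A \<inter> Pair p -` ?S) = 0"
      by (rule emeasure_eq_0[OF b n Int_lower2])
    then show "emeasure U (Pair p -` ?S) = 0"
      unfolding U_def by (subst emeasure_uniform_measure) (use b in simp_all)
  qed
  finally show "N \<in> null_sets (distr (U \<Otimes>\<^sub>M U) lborel (\<lambda>(p, q). norm (p - q)))"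
    by (intro null_setsI) simp_all
qed

text \<open>The derivative is finite almost everywhere, so \<open>enn2real\<close> loses nothing in
  \<open>distance_density\<close>. The normalising volumes are multiplied to the left to keep
  division of extended reals out of the statement.\<close>

lemma nn_integral_distance_density:
  fixes A :: "'a::euclidean_space set" and f :: "real \<Rightarrow> ennreal"
  assumes A[measurable]: "A \<in> sets borel" and pos: "emeasure lborel A \<noteq> 0" "emeasure lborel A \<noteq> \<infinity>"
    and f[measurable]: "f \<in> borel_measurable borel"
  shows "(\<integral>\<^sup>+z. ennreal (distance_density A z) * f z \<partial>lborel) * (emeasure lborel A)\<^sup>2 =
    (\<integral>\<^sup>+p. \<integral>\<^sup>+q. f (norm (p - q)) * indicator A q * indicator A p \<partial>lborel \<partial>lborel)"
proof -
  define U where "U = uniform_measure lborel A"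
  interpret U: prob_space U unfolding U_def by (rule prob_space_uniform_measure[OF pos])
  interpret UU: pair_prob_space U U ..
  have [measurable_cong]: "sets U = sets borel" by (simp add: U_def)
  define D where "D = distr (U \<Otimes>\<^sub>M U) lborel (\<lambda>(p, q). norm (p - q))"
  have m: "(\<lambda>(p, q). norm (p - q)) \<in> U \<Otimes>\<^sub>M U \<rightarrow>\<^sub>M lborel" by measurable
  interpret D: prob_space D unfolding D_def by (rule UU.prob_space_distr[OF m])
  have ac: "absolutely_continuous lborel D"
    unfolding D_def U_def by (rule absolutely_continuous_distance[OF A pos])
  have sD: "sets D = sets lborel" by (simp add: D_def)
  have "AE z in lborel. RN_deriv lborel D z \<noteq> \<infinity>"
    by (rule sigma_finite_measure.RN_deriv_finite[OF lborel.sigma_finite_measure_axioms D.sigma_finite_measure_axioms ac sD])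
  then have dd: "AE z in lborel. ennreal (distance_density A z) = RN_deriv lborel D z"
    unfolding distance_density_def D_def[symmetric] U_def[symmetric]
    by eventually_elim (simp add: less_top)
  have mc: "(\<integral>\<^sup>+q. f (norm (p - q)) * indicator A q * indicator A p \<partial>lborel) = (\<integral>\<^sup>+q. f (norm (p - q)) * indicator A q \<partial>lborel) * indicator A p" for p
    by (rule nn_integral_multc) measurable
  have "(\<integral>\<^sup>+z. ennreal (distance_density A z) * f z \<partial>lborel) = (\<integral>\<^sup>+z. RN_deriv lborel D z * f z \<partial>lborel)"
    using dd by (intro nn_integral_cong_AE) auto
  also have "\<dots> = (\<integral>\<^sup>+z. f z \<partial>D)"
    by (rule sigma_finite_measure.RN_deriv_nn_integral[OF lborel.sigma_finite_measure_axioms ac sD, symmetric]) simp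
  also have "\<dots> = (\<integral>\<^sup>+z. f (norm (fst z - snd z)) \<partial>(U \<Otimes>\<^sub>M U))"
    unfolding D_def by (subst nn_integral_distr[OF m]) (simp_all add: case_prod_unfold)
  also have "\<dots> = (\<integral>\<^sup>+p. \<integral>\<^sup>+q. f (norm (p - q)) \<partial>U \<partial>U)"
    by (subst U.nn_integral_fst[symmetric]) simp_all
  also have "\<dots> = (\<integral>\<^sup>+p. (\<integral>\<^sup>+q. f (norm (p - q)) * indicator A q \<partial>lborel) / emeasure lborel A * indicator A p \<partial>lborel) / emeasure lborel A"
    unfolding U_def by (subst nn_integral_uniform_measure; simp add: nn_integral_uniform_measure)
  also have "\<dots> = (\<integral>\<^sup>+p. (\<integral>\<^sup>+q. f (norm (p - q)) * indicator A q * indicator A p \<partial>lborel) * inverse (emeasure lborel A) \<partial>lborel) * inverse (emeasure lborel A)"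
    unfolding divide_ennreal_def
    by (intro arg_cong[where f="\<lambda>x. x * inverse (emeasure lborel A)"] nn_integral_cong) (unfold mc, simp only: mult_ac)
  also have "(\<integral>\<^sup>+p. (\<integral>\<^sup>+q. f (norm (p - q)) * indicator A q * indicator A p \<partial>lborel) * inverse (emeasure lborel A) \<partial>lborel)
    = (\<integral>\<^sup>+p. (\<integral>\<^sup>+q. f (norm (p - q)) * indicator A q * indicator A p \<partial>lborel) \<partial>lborel) * inverse (emeasure lborel A)"
    by (rule nn_integral_multc) measurable
  finally have eq: "(\<integral>\<^sup>+z. ennreal (distance_density A z) * f z \<partial>lborel) =
    (\<integral>\<^sup>+p. (\<integral>\<^sup>+q. f (norm (p - q)) * indicator A q * indicator A p \<partial>lborel) \<partial>lborel) * inverse (emeasure lborel A) * inverse (emeasure lborel A)" .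
  have alg: "y * i * i * e\<^sup>2 = y * (i * e) * (i * e)" for y i e :: ennreal
    by (simp only: power2_eq_square mult_ac)
  have one: "inverse (emeasure lborel A) * emeasure lborel A = 1"
    using ennreal_divide_self[OF pos(1)] pos(2) by (simp add: divide_ennreal_def mult.commute less_top)
  show ?thesis unfolding eq alg one mult_1_right ..
qed

section \<open>The variance formula as a double integral of the covariance\<close>

lemma nn_integral_lborel_on:
  fixes f :: "'a::euclidean_space \<Rightarrow> ennreal"
  assumes [measurable]: "S \<in> sets borel" "f \<in> borel_measurable borel"
  shows "(\<integral>\<^sup>+x. f x \<partial>lborel_on S) = (\<integral>\<^sup>+x. f x * indicator S x \<partial>lborel)"
proof -
  have "(\<integral>\<^sup>+x. f x \<partial>lborel_on S) = (\<integral>\<^sup>+x. ennreal (indicator S x) * f x \<partial>lborel)"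
    unfolding lborel_on_def by (rule nn_integral_density) auto
  also have "\<dots> = (\<integral>\<^sup>+x. f x * indicator S x \<partial>lborel)"
    by (intro nn_integral_cong) (simp split: split_indicator)
  finally show ?thesis .
qed

lemma nn_integral_abs_even:
  fixes g :: "real \<Rightarrow> ennreal"
  assumes [measurable]: "g \<in> borel_measurable borel"
  shows "(\<integral>\<^sup>+v. g \<bar>v\<bar> \<partial>lborel) = 2 * (\<integral>\<^sup>+v. g v * indicator {0..} v \<partial>lborel)"
proof -
  have "(\<integral>\<^sup>+v. g \<bar>v\<bar> \<partial>lborel) = (\<integral>\<^sup>+v. g v * indicator {0..} v + g (- v) * indicator {..<0} v \<partial>lborel)"
    by (intro nn_integral_cong) (auto split: split_indicator)
  also have "\<dots> = (\<integral>\<^sup>+v. g v * indicator {0..} v \<partial>lborel) + (\<integral>\<^sup>+v. g (- v) * indicator {..<0} v \<partial>lborel)"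
    by (rule nn_integral_add) auto
  also have "(\<integral>\<^sup>+v. g (- v) * indicator {..<0} v \<partial>lborel) = (\<integral>\<^sup>+v. g v * indicator {..<0} (- v) \<partial>lborel)"
    using nn_integral_real_affine[of "\<lambda>v. g (- v) * indicator {..<0} v" "-1" 0] by simp
  also have "\<dots> = (\<integral>\<^sup>+v. g v * indicator {0..} v \<partial>lborel)"
    by (intro nn_integral_cong_AE) (use AE_lborel_singleton[of "0::real"] in eventually_elim, auto split: split_indicator)
  finally show ?thesis by (simp add: mult_2)
qed

text \<open>Substitute \<open>s = t + v\<close>: the times \<open>t\<close> for which both points
  lie in \<open>{0..T}\<close> form an interval of length \<open>T - \<bar>v\<bar>\<close>. The
  factor 2 folds negative lags onto positive ones.\<close>

lemma nn_integral_abs_diff_square: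
  fixes h :: "real \<Rightarrow> ennreal"
  assumes h[measurable]: "h \<in> borel_measurable borel" and T: "0 \<le> T"
  shows "(\<integral>\<^sup>+t. (\<integral>\<^sup>+s. h \<bar>t - s\<bar> * indicator {0..T} s \<partial>lborel) * indicator {0..T} t \<partial>lborel) =
    2 * (\<integral>\<^sup>+\<tau>. ennreal (T - \<tau>) * h \<tau> * indicator {0..T} \<tau> \<partial>lborel)"
proof -
  have "(\<integral>\<^sup>+t. (\<integral>\<^sup>+s. h \<bar>t - s\<bar> * indicator {0..T} s \<partial>lborel) * indicator {0..T} t \<partial>lborel)
    = (\<integral>\<^sup>+t. (\<integral>\<^sup>+v. h \<bar>v\<bar> * indicator {0..T} (t + v) * indicator {0..T} t \<partial>lborel) \<partial>lborel)"
  proof (rule nn_integral_cong)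
    fix t :: real
    have "(\<integral>\<^sup>+s. h \<bar>t - s\<bar> * indicator {0..T} s \<partial>lborel) = (\<integral>\<^sup>+v. h \<bar>v\<bar> * indicator {0..T} (t + v) \<partial>lborel)"
      using nn_integral_real_affine[of "\<lambda>s. h \<bar>t - s\<bar> * indicator {0..T} s" 1 t] by simp
    then show "(\<integral>\<^sup>+s. h \<bar>t - s\<bar> * indicator {0..T} s \<partial>lborel) * indicator {0..T} t =
      (\<integral>\<^sup>+v. h \<bar>v\<bar> * indicator {0..T} (t + v) * indicator {0..T} t \<partial>lborel)"
      by (subst nn_integral_multc) simp_all
  qed
  also have "\<dots> = (\<integral>\<^sup>+v. (\<integral>\<^sup>+t. h \<bar>v\<bar> * indicator {0..T} (t + v) * indicator {0..T} t \<partial>lborel) \<partial>lborel)"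
    by (rule lborel_pair.Fubini'[symmetric]) measurable
  also have "\<dots> = (\<integral>\<^sup>+v. ennreal (T - \<bar>v\<bar>) * h \<bar>v\<bar> \<partial>lborel)"
  proof (rule nn_integral_cong)
    fix v :: real
    have "(\<integral>\<^sup>+t. h \<bar>v\<bar> * indicator {0..T} (t + v) * indicator {0..T} t \<partial>lborel) =
      (\<integral>\<^sup>+t. h \<bar>v\<bar> * indicator {max 0 (- v)..min T (T - v)} t \<partial>lborel)"
      by (intro nn_integral_cong) (auto split: split_indicator)
    also have "\<dots> = h \<bar>v\<bar> * emeasure lborel {max 0 (- v)..min T (T - v)}"
      by (rule nn_integral_cmult_indicator) simp
    also have "emeasure lborel {max 0 (- v)..min T (T - v)} = ennreal (T - \<bar>v\<bar>)"
    proof (cases "\<bar>v\<bar> \<le> T")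
      case True
      then have "min T (T - v) - max 0 (- v) = T - \<bar>v\<bar>" "max 0 (- v) \<le> min T (T - v)" using T by auto
      then show ?thesis by simp
    next
      case False
      then have "{max 0 (- v)..min T (T - v)} = {}" by auto
      then show ?thesis using False by (simp add: ennreal_neg)
    qed
    finally show "(\<integral>\<^sup>+t. h \<bar>v\<bar> * indicator {0..T} (t + v) * indicator {0..T} t \<partial>lborel) = ennreal (T - \<bar>v\<bar>) * h \<bar>v\<bar>"
      by (simp add: mult.commute)
  qed
  also have "\<dots> = 2 * (\<integral>\<^sup>+v. ennreal (T - v) * h v * indicator {0..} v \<partial>lborel)"
    by (rule nn_integral_abs_even) measurable
  \<comment> \<open>For \<open>v > T\<close> the weight is \<open>ennreal\<close> of a negative
    number, that is 0, so the range may be cut at \<open>T\<close>.\<close>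
  also have "(\<integral>\<^sup>+v. ennreal (T - v) * h v * indicator {0..} v \<partial>lborel) = (\<integral>\<^sup>+v. ennreal (T - v) * h v * indicator {0..T} v \<partial>lborel)"
    by (intro nn_integral_cong) (auto split: split_indicator simp: ennreal_neg)
  finally show ?thesis .
qed

text \<open>The distance density times the squared volume accounts for the pairs of spatial points,
  and \<open>T * (1 - \<tau> / T)\<close> for the pairs of times with lag \<open>\<tau>\<close>. As
  \<open>C\<close> is nonnegative, everything is computed with Tonelli in \<open>ennreal\<close>;
  \<open>H \<tau> \<le> a\<^sup>2\<close> permits the return to reals.\<close>

theorem variance_double_integral:
  fixes C :: "real \<Rightarrow> real \<Rightarrow> real" and A :: "'a::euclidean_space set"
  assumes Cm[measurable]: "(\<lambda>z. C \<bar>fst z\<bar> \<bar>snd z\<bar>) \<in> borel_measurable (borel \<Otimes>\<^sub>M borel)"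
    and C: "\<And>z \<tau>. 0 \<le> z \<Longrightarrow> 0 \<le> \<tau> \<Longrightarrow> 0 \<le> C z \<tau>" "\<And>z \<tau>. 0 \<le> z \<Longrightarrow> 0 \<le> \<tau> \<Longrightarrow> C z \<tau> \<le> 1"
    and A[measurable]: "A \<in> sets borel" and bA: "bounded A" and pos: "measure lborel A > 0" and T: "T > 0"
  defines "N \<equiv> lborel_on (A \<times> {0..T})"
  shows "2 * T * (measure lborel A)\<^sup>2 * (LBINT \<tau>:{0..T}. (1 - \<tau> / T) * (LBINT z:{0..diameter A}. C z \<tau> * distance_density A z))
    = (\<integral>(p, q). C (norm (fst p - fst q)) \<bar>snd p - snd q\<bar> \<partial>(N \<Otimes>\<^sub>M N))"
proof -
  define a where "a = measure lborel A"
  have E_fin: "emeasure lborel A \<noteq> \<infinity>" using emeasure_bounded_finite[OF bA] by auto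
  have E: "emeasure lborel A = ennreal a" unfolding a_def by (rule emeasure_eq_ennreal_measure) (use E_fin in auto)
  have E_pos: "emeasure lborel A \<noteq> 0" using pos E by (simp add: a_def ennreal_eq_0_iff)
  have a: "a > 0" using pos by (simp add: a_def)
  have [measurable]: "(\<lambda>z. C \<bar>z\<bar> \<tau>) \<in> borel_measurable borel" if "0 \<le> \<tau>" for \<tau>
  proof -
    have "(\<lambda>z. (\<lambda>z. C \<bar>fst z\<bar> \<bar>snd z\<bar>) (z, \<tau>)) \<in> borel_measurable borel" by measurable
    then show ?thesis using that by simp
  qed
  have [measurable]: "distance_density A \<in> borel_measurable borel"
    unfolding distance_density_def[abs_def] by measurable
  have dd0: "0 \<le> distance_density A z" for z by (simp add: distance_density_def)
  \<comment> \<open>\<open>C\<close> is controlled at nonnegative arguments only; the absolute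
    values give the form in which \<open>Cm\<close> provides measurability, and allow signed time
    lags.\<close>
  define K where "K x y \<tau> = ennreal (C \<bar>norm (x - y)\<bar> \<bar>\<tau>\<bar>)" for x y :: 'a and \<tau>
  have K_le: "K x y \<tau> \<le> 1" for x y \<tau>
    unfolding K_def using C(2)[of "\<bar>norm (x - y)\<bar>" "\<bar>\<tau>\<bar>"] by (simp add: ennreal_le_1)
  have Km: "(\<lambda>z. K (f z) (g z) (k z)) \<in> borel_measurable R"
    if [measurable]: "f \<in> borel_measurable R" "g \<in> borel_measurable R" "k \<in> borel_measurable R" for f g k R
  proof -
    have "(\<lambda>z. (norm (f z - g z), k z)) \<in> R \<rightarrow>\<^sub>M borel \<Otimes>\<^sub>M borel" by measurable
    from measurable_compose[OF this Cm] show ?thesis unfolding K_def by simp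
  qed
  define H where "H \<tau> = (\<integral>\<^sup>+x. \<integral>\<^sup>+y. K x y \<tau> * indicator A y * indicator A x \<partial>lborel \<partial>lborel)" for \<tau>
  have Hm[measurable]: "H \<in> borel_measurable borel"
  proof -
    have [measurable]: "(\<lambda>z. K (snd (fst z)) (snd z) (fst (fst z))) \<in> borel_measurable ((borel \<Otimes>\<^sub>M lborel) \<Otimes>\<^sub>M lborel)"
      by (rule Km) measurable
    show ?thesis unfolding H_def[abs_def] by measurable
  qed
  have H_le: "H \<tau> \<le> ennreal (a\<^sup>2)" for \<tau>
  proof -
    have "H \<tau> \<le> (\<integral>\<^sup>+x. \<integral>\<^sup>+y. indicator A y * indicator A x \<partial>lborel \<partial>lborel)"
      unfolding H_def by (intro nn_integral_mono) (use K_le in \<open>auto split: split_indicator\<close>)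
    also have "\<dots> = (\<integral>\<^sup>+x. ennreal a * indicator A x \<partial>lborel)"
      by (intro nn_integral_cong) (simp add: nn_integral_multc E)
    also have "\<dots> = ennreal (a\<^sup>2)"
      using a by (subst nn_integral_cmult_indicator) (auto simp: E power2_eq_square ennreal_mult)
    finally show ?thesis .
  qed
  have H_fin: "H \<tau> < \<infinity>" for \<tau> using H_le[of \<tau>] by (rule order.strict_trans1) simp
  define L where "L \<tau> = (LBINT z:{0..diameter A}. C z \<tau> * distance_density A z)" for \<tau>
  have inner: "L \<tau> = enn2real (H \<tau>) / a\<^sup>2" if \<tau>: "0 \<le> \<tau>" for \<tau>
  proof -
    define f where "f z = ennreal (C \<bar>z\<bar> \<tau>) * indicator {0..diameter A} z" for z
    have [measurable]: "f \<in> borel_measurable borel" unfolding f_def[abs_def] using \<tau> by measurable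
    define X where "X = (\<integral>\<^sup>+z. ennreal (distance_density A z) * f z \<partial>lborel)"
    have "X * (emeasure lborel A)\<^sup>2 = (\<integral>\<^sup>+p. \<integral>\<^sup>+q. f (norm (p - q)) * indicator A q * indicator A p \<partial>lborel \<partial>lborel)"
      unfolding X_def by (rule nn_integral_distance_density[OF A E_pos E_fin]) measurable
    also have "\<dots> = H \<tau>"
      unfolding H_def
    proof (intro nn_integral_cong)
      fix p q :: 'a
      \<comment> \<open>Two points of \<open>A\<close> are at most its diameter apart, so the cutoff
        in \<open>f\<close> equals 1 wherever both indicators do.\<close>
      show "f (norm (p - q)) * indicator A q * indicator A p = K p q \<tau> * indicator A q * indicator A p"
        using diameter_bounded_bound[OF bA, of p q] \<tau> by (auto simp: f_def K_def dist_norm split: split_indicator)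
    qed
    finally have X_eq: "X * ennreal (a\<^sup>2) = H \<tau>" using a by (simp add: E ennreal_power)
    have "L \<tau> =
      (\<integral>z. indicator {0..diameter A} z * (C \<bar>z\<bar> \<tau> * distance_density A z) \<partial>lborel)"
      unfolding L_def set_lebesgue_integral_def by (intro Bochner_Integration.integral_cong) (auto split: split_indicator)
    also have "\<dots> = enn2real (\<integral>\<^sup>+z. ennreal (indicator {0..diameter A} z * (C \<bar>z\<bar> \<tau> * distance_density A z)) \<partial>lborel)"
      using \<tau> C(1) dd0 by (intro integral_eq_nn_integral) auto
    also have "(\<integral>\<^sup>+z. ennreal (indicator {0..diameter A} z * (C \<bar>z\<bar> \<tau> * distance_density A z)) \<partial>lborel) = X"
      unfolding X_def f_def using \<tau> C(1) dd0
      by (intro nn_integral_cong) (auto simp: ennreal_mult mult.commute split: split_indicator)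
    also have "enn2real X = enn2real (H \<tau>) / a\<^sup>2"
      unfolding X_eq[symmetric] using a by (simp add: enn2real_mult)
    finally show ?thesis .
  qed
  have "2 * T * a\<^sup>2 * (LBINT \<tau>:{0..T}. (1 - \<tau> / T) * L \<tau>) =
    2 * T * a\<^sup>2 * (\<integral>\<tau>. indicator {0..T} \<tau> * ((1 - \<tau> / T) * (enn2real (H \<tau>) / a\<^sup>2)) \<partial>lborel)"
    unfolding set_lebesgue_integral_def
    by (intro arg_cong2[where f="(*)"] refl Bochner_Integration.integral_cong) (auto simp: inner split: split_indicator)
  also have "\<dots> = (\<integral>\<tau>. 2 * T * a\<^sup>2 * (indicator {0..T} \<tau> * ((1 - \<tau> / T) * (enn2real (H \<tau>) / a\<^sup>2))) \<partial>lborel)"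
    by (rule integral_mult_right_zero[symmetric])
  also have "\<dots> = (\<integral>\<tau>. 2 * ((T - \<tau>) * enn2real (H \<tau>) * indicator {0..T} \<tau>) \<partial>lborel)"
  proof (rule Bochner_Integration.integral_cong[OF refl])
    fix \<tau>
    have "T * (1 - \<tau> / T) = T - \<tau>" using T by (simp add: field_simps)
    moreover have "2 * T * a\<^sup>2 * (i * ((1 - \<tau> / T) * (x / a\<^sup>2))) = 2 * ((T * (1 - \<tau> / T)) * x * i)" for i x
      using a by simp
    ultimately show "2 * T * a\<^sup>2 * (indicator {0..T} \<tau> * ((1 - \<tau> / T) * (enn2real (H \<tau>) / a\<^sup>2))) = 2 * ((T - \<tau>) * enn2real (H \<tau>) * indicator {0..T} \<tau>)"
      by simp
  qed
  also have "\<dots> = enn2real (\<integral>\<^sup>+\<tau>. ennreal (2 * ((T - \<tau>) * enn2real (H \<tau>) * indicator {0..T} \<tau>)) \<partial>lborel)"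
    by (intro integral_eq_nn_integral) (auto split: split_indicator)
  also have "(\<integral>\<^sup>+\<tau>. ennreal (2 * ((T - \<tau>) * enn2real (H \<tau>) * indicator {0..T} \<tau>)) \<partial>lborel) =
    (\<integral>\<^sup>+\<tau>. 2 * (ennreal (T - \<tau>) * H \<tau> * indicator {0..T} \<tau>) \<partial>lborel)"
  proof (rule nn_integral_cong)
    fix \<tau>
    have "ennreal (enn2real (H \<tau>)) = H \<tau>" using H_fin[of \<tau>] by simp
    then show "ennreal (2 * ((T - \<tau>) * enn2real (H \<tau>) * indicator {0..T} \<tau>)) = 2 * (ennreal (T - \<tau>) * H \<tau> * indicator {0..T} \<tau>)"
      by (auto simp: ennreal_mult split: split_indicator)
  qed
  also have "\<dots> = 2 * (\<integral>\<^sup>+\<tau>. ennreal (T - \<tau>) * H \<tau> * indicator {0..T} \<tau> \<partial>lborel)"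
    by (rule nn_integral_cmult) measurable
  also have "\<dots> = (\<integral>\<^sup>+t. (\<integral>\<^sup>+s. H \<bar>t - s\<bar> * indicator {0..T} s \<partial>lborel) * indicator {0..T} t \<partial>lborel)"
    using T by (intro nn_integral_abs_diff_square[symmetric] Hm) simp
  also have "\<dots> = (\<integral>\<^sup>+r. ennreal (C (norm (fst (fst r) - fst (snd r))) \<bar>snd (fst r) - snd (snd r)\<bar>) \<partial>(N \<Otimes>\<^sub>M N))"
  proof -
    let ?NA = "lborel_on A" and ?NT = "lborel_on {0..T}"
    have "finite_measure ?NA" "finite_measure ?NT" by (rule finite_measure_lborel_on; simp add: bA)+
    then interpret NA: finite_measure ?NA + NT: finite_measure ?NT .
    interpret AT: pair_sigma_finite ?NA ?NT ..
    have N_eq: "N = ?NA \<Otimes>\<^sub>M ?NT" unfolding N_def by (rule lborel_on_Times[symmetric]) auto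
    interpret N: finite_measure N unfolding N_eq by (rule finite_measure_pair_measure) unfold_locales
    have sN: "sets N = sets ((borel :: 'a measure) \<Otimes>\<^sub>M (borel :: real measure))" unfolding N_eq by (rule sets_pair_measure_cong) simp_all
    note [measurable_cong] = sN
    have H_eq: "H \<tau> = (\<integral>\<^sup>+x. \<integral>\<^sup>+y. K x y \<tau> \<partial>?NA \<partial>?NA)" for \<tau>
    proof -
      have [measurable]: "(\<lambda>y. K x y \<tau>) \<in> borel_measurable borel" for x by (rule Km) measurable
      have [measurable]: "(\<lambda>z. K (fst z) (snd z) \<tau>) \<in> borel_measurable (borel \<Otimes>\<^sub>M ?NA)" by (rule Km) measurable
      have "(\<integral>\<^sup>+x. \<integral>\<^sup>+y. K x y \<tau> \<partial>?NA \<partial>?NA) = (\<integral>\<^sup>+x. (\<integral>\<^sup>+y. K x y \<tau> \<partial>?NA) * indicator A x \<partial>lborel)"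
        by (rule nn_integral_lborel_on[OF A]) measurable
      also have "\<dots> = (\<integral>\<^sup>+x. (\<integral>\<^sup>+y. K x y \<tau> * indicator A y \<partial>lborel) * indicator A x \<partial>lborel)"
        by (subst nn_integral_lborel_on[OF A]) simp_all
      also have "\<dots> = H \<tau>" unfolding H_def by (intro nn_integral_cong nn_integral_multc[symmetric]) measurable
      finally show ?thesis ..
    qed
    have Nf: "(\<integral>\<^sup>+p. F p \<partial>N) = (\<integral>\<^sup>+t. \<integral>\<^sup>+x. F (x, t) \<partial>?NA \<partial>?NT)" if "F \<in> borel_measurable N" for F
      using that unfolding N_eq by (intro AT.nn_integral_snd[symmetric]) 
    have m4[measurable]: "(\<lambda>r. K (fst (fst r)) (fst (snd r)) (snd (fst r) - snd (snd r))) \<in> borel_measurable (N \<Otimes>\<^sub>M N)"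
      by (rule Km) measurable
    have "(\<integral>\<^sup>+r. ennreal (C (norm (fst (fst r) - fst (snd r))) \<bar>snd (fst r) - snd (snd r)\<bar>) \<partial>(N \<Otimes>\<^sub>M N))
      = (\<integral>\<^sup>+r. K (fst (fst r)) (fst (snd r)) (snd (fst r) - snd (snd r)) \<partial>(N \<Otimes>\<^sub>M N))"
      by (simp add: K_def)
    also have "\<dots> = (\<integral>\<^sup>+p. \<integral>\<^sup>+q. K (fst p) (fst q) (snd p - snd q) \<partial>N \<partial>N)"
      by (subst N.nn_integral_fst[OF m4, symmetric]) simp
    also have "\<dots> = (\<integral>\<^sup>+t. \<integral>\<^sup>+x. \<integral>\<^sup>+q. K x (fst q) (t - snd q) \<partial>N \<partial>?NA \<partial>?NT)"
      using N.borel_measurable_nn_integral_fst[OF m4] by (subst Nf) simp_all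
    also have "\<dots> = (\<integral>\<^sup>+t. \<integral>\<^sup>+x. \<integral>\<^sup>+s. \<integral>\<^sup>+y. K x y (t - s) \<partial>?NA \<partial>?NT \<partial>?NA \<partial>?NT)"
    proof (intro nn_integral_cong)
      fix t x
      have "(\<lambda>q. K x (fst q) (t - snd q)) \<in> borel_measurable N" by (rule Km) measurable
      from Nf[OF this] show "(\<integral>\<^sup>+q. K x (fst q) (t - snd q) \<partial>N) = (\<integral>\<^sup>+s. \<integral>\<^sup>+y. K x y (t - s) \<partial>?NA \<partial>?NT)" by simp
    qed
    also have "\<dots> = (\<integral>\<^sup>+t. \<integral>\<^sup>+s. \<integral>\<^sup>+x. \<integral>\<^sup>+y. K x y (t - s) \<partial>?NA \<partial>?NA \<partial>?NT \<partial>?NT)"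
    proof (rule nn_integral_cong)
      fix t
      have [measurable]: "(\<lambda>z. K (fst (fst z)) (snd z) (t - snd (fst z))) \<in> borel_measurable ((?NA \<Otimes>\<^sub>M ?NT) \<Otimes>\<^sub>M ?NA)"
        by (rule Km) measurable
      show "(\<integral>\<^sup>+x. \<integral>\<^sup>+s. \<integral>\<^sup>+y. K x y (t - s) \<partial>?NA \<partial>?NT \<partial>?NA) = (\<integral>\<^sup>+s. \<integral>\<^sup>+x. \<integral>\<^sup>+y. K x y (t - s) \<partial>?NA \<partial>?NA \<partial>?NT)"
        by (rule AT.Fubini'[symmetric]) measurable
    qed
    also have "\<dots> = (\<integral>\<^sup>+t. \<integral>\<^sup>+s. H \<bar>t - s\<bar> \<partial>?NT \<partial>?NT)"
      unfolding H_eq by (simp add: K_def)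
    also have "\<dots> = (\<integral>\<^sup>+t. (\<integral>\<^sup>+s. H \<bar>t - s\<bar> * indicator {0..T} s \<partial>lborel) * indicator {0..T} t \<partial>lborel)"
      by (subst (1 2) nn_integral_lborel_on) simp_all
    finally show ?thesis ..
  qed
  also have "enn2real \<dots> = (\<integral>r. C (norm (fst (fst r) - fst (snd r))) \<bar>snd (fst r) - snd (snd r)\<bar> \<partial>(N \<Otimes>\<^sub>M N))"
  proof (rule integral_eq_nn_integral[symmetric])
    have sN: "sets N = sets ((borel :: 'a measure) \<Otimes>\<^sub>M (borel :: real measure))" unfolding N_def borel_prod by simp
    note [measurable_cong] = sN
    have "(\<lambda>r. (norm (fst (fst r) - fst (snd r)), snd (fst r) - snd (snd r))) \<in> N \<Otimes>\<^sub>M N \<rightarrow>\<^sub>M borel \<Otimes>\<^sub>M borel"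
      by measurable
    from measurable_compose[OF this Cm]
    show "(\<lambda>r. C (norm (fst (fst r) - fst (snd r))) \<bar>snd (fst r) - snd (snd r)\<bar>) \<in> borel_measurable (N \<Otimes>\<^sub>M N)"
      by simp
  qed (intro AE_I2 C(1); simp)
  finally show ?thesis by (simp add: a_def L_def case_prod_unfold)
qed

section \<open>Sojourn measures of stationary Gaussian fields\<close>

text \<open>Space and time form a single index, so that the functionals become integrals over one
  product set; the invariance of the field is encoded in the shape of \<open>cov\<close>.\<close>

locale stationary_gaussian_field = prob_space M for M :: "'w measure" +
  fixes X :: "'a::euclidean_space \<times> real \<Rightarrow> 'w \<Rightarrow> real" and C :: "real \<Rightarrow> real \<Rightarrow> real"
  assumes field_measurable: "(\<lambda>(p, w). X p w) \<in> borel_measurable (borel \<Otimes>\<^sub>M M)"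
    and gauss: "\<And>F a. finite F \<Longrightarrow> gaussian_rv M (\<lambda>w. \<Sum>p\<in>F. a p * X p w)"
    and mean: "\<And>p. expectation (X p) = 0"
    and sq: "\<And>p. expectation (\<lambda>w. (X p w)\<^sup>2) = 1"
    and cov: "\<And>p q. expectation (\<lambda>w. X p w * X q w) = C (norm (fst p - fst q)) \<bar>snd p - snd q\<bar>"
    and C_nonneg: "\<And>z \<tau>. 0 \<le> z \<Longrightarrow> 0 \<le> \<tau> \<Longrightarrow> 0 \<le> C z \<tau>"
    and ms_cont: "ms_uniformly_continuous M X"
begin

lemma X_measurable[measurable]: "X p \<in> borel_measurable M"
  using gaussian_rv_measurable[OF gauss[of "{p}" "\<lambda>_. 1"]] by simp

lemma X_sq_integrable: "integrable M (\<lambda>w. (X p w)\<^sup>2)"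
  by (rule square_integrableI[OF sq])

lemma X_second_order: "second_order_field M X 1"
  unfolding second_order_field_def using field_measurable X_sq_integrable sq by simp

lemma X_pair_gaussian: "gaussian_rv M (\<lambda>w. a * X p w + b * X q w)"
proof (cases "p = q")
  case True
  then show ?thesis using gauss[of "{p}" "\<lambda>_. a + b"] by (simp add: distrib_right)
next
  case False
  then show ?thesis using gauss[of "{p, q}" "\<lambda>r. if r = p then a else b"] by simp
qed

lemma X_std_normal: "distr M borel (X p) = std_normal_distribution"
proof (rule distributed_std_normalI_char[OF X_measurable])
  fix t
  show "expectation (\<lambda>w. iexp (t * X p w)) = of_real (exp (- t\<^sup>2 / 2))"
    using gaussian_rv_char[of "X p" t] gauss[of "{p}" "\<lambda>_. 1"] mean[of p] sq[of p] by simp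
qed

lemma X_diff_sq:
  "expectation (\<lambda>w. (X p w - X q w)\<^sup>2) = 2 - 2 * C (norm (fst p - fst q)) \<bar>snd p - snd q\<bar>"
proof -
  have "integrable M (\<lambda>w. X p w * X q w)"
    by (rule integrable_mult_squares[OF _ _ X_sq_integrable X_sq_integrable]) measurable
  moreover have "(X p w - X q w)\<^sup>2 = (X p w)\<^sup>2 + (X q w)\<^sup>2 - 2 * (X p w * X q w)" for w
    by (simp add: power2_diff)
  ultimately show ?thesis using X_sq_integrable by (simp add: sq cov)
qed

text \<open>Every pair of lags is realised by two points, along a unit vector, and their increment
  has nonnegative variance \<open>2 - 2 * C z \<tau>\<close>.\<close>

lemma C_le_1:
  assumes "0 \<le> z" "0 \<le> \<tau>"
  shows "C z \<tau> \<le> 1"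
proof -
  obtain b :: 'a where "b \<in> Basis" using nonempty_Basis by blast
  then have b: "norm b = 1" by simp
  define p q where "p = (z *\<^sub>R b, \<tau>)" and "q = (0 :: 'a, 0 :: real)"
  have "C (norm (fst p - fst q)) \<bar>snd p - snd q\<bar> = C z \<tau>"
    using assms b by (simp add: p_def q_def)
  moreover have "0 \<le> expectation (\<lambda>w. (X p w - X q w)\<^sup>2)" by simp
  ultimately show ?thesis unfolding X_diff_sq by simp
qed

text \<open>Along a unit direction \<open>C\<close> is the covariance with the field at the origin,
  an expectation depending on parameters, so joint measurability of the field is inherited.\<close>

lemma C_measurable: "(\<lambda>z. C \<bar>fst z\<bar> \<bar>snd z\<bar>) \<in> borel_measurable (borel \<Otimes>\<^sub>M borel)"
proof -
  obtain b :: 'a where "b \<in> Basis" using nonempty_Basis by blast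
  then have b: "norm b = 1" by simp
  have "(\<lambda>z. ((fst (fst z) *\<^sub>R b, snd (fst z) :: real), snd z)) \<in> (borel \<Otimes>\<^sub>M borel) \<Otimes>\<^sub>M M \<rightarrow>\<^sub>M borel \<Otimes>\<^sub>M M"
    by (rule measurable_Pair, rule borel_measurable_Pair) simp_all
  from measurable_compose[OF this field_measurable]
  have [measurable]: "(\<lambda>z. X (fst (fst z) *\<^sub>R b, snd (fst z)) (snd z)) \<in> borel_measurable ((borel \<Otimes>\<^sub>M borel) \<Otimes>\<^sub>M M)"
    by simp
  have "(\<lambda>z. expectation (\<lambda>w. X (fst z *\<^sub>R b, snd z) w * X (0, 0) w)) \<in> borel_measurable (borel \<Otimes>\<^sub>M borel)"
    by measurable
  then show ?thesis using b by (simp add: cov)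
qed

lemma remainder_measurable:
  "(\<lambda>(p, w). rank_one_remainder u (X p w)) \<in> borel_measurable (borel \<Otimes>\<^sub>M M)"
proof -
  note [measurable] = field_measurable
  show ?thesis by measurable
qed

lemma remainder_second_order:
  assumes "0 \<le> u"
  shows "second_order_field M (\<lambda>p w. rank_one_remainder u (X p w)) 1"
  unfolding second_order_field_def
  using remainder_measurable rank_one_remainder_sq[OF X_measurable X_std_normal mean sq assms] by simp

lemma exceedance_second_order: "second_order_field M (\<lambda>p w. indicator {u..} (X p w)) 1"
  unfolding second_order_field_def
proof (intro conjI allI)
  note [measurable] = field_measurable
  show "(\<lambda>(p, w). indicator {u..} (X p w) :: real) \<in> borel_measurable (borel \<Otimes>\<^sub>M M)" by measurable
  fix p
  show 1: "integrable M (\<lambda>w. (indicator {u..} (X p w) :: real)\<^sup>2)"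
    by (intro integrable_const_bound[where B=1]) (auto simp: indicator_def)
  show "expectation (\<lambda>w. (indicator {u..} (X p w) :: real)\<^sup>2) \<le> 1"
  proof -
    have "expectation (\<lambda>w. (indicator {u..} (X p w) :: real)\<^sup>2) \<le> expectation (\<lambda>_. 1)"
      by (intro integral_mono 1 integrable_const) (simp add: indicator_def)
    then show ?thesis by (simp add: prob_space)
  qed
qed

lemma X_small_interval: "0 \<le> h \<Longrightarrow> prob {w\<in>space M. X p w \<in> {u - h..u + h}} \<le> 2 * h"
proof -
  assume h: "0 \<le> h"
  have "ennreal (prob {w\<in>space M. X p w \<in> {u - h..u + h}}) = emeasure (distr M borel (X p)) {u - h..u + h}"
    by (subst emeasure_distr) (auto simp: emeasure_eq_measure intro!: arg_cong[where f=prob])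
  also have "\<dots> = (\<integral>\<^sup>+x. ennreal (std_normal_density x) * indicator {u - h..u + h} x \<partial>lborel)"
    unfolding X_std_normal by (simp add: emeasure_density)
  also have "\<dots> \<le> (\<integral>\<^sup>+x. indicator {u - h..u + h} x \<partial>lborel)"
    using std_normal_density_le_1 by (intro nn_integral_mono) (auto split: split_indicator simp: ennreal_le_1)
  also have "\<dots> = ennreal (2 * h)" using h by simp
  finally show ?thesis using h by (simp add: ennreal_le_iff)
qed

text \<open>The indicators differ only if the two values are at least \<open>h\<close> apart or one
  value lies within \<open>h\<close> of the level. Markov's inequality bounds the first event, the
  bounded normal density the second.\<close>

lemma exceedance_ms_continuous: "ms_uniformly_continuous M (\<lambda>p w. indicator {u..} (X p w))"
  unfolding ms_uniformly_continuous_def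
proof (intro allI impI)
  fix \<epsilon> :: real assume "\<epsilon> > 0"
  \<comment> \<open>Chosen so that \<open>2 * h = \<epsilon> / 2\<close>; the other half is left for
    Markov's inequality.\<close>
  define h where "h = \<epsilon> / 4"
  have h: "h > 0" using \<open>\<epsilon> > 0\<close> by (simp add: h_def)
  have "\<epsilon> / 2 * h\<^sup>2 > 0" using \<open>\<epsilon> > 0\<close> h by simp
  then obtain \<delta> where \<delta>: "\<delta> > 0" "\<And>p q. dist p q \<le> \<delta> \<Longrightarrow> expectation (\<lambda>w. (X p w - X q w)\<^sup>2) \<le> \<epsilon> / 2 * h\<^sup>2"
    using ms_cont unfolding ms_uniformly_continuous_def by blast
  have "expectation (\<lambda>w. (indicator {u..} (X p w) - indicator {u..} (X q w) :: real)\<^sup>2) \<le> \<epsilon>" if "dist p q \<le> \<delta>" for p q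
  proof -
    let ?A = "{w\<in>space M. h\<^sup>2 \<le> (X p w - X q w)\<^sup>2}" and ?B = "{w\<in>space M. X p w \<in> {u - h..u + h}}"
    have D: "integrable M (\<lambda>w. (X p w - X q w)\<^sup>2)"
      by (rule integrable_diff_squares[OF _ _ X_sq_integrable X_sq_integrable]) measurable
    have *: "h \<le> \<bar>a\<bar> \<Longrightarrow> h\<^sup>2 \<le> a\<^sup>2" for a
      using h power_mono[of h "\<bar>a\<bar>" 2] by simp
    have "expectation (\<lambda>w. (indicator {u..} (X p w) - indicator {u..} (X q w) :: real)\<^sup>2) \<le> expectation (indicator (?A \<union> ?B))"
    proof (rule integral_mono)
      show "integrable M (\<lambda>w. (indicator {u..} (X p w) - indicator {u..} (X q w) :: real)\<^sup>2)"
        by (intro integrable_const_bound[where B=1]) (auto simp: indicator_def)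
      show "integrable M (indicator (?A \<union> ?B) :: 'w \<Rightarrow> real)"
        by (simp add: less_top[symmetric])
      fix w assume "w \<in> space M"
      then show "(indicator {u..} (X p w) - indicator {u..} (X q w) :: real)\<^sup>2 \<le> indicator (?A \<union> ?B) w"
      proof (cases "h \<le> \<bar>X p w - X q w\<bar>")
        case True
        then show ?thesis using *[OF True] \<open>w \<in> space M\<close> by (simp add: indicator_def)
      next
        case False
        have "X p w \<in> {u - h..u + h}" if "(u \<le> X p w) \<noteq> (u \<le> X q w)"
          using False that by (auto simp: abs_if split: if_splits)
        then show ?thesis using \<open>w \<in> space M\<close> by (auto simp: indicator_def)
      qed
    qed
    also have "\<dots> = prob (?A \<union> ?B)" by simp
    also have "\<dots> \<le> prob ?A + prob ?B" by (rule measure_Un_le) measurable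
    also have "prob ?A \<le> expectation (\<lambda>w. (X p w - X q w)\<^sup>2) / h\<^sup>2"
      using h by (intro integral_Markov_inequality_measure[OF D, of "{}", simplified]) auto
    also have "\<dots> \<le> \<epsilon> / 2 * h\<^sup>2 / h\<^sup>2" by (intro divide_right_mono \<delta> that) simp
    also have "\<dots> = \<epsilon> / 2" using h by simp
    also have "prob ?B \<le> 2 * h" using h by (intro X_small_interval) simp
    finally show ?thesis by (simp add: h_def)
  qed
  then show "\<exists>\<delta>>0. \<forall>p q. dist p q \<le> \<delta> \<longrightarrow> expectation (\<lambda>w. (indicator {u..} (X p w) - indicator {u..} (X q w) :: real)\<^sup>2) \<le> \<epsilon>"
    using \<delta>(1) by (intro exI[of _ \<delta>]) simp
qed

lemma remainder_cov_le_1: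
  assumes u: "0 \<le> u"
  shows "expectation (\<lambda>w. rank_one_remainder u (X p w) * rank_one_remainder u (X q w)) \<le> 1"
proof -
  note rs = rank_one_remainder_sq[OF X_measurable X_std_normal mean sq u]
  have "expectation (\<lambda>w. rank_one_remainder u (X p w) * rank_one_remainder u (X q w)) \<le>
    expectation (\<lambda>w. ((rank_one_remainder u (X p w))\<^sup>2 + (rank_one_remainder u (X q w))\<^sup>2) / 2)"
  proof (rule integral_mono)
    show "integrable M (\<lambda>w. rank_one_remainder u (X p w) * rank_one_remainder u (X q w))"
      by (rule integrable_mult_squares[OF _ _ rs(1) rs(1)]) measurable
    show "integrable M (\<lambda>w. ((rank_one_remainder u (X p w))\<^sup>2 + (rank_one_remainder u (X q w))\<^sup>2) / 2)"
      using rs(1) by simp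
    show "a * b \<le> (a\<^sup>2 + b\<^sup>2) / 2" for a b :: real
      using sum_squares_bound[of a b] by simp
  qed
  also have "\<dots> = (expectation (\<lambda>w. (rank_one_remainder u (X p w))\<^sup>2) + expectation (\<lambda>w. (rank_one_remainder u (X q w))\<^sup>2)) / 2"
    using rs(1) by simp
  also have "\<dots> \<le> 1" using rs(2)[of p] rs(2)[of q] by simp
  finally show ?thesis .
qed

text \<open>Only the bracket is replaced by its value at \<open>e\<close>. The linear factor
  \<open>C\<close> stays, because its integral over all pairs is the variance.\<close>

lemma remainder_cov_far:
  assumes u: "0 \<le> u" and e: "e < 1" and r: "C (norm (fst p - fst q)) \<bar>snd p - snd q\<bar> \<le> e"
  shows "expectation (\<lambda>w. rank_one_remainder u (X p w) * rank_one_remainder u (X q w))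
    \<le> (std_normal_density u)\<^sup>2 * (exp (u\<^sup>2 * e) / sqrt (1 - e\<^sup>2) - 1) * C (norm (fst p - fst q)) \<bar>snd p - snd q\<bar>"
proof -
  let ?r = "C (norm (fst p - fst q)) \<bar>snd p - snd q\<bar>"
  have r0: "0 \<le> ?r" by (intro C_nonneg) auto
  have "expectation (\<lambda>w. rank_one_remainder u (X p w) * rank_one_remainder u (X q w))
    \<le> ?r * (std_normal_density u)\<^sup>2 * (exp (u\<^sup>2 * ?r) / sqrt (1 - ?r\<^sup>2) - 1)"
    using r e by (intro rank_one_remainder_cov X_pair_gaussian mean sq cov r0 u) simp
  also have "\<dots> \<le> ?r * (std_normal_density u)\<^sup>2 * (exp (u\<^sup>2 * e) / sqrt (1 - e\<^sup>2) - 1)"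
  proof (intro mult_left_mono diff_right_mono frac_le)
    have "e\<^sup>2 < 1" using e r r0 by (simp add: abs_square_less_1)
    then show "0 < sqrt (1 - e\<^sup>2)" by simp
    have "?r\<^sup>2 \<le> e\<^sup>2" using r r0 by (intro power_mono) auto
    then show "sqrt (1 - e\<^sup>2) \<le> sqrt (1 - ?r\<^sup>2)" by simp
    show "exp (u\<^sup>2 * ?r) \<le> exp (u\<^sup>2 * e)" using r by (simp add: mult_left_mono)
  qed (use r0 in auto)
  finally show ?thesis by (simp add: mult_ac)
qed

end

section \<open>Second moment of the integrated remainder\<close>

definition double_cov :: "(real \<Rightarrow> real \<Rightarrow> real) \<Rightarrow> 'a::euclidean_space set \<Rightarrow> real \<Rightarrow> real" where
  "double_cov C A T = 2 * T * (measure lborel A)\<^sup>2 *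
     (LBINT \<tau>:{0..T}. (1 - \<tau> / T) * (LBINT z:{0..diameter A}. C z \<tau> * distance_density A z))"

context stationary_gaussian_field
begin

context
  fixes A :: "'a set" and T :: real
  assumes A[measurable]: "A \<in> sets borel" and bA: "bounded A" and A_pos: "measure lborel A > 0" and T: "T > 0"
begin

abbreviation "N \<equiv> lborel_on (A \<times> {0..T})"
abbreviation "V \<equiv> double_cov C A T"

lemma bounded_domain: "bounded (A \<times> {0..T})"
  by (intro bounded_Times bA) simp

lemma borel_domain[measurable]: "A \<times> {0..T} \<in> sets borel"
  by (rule borel_Times) simp_all

lemma finite_N: "finite_measure N"
  by (rule finite_measure_lborel_on[OF borel_domain bounded_domain])

lemma measure_N: "measure N UNIV = measure lborel A * T"
proof -
  have "emeasure lborel (A \<times> {0..T}) = emeasure lborel A * emeasure lborel {0..T}"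
    unfolding lborel_prod[symmetric] by (rule lborel.emeasure_pair_measure_Times) simp_all
  then have "measure lborel (A \<times> {0..T}) = measure lborel A * T"
    using T by (simp add: measure_def enn2real_mult)
  then show ?thesis using measure_lborel_on[OF borel_domain, of UNIV] by simp
qed

lemmas field_integral = second_order_field_integral[OF _ finite_N sets_lborel_on]

lemma cov_integrable: "integrable (N \<Otimes>\<^sub>M N) (\<lambda>(p, q). C (norm (fst p - fst q)) \<bar>snd p - snd q\<bar>)"
  using field_integral(4)[OF X_second_order] by (simp add: cov)

lemma V_eq: "V = (\<integral>(p, q). C (norm (fst p - fst q)) \<bar>snd p - snd q\<bar> \<partial>(N \<Otimes>\<^sub>M N))"
  unfolding double_cov_def
  by (rule variance_double_integral[OF C_measurable C_nonneg C_le_1 A bA A_pos T])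

lemma integral_X_sq: "expectation (\<lambda>w. (\<integral>p. X p w \<partial>N)\<^sup>2) = V"
  using field_integral(5)[OF X_second_order] by (simp add: cov V_eq)

lemma integral_X_mean: "expectation (\<lambda>w. \<integral>p. X p w \<partial>N) = 0"
proof -
  interpret N: finite_measure N by (rule finite_N)
  interpret NM: pair_sigma_finite N M ..
  have "expectation (\<lambda>w. \<integral>p. X p w \<partial>N) = (\<integral>p. expectation (\<lambda>w. X p w) \<partial>N)"
    by (rule NM.Fubini_integral) (use field_integral(1)[OF X_second_order] in simp)
  also have "\<dots> = 0" by (simp add: mean)
  finally show ?thesis .
qed

lemma integral_X_normal:
  assumes V: "V > 0"
  shows "distr M borel (\<lambda>w. (\<integral>p. X p w \<partial>N) / sqrt V) = std_normal_distribution"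
proof (rule distributed_std_normalI_char)
  have [measurable]: "(\<lambda>w. \<integral>p. X p w \<partial>N) \<in> borel_measurable M"
    by (rule field_integral(2)[OF X_second_order])
  show "(\<lambda>w. (\<integral>p. X p w \<partial>N) / sqrt V) \<in> borel_measurable M" by measurable
  fix t
  have "has_ms_integral M X (A \<times> {0..T}) (\<lambda>w. \<integral>p. X p w \<partial>N)"
    by (rule has_ms_integral_pathwise[OF X_second_order ms_cont borel_domain bounded_domain])
  from ms_integral_gaussian_char[OF this borel_domain bounded_domain gauss mean X_sq_integrable, of "t / sqrt V"]
  have "expectation (\<lambda>w. iexp (t / sqrt V * (\<integral>p. X p w \<partial>N))) = of_real (exp (- (V * (t / sqrt V)\<^sup>2 / 2)))"
    unfolding integral_X_sq .
  moreover have "V * (t / sqrt V)\<^sup>2 = t\<^sup>2" using V by (simp add: power_divide)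
  ultimately show "expectation (\<lambda>w. iexp (t * ((\<integral>p. X p w \<partial>N) / sqrt V))) = of_real (exp (- t\<^sup>2 / 2))"
    by simp
qed

text \<open>With one point fixed, the other lies in a ball of radius \<open>a\<close> times an
  interval of length \<open>2 * b\<close>; the first point then ranges over space-time of mass
  \<open>measure lborel A * T\<close>.\<close>

lemma near_measure:
  fixes a b :: real
  assumes a: "a \<ge> 0" and b: "b \<ge> 0"
  defines "S \<equiv> {r :: ('a \<times> real) \<times> ('a \<times> real). norm (fst (fst r) - fst (snd r)) < a \<and> \<bar>snd (fst r) - snd (snd r)\<bar> < b}"
  shows "S \<in> sets (N \<Otimes>\<^sub>M N)"
    and "measure (N \<Otimes>\<^sub>M N) S \<le> measure lborel A * T * (unit_ball_vol (DIM('a)) * a ^ DIM('a) * (2 * b))"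
proof -
  interpret N: finite_measure N by (rule finite_N)
  interpret NN: finite_measure "N \<Otimes>\<^sub>M N" by (rule finite_measure_pair_measure) unfold_locales
  let ?c = "unit_ball_vol (DIM('a)) * a ^ DIM('a) * (2 * b)"
  have c0: "?c \<ge> 0" using a b by simp
  have "S = {r. norm (fst (fst r) - fst (snd r)) < a} \<inter> {r. \<bar>snd (fst r) - snd (snd r)\<bar> < b}"
    by (auto simp: S_def)
  then have "open S"
    by (simp only:) (intro open_Int open_Collect_less continuous_intros)
  then have "S \<in> sets (borel \<Otimes>\<^sub>M borel)" unfolding borel_prod by simp
  moreover have "sets (N \<Otimes>\<^sub>M N) = sets (borel \<Otimes>\<^sub>M borel)" by (rule sets_pair_measure_cong) simp_all
  ultimately show S: "S \<in> sets (N \<Otimes>\<^sub>M N)" by simp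
  have "emeasure (N \<Otimes>\<^sub>M N) S = (\<integral>\<^sup>+p. emeasure N (Pair p -` S) \<partial>N)"
    by (rule N.emeasure_pair_measure_alt[OF S])
  also have "\<dots> \<le> (\<integral>\<^sup>+p. ennreal ?c \<partial>N)"
  proof (rule nn_integral_mono)
    fix p :: "'a \<times> real"
    let ?B = "ball (fst p) a \<times> {snd p - b<..<snd p + b}"
    have B: "?B \<in> sets borel" by (intro borel_Times) simp_all
    have "Pair p -` S \<subseteq> ?B" by (auto simp: S_def dist_norm abs_less_iff)
    then have "emeasure N (Pair p -` S) \<le> emeasure N ?B"
      using B by (intro emeasure_mono) simp_all
    also have "\<dots> = emeasure lborel (A \<times> {0..T} \<inter> ?B)"
      by (rule emeasure_lborel_on[OF borel_domain B])
    also have "\<dots> \<le> emeasure lborel ?B" using B by (intro emeasure_mono) auto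
    also have "\<dots> = emeasure lborel (ball (fst p) a) * emeasure lborel {snd p - b<..<snd p + b}"
      unfolding lborel_prod[symmetric] by (rule lborel.emeasure_pair_measure_Times) simp_all
    also have "\<dots> = ennreal ?c"
      using a b by (simp add: emeasure_ball ennreal_mult)
    finally show "emeasure N (Pair p -` S) \<le> ennreal ?c" .
  qed
  also have "\<dots> = ennreal (measure lborel A * T * ?c)"
    using c0 A_pos T by (simp add: N.emeasure_eq_measure measure_N ennreal_mult mult.commute)
  finally show "measure (N \<Otimes>\<^sub>M N) S \<le> measure lborel A * T * ?c"
    unfolding NN.emeasure_eq_measure using c0 A_pos T by (subst (asm) ennreal_le_iff) auto
qed

text \<open>Close pairs get the trivial bound 1, all others the far bound. Since the far bound is
  nonnegative it may be kept on close pairs as well, so that its integral is over all pairs and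
  equals a multiple of \<open>V\<close>.\<close>

lemma remainder_integral_sq:
  assumes u: "0 \<le> u" and e: "e < 1" and a: "a \<ge> 0" and b: "b \<ge> 0"
    and far: "\<And>z \<tau>. 0 \<le> z \<Longrightarrow> 0 \<le> \<tau> \<Longrightarrow> b \<le> \<tau> \<or> a \<le> z \<Longrightarrow> C z \<tau> \<le> e"
  shows "expectation (\<lambda>w. (\<integral>p. rank_one_remainder u (X p w) \<partial>N)\<^sup>2) \<le>
    measure lborel A * T * (unit_ball_vol (DIM('a)) * a ^ DIM('a) * (2 * b)) +
    (std_normal_density u)\<^sup>2 * (exp (u\<^sup>2 * e) / sqrt (1 - e\<^sup>2) - 1) * V"
proof -
  interpret N: finite_measure N by (rule finite_N)
  interpret NN: finite_measure "N \<Otimes>\<^sub>M N" by (rule finite_measure_pair_measure) unfold_locales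
  define S where "S = {r :: ('a \<times> real) \<times> ('a \<times> real). norm (fst (fst r) - fst (snd r)) < a \<and> \<bar>snd (fst r) - snd (snd r)\<bar> < b}"
  note near = near_measure[OF a b, folded S_def]
  \<comment> \<open>At the threshold point \<open>(a, b)\<close> itself \<open>C\<close> lies
    between 0 and \<open>e\<close>.\<close>
  have e0: "0 \<le> e" using far[of a b] C_nonneg[of a b] a b by auto
  let ?k = "(std_normal_density u)\<^sup>2 * (exp (u\<^sup>2 * e) / sqrt (1 - e\<^sup>2) - 1)"
  have k0: "0 \<le> ?k"
  proof -
    have "e\<^sup>2 < 1" using e e0 by (simp add: abs_square_less_1)
    then have q: "0 < sqrt (1 - e\<^sup>2)" by simp
    have "sqrt (1 - e\<^sup>2) \<le> 1" by simp
    also have "1 \<le> exp (u\<^sup>2 * e)" using e0 by simp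
    finally have "1 \<le> exp (u\<^sup>2 * e) / sqrt (1 - e\<^sup>2)" using q by (simp only: le_divide_eq_1_pos)
    then show ?thesis by simp
  qed
  let ?c = "\<lambda>r. C (norm (fst (fst r) - fst (snd r))) \<bar>snd (fst r) - snd (snd r)\<bar>"
  have c_int: "integrable (N \<Otimes>\<^sub>M N) ?c" using cov_integrable by (simp add: case_prod_unfold)
  have S_int: "integrable (N \<Otimes>\<^sub>M N) (indicator S :: _ \<Rightarrow> real)"
    using near(1) by (simp add: NN.emeasure_eq_measure)
  have "expectation (\<lambda>w. (\<integral>p. rank_one_remainder u (X p w) \<partial>N)\<^sup>2) =
    (\<integral>r. expectation (\<lambda>w. rank_one_remainder u (X (fst r) w) * rank_one_remainder u (X (snd r) w)) \<partial>(N \<Otimes>\<^sub>M N))"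
    using field_integral(5)[OF remainder_second_order[OF u]] by (simp add: case_prod_unfold)
  also have "\<dots> \<le> (\<integral>r. indicator S r + ?k * ?c r \<partial>(N \<Otimes>\<^sub>M N))"
  proof (rule integral_mono)
    show "integrable (N \<Otimes>\<^sub>M N) (\<lambda>r. expectation (\<lambda>w. rank_one_remainder u (X (fst r) w) * rank_one_remainder u (X (snd r) w)))"
      using field_integral(4)[OF remainder_second_order[OF u]] by (simp add: case_prod_unfold)
    show "integrable (N \<Otimes>\<^sub>M N) (\<lambda>r. indicator S r + ?k * ?c r)"
      by (intro Bochner_Integration.integrable_add S_int integrable_mult_right c_int)
    fix r :: "('a \<times> real) \<times> ('a \<times> real)"
    have c0: "0 \<le> ?c r" by (intro C_nonneg) auto
    show "expectation (\<lambda>w. rank_one_remainder u (X (fst r) w) * rank_one_remainder u (X (snd r) w)) \<le> indicator S r + ?k * ?c r"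
    proof (cases "r \<in> S")
      case True
      have "0 \<le> ?k * ?c r" using k0 c0 by (rule mult_nonneg_nonneg)
      then show ?thesis using remainder_cov_le_1[OF u, of "fst r" "snd r"] True by simp
    next
      case False
      then have "?c r \<le> e" by (intro far) (auto simp: S_def)
      from remainder_cov_far[OF u e this] False show ?thesis by simp
    qed
  qed
  also have "\<dots> = measure (N \<Otimes>\<^sub>M N) S + ?k * (\<integral>r. ?c r \<partial>(N \<Otimes>\<^sub>M N))"
    using near(1) S_int c_int by (subst Bochner_Integration.integral_add) (auto intro!: integrable_mult_right)
  also have "(\<integral>r. ?c r \<partial>(N \<Otimes>\<^sub>M N)) = V" unfolding V_eq by (simp add: case_prod_unfold)
  finally show ?thesis using near(2) by simp
qed

lemma sojourn_decomposition:
  assumes u: "0 \<le> u"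
  shows "AE w in M. (\<integral>p. indicator {u..} (X p w) \<partial>N) - measure lborel A * T * std_normal_tail u
    = (\<integral>p. rank_one_remainder u (X p w) \<partial>N) + std_normal_density u * (\<integral>p. X p w \<partial>N)"
proof -
  interpret N: finite_measure N by (rule finite_N)
  interpret NM: pair_sigma_finite N M ..
  have "AE w in M. integrable N (\<lambda>p. X p w)"
    using NM.AE_integrable_snd[OF field_integral(1)[OF X_second_order]] .
  moreover have "AE w in M. integrable N (\<lambda>p. indicator {u..} (X p w) :: real)"
    using NM.AE_integrable_snd[OF field_integral(1)[OF exceedance_second_order]] .
  ultimately show ?thesis
  proof eventually_elim
    case (elim w)
    have c: "integrable N (\<lambda>p. std_normal_tail u)" by simp
    have "(\<integral>p. rank_one_remainder u (X p w) \<partial>N) = (\<integral>p. indicator {u..} (X p w) \<partial>N) - (\<integral>p. std_normal_tail u \<partial>N) - (\<integral>p. std_normal_density u * X p w \<partial>N)"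
      unfolding rank_one_remainder_def
      by (subst Bochner_Integration.integral_diff) (use elim c in \<open>auto intro!: integrable_mult_right Bochner_Integration.integral_diff\<close>)
    then show ?case by (simp add: measure_N)
  qed
qed

end

end

section \<open>Growth rates\<close>

text \<open>After division by the squared normalisation, the second summand is the bracket, which
  tends to 0 by \<open>eps\<close>. In the first, the exponents of \<open>T\<close> leave
  \<open>\<beta>1 - \<delta>1 + \<gamma> * n * (\<beta>2 - \<delta>2)\<close>, which has to outweigh
  \<open>exp (u\<^sup>2)\<close> from the inverse squared density.\<close>

lemma remainder_ratio_tendsto:
  fixes u VF eps :: "real \<Rightarrow> real" and n :: nat
  assumes VF: "\<forall>\<^sub>F T in at_top. T powr (1 + \<delta>1) * T powr (\<gamma> * real n * (1 + \<delta>2)) \<le> VF T"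
    and u: "filterlim u at_top at_top" and u_ln: "(\<lambda>T. (u T)\<^sup>2) \<in> o[at_top](\<lambda>T. ln T)"
    and eps: "\<forall>\<^sub>F T in at_top. 0 \<le> eps T" "((\<lambda>T. (u T)\<^sup>2 * eps T) \<longlongrightarrow> 0) at_top"
    and par: "0 \<le> \<gamma>" "\<beta>1 < \<delta>1" "\<beta>2 < \<delta>2" "0 \<le> k"
  shows "((\<lambda>T. (k * T powr (\<gamma> * real n) * T * (T powr (\<gamma> * \<beta>2)) ^ n * T powr \<beta>1 +
      (std_normal_density (u T))\<^sup>2 * (exp ((u T)\<^sup>2 * eps T) / sqrt (1 - (eps T)\<^sup>2) - 1) * VF T)
      / ((std_normal_density (u T))\<^sup>2 * VF T)) \<longlongrightarrow> 0) at_top"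
proof -
  \<comment> \<open>Half of the exponent gained in time: one half pays for
    \<open>exp ((u T)\<^sup>2) \<le> T powr c\<close>, the other remains as the decay
    \<open>T powr (- c)\<close>.\<close>
  define c where "c = (\<delta>1 - \<beta>1) / 2"
  have c: "c > 0" using par by (simp add: c_def)
  have u_le: "\<forall>\<^sub>F T in at_top. (u T)\<^sup>2 \<le> c * ln T"
    using landau_o.smallD[OF u_ln c] eventually_ge_at_top[of 1]
    by eventually_elim simp
  have far: "((\<lambda>T. exp ((u T)\<^sup>2 * eps T) / sqrt (1 - (eps T)\<^sup>2) - 1) \<longlongrightarrow> 0) at_top"
  proof -
    have "(eps \<longlongrightarrow> 0) at_top"
    proof (rule tendsto_sandwich[OF _ _ tendsto_const eps(2)])
      show "\<forall>\<^sub>F T in at_top. eps T \<le> (u T)\<^sup>2 * eps T"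
        using filterlim_at_top[THEN iffD1, OF u, rule_format, of 1] eps(1)
      proof eventually_elim
        case (elim T)
        then have "1 * eps T \<le> (u T)\<^sup>2 * eps T" by (intro mult_right_mono) simp_all
        then show ?case by simp
      qed
    qed (use eps(1) in simp)
    then have "((\<lambda>T. exp ((u T)\<^sup>2 * eps T) / sqrt (1 - (eps T)\<^sup>2) - 1) \<longlongrightarrow> exp 0 / sqrt (1 - 0\<^sup>2) - 1) at_top"
      by (intro tendsto_intros eps(2)) simp_all
    then show ?thesis by simp
  qed
  let ?near = "\<lambda>T. k * T powr (\<gamma> * real n) * T * (T powr (\<gamma> * \<beta>2)) ^ n * T powr \<beta>1 / ((std_normal_density (u T))\<^sup>2 * VF T)"
  have near: "(?near \<longlongrightarrow> 0) at_top"
  proof (rule tendsto_sandwich[OF _ _ tendsto_const])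
    show "\<forall>\<^sub>F T in at_top. 0 \<le> ?near T"
      using VF eventually_ge_at_top[of 1]
    proof eventually_elim
      case (elim T)
      have "0 \<le> VF T" by (rule order_trans[OF _ elim(1)]) simp
      then show ?case using elim par by simp
    qed
    show "\<forall>\<^sub>F T in at_top. ?near T \<le> k * (2 * pi) * T powr (- c)"
      using VF u_le eventually_ge_at_top[of 1]
    proof eventually_elim
      case (elim T)
      then have T: "T > 0" "T \<ge> 1" by auto
      let ?e = "1 + \<delta>1 + \<gamma> * real n * (1 + \<delta>2)"
      have VF': "T powr ?e \<le> VF T" using elim(1) by (simp add: powr_add)
      have pos: "0 < T powr ?e" using T by simp
      have num: "T powr (\<gamma> * real n) * T * (T powr (\<gamma> * \<beta>2)) ^ n * T powr \<beta>1 = T powr (\<gamma> * real n + 1 + \<gamma> * \<beta>2 * real n + \<beta>1)"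
        using T by (simp add: powr_add powr_power mult.commute[of "real n"])
      have "exp ((u T)\<^sup>2) \<le> exp (c * ln T)" using elim(2) by simp
      also have "\<dots> = T powr c" using T by (simp add: powr_def)
      finally have eu: "exp ((u T)\<^sup>2) \<le> T powr c" .
      have phi: "1 / (std_normal_density (u T))\<^sup>2 = 2 * pi * exp ((u T)\<^sup>2)"
        unfolding power2_eq_square[of "std_normal_density (u T)"] std_normal_density_mult
        by (simp add: exp_minus field_simps)
      have "?near T = k * T powr (\<gamma> * real n + 1 + \<gamma> * \<beta>2 * real n + \<beta>1) * (1 / (std_normal_density (u T))\<^sup>2) / VF T"
        unfolding num[symmetric] by (simp add: mult.assoc)
      also have "\<dots> \<le> k * T powr (\<gamma> * real n + 1 + \<gamma> * \<beta>2 * real n + \<beta>1) * (2 * pi * T powr c) / T powr ?e"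
        unfolding phi using par eu VF' pos by (intro frac_le mult_left_mono mult_nonneg_nonneg) auto
      also have "\<dots> = k * (2 * pi) * T powr (\<gamma> * real n + 1 + \<gamma> * \<beta>2 * real n + \<beta>1 + c - ?e)"
      proof -
        have "T powr (x + c - y) = T powr x * T powr c / T powr y" for x y
          by (simp only: powr_add powr_diff)
        then show ?thesis by (simp only: mult_ac times_divide_eq_right times_divide_eq_left)
      qed
      also have "\<dots> \<le> k * (2 * pi) * T powr (- c)"
      proof (intro mult_left_mono powr_mono)
        \<comment> \<open>The spatial gain can be 0, as \<open>\<gamma>\<close> can be; the decay
          comes from time, where \<open>\<beta>1 - \<delta>1 = - 2 * c\<close>.\<close>
        have "\<gamma> * real n * (\<beta>2 - \<delta>2) \<le> 0" using par by (intro mult_nonneg_nonpos) auto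
        then show "\<gamma> * real n + 1 + \<gamma> * \<beta>2 * real n + \<beta>1 + c - ?e \<le> - c"
          unfolding c_def by (simp add: algebra_simps)
      qed (use T par in auto)
      finally show ?case .
    qed
    show "((\<lambda>T. k * (2 * pi) * T powr (- c)) \<longlongrightarrow> 0) at_top"
      using tendsto_mult_right_zero[OF tendsto_neg_powr[OF _ filterlim_ident], of "- c" "k * (2 * pi)"] c by simp
  qed
  have "\<forall>\<^sub>F T in at_top. ?near T + (exp ((u T)\<^sup>2 * eps T) / sqrt (1 - (eps T)\<^sup>2) - 1) =
    (k * T powr (\<gamma> * real n) * T * (T powr (\<gamma> * \<beta>2)) ^ n * T powr \<beta>1 +
      (std_normal_density (u T))\<^sup>2 * (exp ((u T)\<^sup>2 * eps T) / sqrt (1 - (eps T)\<^sup>2) - 1) * VF T)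
      / ((std_normal_density (u T))\<^sup>2 * VF T)"
    using VF eventually_gt_at_top[of 0]
  proof eventually_elim
    case (elim T)
    have "0 < T powr (1 + \<delta>1) * T powr (\<gamma> * real n * (1 + \<delta>2))" using elim(2) by simp
    with elim(1) have "VF T > 0" by linarith
    moreover have "std_normal_density (u T) > 0" by (rule normal_density_pos) simp
    ultimately show ?case by (simp add: add_divide_distrib)
  qed
  then show ?thesis
    using tendsto_add[OF near far] by (simp add: tendsto_cong)
qed

section \<open>Homothetic scaling and uniform continuity by stationarity\<close>

lemma homothetic_facts:
  fixes K :: "(real^'d) set"
  assumes K: "convex_body K" and T: "T > 0"
  shows "homothetic \<gamma> T K \<in> sets borel" and "bounded (homothetic \<gamma> T K)"
    and "measure lborel (homothetic \<gamma> T K) = T powr (\<gamma> * real CARD('d)) * measure lborel K"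
    and "measure lborel (homothetic \<gamma> T K) > 0"
proof -
  let ?c = "T powr \<gamma>"
  have c: "?c > 0" using T by simp
  have "compact K" using K by (simp add: convex_body_def)
  then have comp: "compact (homothetic \<gamma> T K)" unfolding homothetic_def by (rule compact_scaling)
  then show b: "homothetic \<gamma> T K \<in> sets borel" and "bounded (homothetic \<gamma> T K)"
    by (auto intro: borel_compact compact_imp_bounded)
  have vim: "{x. 0 + ?c *\<^sub>R x \<in> homothetic \<gamma> T K} = K"
    using c by (auto simp: homothetic_def)
  have "emeasure lborel (homothetic \<gamma> T K) = ennreal (\<bar>?c\<bar> ^ DIM(real^'d)) * emeasure lborel K"
    using emeasure_lborel_affine_vimage[OF b, of ?c 0] c unfolding vim by simp
  then show m: "measure lborel (homothetic \<gamma> T K) = T powr (\<gamma> * real CARD('d)) * measure lborel K"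
    using T by (simp add: measure_def enn2real_mult powr_power mult.commute)
  \<comment> \<open>A ball around an interior point makes the volume positive.\<close>
  obtain x where "x \<in> interior K" using K by (auto simp: convex_body_def)
  then obtain e where e: "e > 0" "cball x e \<subseteq> K" by (auto simp: mem_interior_cball)
  have "0 < measure lborel (cball x e)" using e by (simp add: content_cball)
  also have "\<dots> \<le> measure lborel K"
    using e \<open>compact K\<close> emeasure_compact_finite[of K]
    by (intro measure_mono_fmeasurable fmeasurableI) (auto intro: borel_compact)
  finally show "measure lborel (homothetic \<gamma> T K) > 0" unfolding m using T by simp
qed

lemma variance_formula_eq:
  fixes K :: "(real^'d) set"
  assumes K: "convex_body K" and T: "T > 0"
  shows "variance_formula C K \<gamma> T = double_cov C (homothetic \<gamma> T K) T"
proof -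
  have "T powr (2 * \<gamma> * real CARD('d)) = (T powr (\<gamma> * real CARD('d)))\<^sup>2"
    using T by (simp add: powr_power mult_ac)
  then show ?thesis
    unfolding variance_formula_def double_cov_def homothetic_facts(3)[OF K T]
    by (simp add: power_mult_distrib mult_ac)
qed

text \<open>The increment variance depends on the lag alone, so any increment can be moved to the
  origin, where the modulus of continuity is taken.\<close>

lemma ms_continuous_stationary:
  fixes Z :: "'a::euclidean_space \<Rightarrow> real \<Rightarrow> 'w \<Rightarrow> real"
  assumes cont: "ms_continuous_field M Z"
    and sq: "\<And>p q. (\<integral>w. (Z (fst p) (snd p) w - Z (fst q) (snd q) w)\<^sup>2 \<partial>M) = D (norm (fst p - fst q)) \<bar>snd p - snd q\<bar>"
  shows "ms_uniformly_continuous M (\<lambda>p. Z (fst p) (snd p))"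
  unfolding ms_uniformly_continuous_def
proof (intro allI impI)
  fix \<epsilon> :: real assume "\<epsilon> > 0"
  let ?f = "\<lambda>p :: 'a \<times> real. \<integral>w. (Z (fst p) (snd p) w - Z 0 0 w)\<^sup>2 \<partial>M"
  have "(?f \<longlongrightarrow> 0) (at (0, 0))"
    using cont unfolding ms_continuous_field_def by (simp add: case_prod_unfold)
  from tendstoD[OF this \<open>\<epsilon> > 0\<close>] obtain d where d: "d > 0" "\<And>p. p \<noteq> (0, 0) \<Longrightarrow> dist p (0, 0) < d \<Longrightarrow> dist (?f p) 0 < \<epsilon>"
    unfolding eventually_at by blast
  have "(\<integral>w. (Z (fst p) (snd p) w - Z (fst q) (snd q) w)\<^sup>2 \<partial>M) \<le> \<epsilon>" if "dist p q \<le> d / 2" for p q :: "'a \<times> real"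
  proof (cases "p = q")
    case True
    then show ?thesis using \<open>\<epsilon> > 0\<close> by simp
  next
    case False
    have "dist (p - q) (0, 0) = dist p q" by (simp add: dist_norm flip: zero_prod_def)
    then have "dist (?f (p - q)) 0 < \<epsilon>"
      using that d(1) False by (intro d(2)) (simp_all flip: zero_prod_def)
    moreover have "?f (p - q) = (\<integral>w. (Z (fst p) (snd p) w - Z (fst q) (snd q) w)\<^sup>2 \<partial>M)"
      using sq[of "p - q" "(0, 0)"] sq[of p q] by simp
    ultimately show ?thesis by (simp add: dist_real_def)
  qed
  then show "\<exists>\<delta>>0. \<forall>p q. dist p q \<le> \<delta> \<longrightarrow> (\<integral>w. (Z (fst p) (snd p) w - Z (fst q) (snd q) w)\<^sup>2 \<partial>M) \<le> \<epsilon>"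
    using d(1) by (intro exI[of _ "d / 2"]) auto
qed

section \<open>The limit theorem for sojourn measures\<close>

theorem theorem4:
  fixes M :: "'w measure"
    and Z :: "real^'d \<Rightarrow> real \<Rightarrow> 'w \<Rightarrow> real"
    and K :: "(real^'d) set"
    and C :: "real \<Rightarrow> real \<Rightarrow> real"
    and u :: "real \<Rightarrow> real"
    and \<gamma> \<delta>1 \<delta>2 \<beta>1 \<beta>2 :: real
  assumes "prob_space M"
    and "CARD('d) \<ge> 2"
    and "convex_body K" and "0 \<in> K"
    and "\<gamma> \<ge> 0"
    \<comment> \<open>the field\<close>
    and "measurable_field M Z"
    and "ms_continuous_field M Z"
    and "gaussian_field M Z"
    and "homogeneous_in_space M Z"
    and "isotropic_in_space M Z"
    and "stationary_in_time M Z"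
    and "\<And>x t. prob_space.expectation M (Z x t) = 0"
    and "\<And>x t. prob_space.expectation M (\<lambda>\<omega>. (Z x t \<omega>)\<^sup>2) = 1"
    and "\<And>x y t s. prob_space.expectation M (\<lambda>\<omega>. Z x t \<omega> * Z y s \<omega>) = C (norm (x - y)) \<bar>t - s\<bar>"
    and "\<And>z \<tau>. z \<ge> 0 \<Longrightarrow> \<tau> \<ge> 0 \<Longrightarrow> C z \<tau> \<ge> 0"
    \<comment> \<open>long-range dependence\<close>
    and "((\<lambda>(z, \<tau>). C z \<tau>) \<longlongrightarrow> 0)
           (inf (filtercomap (\<lambda>(z, \<tau>). max z \<tau>) at_top) (principal ({0..} \<times> {0..})))"
    and "\<delta>1 \<in> {0<..<1}" and "\<delta>2 \<in> {0<..<1}"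
    and "filterlim (\<lambda>T. linear_variance M Z K \<gamma> T /
           (T powr (1 + \<delta>1) * T powr (\<gamma> * real CARD('d) * (1 + \<delta>2)))) at_top at_top"
    \<comment> \<open>the level\<close>
    and "continuous_on {0<..} u"
    and "filterlim u at_top at_top"
    and "(\<lambda>T. (u T)\<^sup>2) \<in> o[at_top](\<lambda>T. ln T)"
    and "\<beta>1 \<in> {0<..<\<delta>1}" and "\<beta>2 \<in> {0<..<\<delta>2}"
    and "((\<lambda>T. (u T)\<^sup>2 * (SUP (z, \<tau>)\<in>far_region \<gamma> \<beta>1 \<beta>2 T. C z \<tau>)) \<longlongrightarrow> 0) at_top"
  shows "converges_in_distribution M
           (\<lambda>T \<omega>. (sojourn_functional M Z K \<gamma> u T \<omega>
                     - T powr (1 + \<gamma> * real CARD('d)) * measure lborel K * (1 - std_normal_cdf (u T)))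
                  / (std_normal_density (u T) * sqrt (variance_formula C K \<gamma> T)))
           std_normal_distribution \<and>
         converges_in_distribution M
           (\<lambda>T \<omega>. linear_functional M Z K \<gamma> T \<omega> / sqrt (variance_formula C K \<gamma> T))
           std_normal_distribution"
proof -
  interpret prob_space M by fact
  note K = \<open>convex_body K\<close> and \<gamma> = \<open>\<gamma> \<ge> 0\<close>
  note mean = assms(12) and sq = assms(13) and cov = assms(14) and C_nn = assms(15)
  note lrd = assms(19) and u_top = assms(21) and u_ln = assms(22) and sup_lim = assms(25)
  let ?X = "\<lambda>p. Z (fst p) (snd p)"
  let ?d = "CARD('d)"
  have gaussX: "gaussian_rv M (\<lambda>w. \<Sum>p\<in>F. a p * ?X p w)" if "finite F" for F a
    using \<open>gaussian_field M Z\<close> that unfolding gaussian_field_def by (simp add: case_prod_unfold)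
  have Z_meas: "Z x t \<in> borel_measurable M" for x t
    using gaussian_rv_measurable[OF gaussX[of "{(x, t)}" "\<lambda>_. 1"]] by simp
  have Zsq: "(\<integral>w. (Z x t w - Z y s w)\<^sup>2 \<partial>M) = 2 - 2 * C (norm (x - y)) \<bar>t - s\<bar>" for x y t s
  proof -
    have "integrable M (\<lambda>w. Z x t w * Z y s w)"
      by (rule integrable_mult_squares[OF Z_meas Z_meas square_integrableI[OF sq] square_integrableI[OF sq]])
    moreover have "(Z x t w - Z y s w)\<^sup>2 = (Z x t w)\<^sup>2 + (Z y s w)\<^sup>2 - 2 * (Z x t w * Z y s w)" for w
      by (simp add: power2_diff)
    ultimately show ?thesis using square_integrableI[OF sq] by (simp add: sq cov)
  qed
  interpret F: stationary_gaussian_field M ?X C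
  proof unfold_locales
    have "(\<lambda>(p, w). ?X p w) = (\<lambda>((x, t), w). Z x t w)" by auto
    then show "(\<lambda>(p, w). ?X p w) \<in> borel_measurable (borel \<Otimes>\<^sub>M M)"
      using \<open>measurable_field M Z\<close> unfolding measurable_field_def borel_prod by simp
    show "ms_uniformly_continuous M ?X"
      by (rule ms_continuous_stationary[OF \<open>ms_continuous_field M Z\<close>, where D="\<lambda>z \<tau>. 2 - 2 * C z \<tau>"]) (rule Zsq)
  qed (use gaussX mean sq cov C_nn in auto)
  define A where "A T = homothetic \<gamma> T K" for T
  define VF where "VF T = variance_formula C K \<gamma> T" for T
  define L where "L T = linear_functional M Z K \<gamma> T" for T
  define S where "S T = sojourn_functional M Z K \<gamma> u T" for T
  define Q where "Q T = std_normal_density (u T)" for T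
  define IX where "IX T w = (\<integral>p. ?X p w \<partial>lborel_on (A T \<times> {0..T}))" for T w
  define IR where "IR T w = (\<integral>p. rank_one_remainder (u T) (?X p w) \<partial>lborel_on (A T \<times> {0..T}))" for T w
  have A: "A T \<in> sets borel" "bounded (A T)" "measure lborel (A T) = T powr (\<gamma> * real ?d) * measure lborel K" "measure lborel (A T) > 0"
    if "T > 0" for T
    using homothetic_facts[OF K that] by (simp_all add: A_def)
  have VF_eq: "VF T = double_cov C (A T) T" if "T > 0" for T
    unfolding VF_def A_def by (rule variance_formula_eq[OF K that])
  have L_meas: "L T \<in> borel_measurable M" and L_eq: "AE w in M. L T w = IX T w" if T: "T > 0" for T
    using iterated_ms_integral[OF F.X_second_order F.ms_cont A(1)[OF T] A(2)[OF T], of "{0..T}"]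
    by (simp_all add: L_def linear_functional_def IX_def A_def)
  have S_meas: "S T \<in> borel_measurable M"
    and S_eq: "AE w in M. S T w = (\<integral>p. indicator {u T..} (?X p w) \<partial>lborel_on (A T \<times> {0..T}))" if T: "T > 0" for T
    using iterated_ms_integral[OF F.exceedance_second_order F.exceedance_ms_continuous A(1)[OF T] A(2)[OF T], of "{0..T}"]
    by (simp_all add: S_def sojourn_functional_def A_def)
  have IX_meas: "IX T \<in> borel_measurable M" if "T > 0" for T
    unfolding IX_def[abs_def] by (rule F.field_integral(2)[OF A(1,2,4)[OF that] that F.X_second_order])
  \<comment> \<open>The growth condition is stated for the variance of the chosen version of the
    linear functional; this transfers it to the explicit formula in the normalisation.\<close>
  have lin_var: "linear_variance M Z K \<gamma> T = VF T" if T: "T > 0" for T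
  proof -
    have "expectation (L T) = expectation (IX T)"
      using L_meas[OF T] IX_meas[OF T] L_eq[OF T] by (intro integral_cong_AE) auto
    also have "\<dots> = 0" unfolding IX_def[abs_def] by (rule F.integral_X_mean[OF A(1,2,4)[OF T] T])
    finally have "variance (L T) = expectation (\<lambda>w. (L T w)\<^sup>2)" by simp
    also have "\<dots> = expectation (\<lambda>w. (IX T w)\<^sup>2)"
      using L_meas[OF T] IX_meas[OF T] L_eq[OF T] by (intro integral_cong_AE) auto
    also have "\<dots> = VF T"
      unfolding IX_def VF_eq[OF T] by (rule F.integral_X_sq[OF A(1,2,4)[OF T] T])
    finally show ?thesis by (simp add: linear_variance_def L_def)
  qed
  \<comment> \<open>A ratio tending to infinity is eventually at least 1, the form that
    \<open>remainder_ratio_tendsto\<close> asks for.\<close>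
  have VF_large: "\<forall>\<^sub>F T in at_top. T powr (1 + \<delta>1) * T powr (\<gamma> * real ?d * (1 + \<delta>2)) \<le> VF T"
    using filterlim_at_top[THEN iffD1, OF lrd, rule_format, of 1] eventually_gt_at_top[of 0]
  proof eventually_elim
    case (elim T)
    then have "0 < T powr (1 + \<delta>1) * T powr (\<gamma> * real ?d * (1 + \<delta>2))" by simp
    then show ?case using elim(1) by (simp only: lin_var[OF elim(2)] le_divide_eq_1_pos)
  qed
  have VF_pos: "\<forall>\<^sub>F T in at_top. VF T > 0"
    using VF_large eventually_gt_at_top[of 0]
  proof eventually_elim
    case (elim T)
    then have "0 < T powr (1 + \<delta>1) * T powr (\<gamma> * real ?d * (1 + \<delta>2))" by simp
    then show ?case using elim(1) by linarith
  qed
  have Y: "\<forall>\<^sub>F T in at_top. (\<lambda>w. L T w / sqrt (VF T)) \<in> borel_measurable M \<and>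
      distr M borel (\<lambda>w. L T w / sqrt (VF T)) = std_normal_distribution"
    using VF_pos eventually_gt_at_top[of 0]
  proof eventually_elim
    case (elim T)
    note [measurable] = L_meas[OF elim(2)] IX_meas[OF elim(2)]
    have "distr M borel (\<lambda>w. L T w / sqrt (VF T)) = distr M borel (\<lambda>w. IX T w / sqrt (VF T))"
      using L_eq[OF elim(2)] by (intro distr_cong_AE) auto
    also have "\<dots> = std_normal_distribution"
      unfolding IX_def VF_eq[OF elim(2)]
      by (rule F.integral_X_normal[OF A(1,2,4)[OF elim(2)] elim(2)]) (use elim VF_eq in simp)
    finally show ?case by simp
  qed
  \<comment> \<open>The family is compared with itself: its law is exactly standard normal for large
    \<open>T\<close>, and the mean-square difference is 0.\<close>
  have lin_conv: "converges_in_distribution M (\<lambda>T w. L T w / sqrt (VF T)) std_normal_distribution"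
    by (rule converges_in_distribution_perturbation[OF _ Y]) (use Y in \<open>auto elim: eventually_mono\<close>)
  define eps where "eps T = (SUP (z, \<tau>)\<in>far_region \<gamma> \<beta>1 \<beta>2 T. C z \<tau>)" for T
  \<comment> \<open>A real supremum bounds its values only for sets bounded above; here
    \<open>C \<le> 1\<close> provides the bound.\<close>
  have C_le_eps: "C z \<tau> \<le> eps T" if "0 \<le> z" "0 \<le> \<tau>" "T powr \<beta>1 \<le> \<tau> \<or> T powr (\<gamma> * \<beta>2) \<le> z" for z \<tau> T
  proof -
    have "bdd_above ((\<lambda>(z, \<tau>). C z \<tau>) ` far_region \<gamma> \<beta>1 \<beta>2 T)"
      by (rule bdd_aboveI[of _ 1]) (auto simp: far_region_def F.C_le_1)
    moreover have "(z, \<tau>) \<in> far_region \<gamma> \<beta>1 \<beta>2 T" using that by (simp add: far_region_def)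
    ultimately show ?thesis unfolding eps_def by (metis (mono_tags, lifting) cSUP_upper case_prod_conv)
  qed
  have eps_nn: "0 \<le> eps T" for T
    using C_le_eps[of 0 "T powr \<beta>1" T] C_nn[of 0 "T powr \<beta>1"] by simp
  have eps_lim: "((\<lambda>T. (u T)\<^sup>2 * eps T) \<longlongrightarrow> 0) at_top"
    using sup_lim unfolding eps_def .
  have u_ge: "\<forall>\<^sub>F T in at_top. 1 \<le> u T"
    using filterlim_at_top[THEN iffD1, OF u_top, rule_format, of 1] .
  \<comment> \<open>The far bound needs correlations below 1. For \<open>u T \<ge> 1\<close>,
    \<open>eps T\<close> is at most \<open>(u T)\<^sup>2 * eps T\<close>, which tends to 0.\<close>
  have eps_lt: "\<forall>\<^sub>F T in at_top. eps T < 1"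
    using order_tendstoD(2)[OF eps_lim, of 1, simplified] u_ge
  proof eventually_elim
    case (elim T)
    then have "1 * eps T \<le> (u T)\<^sup>2 * eps T" using eps_nn by (intro mult_right_mono) simp_all
    then show ?case using elim by simp
  qed
  \<comment> \<open>The constant of \<open>near_measure\<close> without powers of \<open>T\<close>:
    2 from the symmetric time window, the unit ball volume from the spatial ball,
    \<open>measure lborel K\<close> from the outer point.\<close>
  define kk where "kk = 2 * measure lborel K * unit_ball_vol (real ?d)"
  define bound where "bound T = (kk * T powr (\<gamma> * real ?d) * T * (T powr (\<gamma> * \<beta>2)) ^ ?d * T powr \<beta>1 +
      (std_normal_density (u T))\<^sup>2 * (exp ((u T)\<^sup>2 * eps T) / sqrt (1 - (eps T)\<^sup>2) - 1) * VF T)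
      / ((std_normal_density (u T))\<^sup>2 * VF T)" for T
  have bound_lim: "(bound \<longlongrightarrow> 0) at_top"
    unfolding bound_def[abs_def]
    by (rule remainder_ratio_tendsto[OF VF_large u_top u_ln _ eps_lim \<gamma>])
      (use assms(23,24) eps_nn in \<open>auto simp: kk_def\<close>)
  define W where "W T w = (S T w - T powr (1 + \<gamma> * real ?d) * measure lborel K * (1 - std_normal_cdf (u T))) / (Q T * sqrt (VF T))" for T w
  have diff: "\<forall>\<^sub>F T in at_top. integrable M (\<lambda>w. (W T w - L T w / sqrt (VF T))\<^sup>2) \<and>
      expectation (\<lambda>w. (W T w - L T w / sqrt (VF T))\<^sup>2) \<le> bound T"
    using VF_pos eventually_gt_at_top[of 0] u_ge eps_lt
  proof eventually_elim
    case (elim T)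
    then have T: "T > 0" and u0: "0 \<le> u T" by auto
    note AT = A(1,2,4)[OF T] T
    note [measurable] = L_meas[OF T] S_meas[OF T]
    have IR_sq: "integrable M (\<lambda>w. (IR T w)\<^sup>2)" and [measurable]: "IR T \<in> borel_measurable M"
      unfolding IR_def[abs_def] by (rule F.field_integral(3,2)[OF AT F.remainder_second_order[OF u0]])+
    have Qp: "Q T > 0" unfolding Q_def by (rule normal_density_pos) simp
    have mT: "measure lborel (A T) * T = T powr (1 + \<gamma> * real ?d) * measure lborel K"
      using T by (simp add: A(3) powr_add)
    \<comment> \<open>The factor \<open>Q T\<close> of the projection cancels against the
      normalisation, so the two normalised functionals differ by the normalised remainder integral
      alone.\<close>
    have AE: "AE w in M. (W T w - L T w / sqrt (VF T))\<^sup>2 = (IR T w)\<^sup>2 / ((Q T)\<^sup>2 * VF T)"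
      using F.sojourn_decomposition[OF AT u0] S_eq[OF T] L_eq[OF T]
    proof eventually_elim
      case (elim w)
      have "S T w - T powr (1 + \<gamma> * real ?d) * measure lborel K * (1 - std_normal_cdf (u T)) = IR T w + Q T * L T w"
        using elim unfolding mT std_normal_tail_eq by (simp add: IR_def Q_def IX_def)
      then have "W T w - L T w / sqrt (VF T) = IR T w / (Q T * sqrt (VF T))"
        unfolding W_def using Qp by (simp add: add_divide_distrib)
      then show ?case using \<open>VF T > 0\<close> by (simp add: power_divide power_mult_distrib)
    qed
    have [measurable]: "(\<lambda>w. W T w) \<in> borel_measurable M" unfolding W_def by measurable
    have int: "integrable M (\<lambda>w. (W T w - L T w / sqrt (VF T))\<^sup>2)"
      by (rule integrable_cong_AE_imp[OF integrable_divide[OF IR_sq, of "(Q T)\<^sup>2 * VF T"]]) (use AE in auto)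
    have "expectation (\<lambda>w. (W T w - L T w / sqrt (VF T))\<^sup>2) = expectation (\<lambda>w. (IR T w)\<^sup>2 / ((Q T)\<^sup>2 * VF T))"
      using AE by (intro integral_cong_AE) auto
    also have "\<dots> = expectation (\<lambda>w. (IR T w)\<^sup>2) / ((Q T)\<^sup>2 * VF T)" by simp
    also have "\<dots> \<le> bound T"
      unfolding bound_def Q_def[symmetric]
    proof (rule divide_right_mono)
      have "expectation (\<lambda>w. (IR T w)\<^sup>2) \<le>
        measure lborel (A T) * T * (unit_ball_vol (DIM(real^'d)) * (T powr (\<gamma> * \<beta>2)) ^ DIM(real^'d) * (2 * T powr \<beta>1)) +
        (std_normal_density (u T))\<^sup>2 * (exp ((u T)\<^sup>2 * eps T) / sqrt (1 - (eps T)\<^sup>2) - 1) * double_cov C (A T) T"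
        unfolding IR_def
        by (rule F.remainder_integral_sq[OF AT u0 \<open>eps T < 1\<close>]) (auto intro: C_le_eps)
      then show "expectation (\<lambda>w. (IR T w)\<^sup>2) \<le> kk * T powr (\<gamma> * real ?d) * T * (T powr (\<gamma> * \<beta>2)) ^ ?d * T powr \<beta>1 +
        (Q T)\<^sup>2 * (exp ((u T)\<^sup>2 * eps T) / sqrt (1 - (eps T)\<^sup>2) - 1) * VF T"
        unfolding VF_eq[OF T] Q_def A(3)[OF T] kk_def by (simp add: mult_ac)
    qed (use \<open>VF T > 0\<close> in simp)
    finally show ?case using int by simp
  qed
  have W_conv: "converges_in_distribution M W std_normal_distribution"
  proof (rule converges_in_distribution_perturbation[OF _ Y])
    show "\<forall>\<^sub>F T in at_top. W T \<in> borel_measurable M"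
      using eventually_gt_at_top[of 0]
    proof eventually_elim
      case (elim T)
      note [measurable] = S_meas[OF elim]
      show ?case unfolding W_def[abs_def] by measurable
    qed
    show "\<forall>\<^sub>F T in at_top. integrable M (\<lambda>w. (W T w - L T w / sqrt (VF T))\<^sup>2)"
      using diff by (auto elim: eventually_mono)
    show "((\<lambda>T. expectation (\<lambda>w. (W T w - L T w / sqrt (VF T))\<^sup>2)) \<longlongrightarrow> 0) at_top"
    proof (rule tendsto_sandwich[OF _ _ tendsto_const bound_lim])
      show "\<forall>\<^sub>F T in at_top. expectation (\<lambda>w. (W T w - L T w / sqrt (VF T))\<^sup>2) \<le> bound T"
        using diff by eventually_elim simp
    qed simp
  qed
  show ?thesis
    using W_conv lin_conv unfolding W_def[abs_def] L_def S_def Q_def VF_def by simp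
qed

end
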